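(* Let $0<c<1$ and $Z>0$. If $\beta\in\dot C^1[0,Z]$, then the initial boundary value problem $$\mathbf M_t=A\mathbf M_z+\beta B\mathbf M,\quad z\ge 0,\ t\in\mathbb R,$$ $$M_2(0,t)=\delta(t),\quad M_4(0,t)=0,\quad t\in\mathbb R,$$ $$\mathbf M(z,t)=\mathbf 0,\quad t<0,\ z\ge 0,$$ has a unique solution, on the region $\{(z,t): 0\le z\le Z,\ z+t\le 2Z\}$, $$\mathbf M(z,t)=\delta(t-z)\,[0,1,0,0]+\mathbf m(z,t)\,H(t-z),$$ where $\mathbf m(z,t)$ is the unique $C^1$ solution of the characteristic boundary value problem $$\mathbf m_t=A\mathbf m_z+\beta B\mathbf m\quad\text{on } 0\le z\le t\le 2Z-z,$$ $$m_2(0,t)=m_4(0,t)=0,\quad 0\le t\le 2Z,$$ $$m_1(z,z)=0,\quad m_3(z,z)=\frac{c-1}{2(c+1)}\beta(z),\quad m_4(z,z)=\frac{c+1}{2(c-1)}\beta(z),\quad 0\le z\le Z.$$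
   Context: $\dot C^1[0,Z]=\{\beta\in C^1[0,Z] : \beta(0)=0,\ \beta'(0)=0\}$, with $\beta$ real valued. $\mathbf M=[M_1,M_2,M_3,M_4]^T$ and $\mathbf m=[m_1,m_2,m_3,m_4]^T$ are four-component vectors (and $[0,1,0,0]$ is regarded as such a vector); the solution $\mathbf M$ is a distribution. $\delta$ is the Dirac delta and $H$ is the Heaviside function. The matrices are $$A=\mathrm{diag}(1,-1,c,-c),\qquad B=\frac12\begin{bmatrix}0&0&-1-c&-1+c\\0&0&1-c&1+c\\1+c&-1+c&0&0\\1-c&-1-c&0&0\end{bmatrix}.$$ *)

theory Defs
  imports "HOL-Analysis.Analysis"
begin

section \<open>Test functions and distributions\<close>

definition partial :: "'a::euclidean_space \<Rightarrow> ('a \<Rightarrow> real) \<Rightarrow> 'a \<Rightarrow> real" where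
  "partial v f = (\<lambda>x. frechet_derivative f (at x) v)"

definition partials :: "'a::euclidean_space list \<Rightarrow> ('a \<Rightarrow> real) \<Rightarrow> 'a \<Rightarrow> real" where
  "partials vs f = foldr partial vs f"

definition smooth :: "('a::euclidean_space \<Rightarrow> real) \<Rightarrow> bool" where
  "smooth f \<longleftrightarrow> (\<forall>vs. set vs \<subseteq> Basis \<longrightarrow> (\<forall>x. partials vs f differentiable (at x)))"

definition supp :: "('a::euclidean_space \<Rightarrow> real) \<Rightarrow> 'a set" where
  "supp f = closure {x. f x \<noteq> 0}"

definition test_functions :: "'a::euclidean_space set \<Rightarrow> ('a \<Rightarrow> real) set" where
  "test_functions S = {\<phi>. smooth \<phi> \<and> compact (supp \<phi>) \<and> supp \<phi> \<subseteq> S}"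

text \<open>A distribution on the open set \<open>S\<close> is represented by a functional on all functions, of which
  only the values on test functions are meaningful. Values may lie in a normed space, so that a
  vector of distributions is a single vector-valued distribution. In the continuity estimate, \<open>b\<close> is
  any common bound for the partial derivatives of order at most \<open>N\<close>.\<close>

definition distribution_on ::
    "'a::euclidean_space set \<Rightarrow> (('a \<Rightarrow> real) \<Rightarrow> 'b::real_normed_vector) \<Rightarrow> bool" where
  "distribution_on S u \<longleftrightarrow>
     (\<forall>\<phi>\<in>test_functions S. \<forall>\<psi>\<in>test_functions S. u (\<lambda>x. \<phi> x + \<psi> x) = u \<phi> + u \<psi>) \<and>
     (\<forall>\<phi>\<in>test_functions S. \<forall>a. u (\<lambda>x. a * \<phi> x) = a *\<^sub>R u \<phi>) \<and>
     (\<forall>K. compact K \<and> K \<subseteq> S \<longrightarrow>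
        (\<exists>C N. \<forall>\<phi>\<in>test_functions S. \<forall>b. supp \<phi> \<subseteq> K \<longrightarrow>
           (\<forall>vs x. set vs \<subseteq> Basis \<and> length vs \<le> N \<longrightarrow> \<bar>partials vs \<phi> x\<bar> \<le> b) \<longrightarrow>
           norm (u \<phi>) \<le> C * b))"

definition dist_deriv ::
    "'a::euclidean_space \<Rightarrow> (('a \<Rightarrow> real) \<Rightarrow> 'b::real_normed_vector) \<Rightarrow> ('a \<Rightarrow> real) \<Rightarrow> 'b" where
  "dist_deriv v u = (\<lambda>\<psi>. - u (partial v \<psi>))"

definition dirac :: "real \<Rightarrow> (real \<Rightarrow> real) \<Rightarrow> real" where
  "dirac a = (\<lambda>\<phi>. \<phi> a)"

definition regular_dist :: "(real \<Rightarrow> 'b::euclidean_space) \<Rightarrow> (real \<Rightarrow> real) \<Rightarrow> 'b" where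
  "regular_dist f = (\<lambda>\<phi>. integral UNIV (\<lambda>t. \<phi> t *\<^sub>R f t))"

definition heaviside :: "real \<Rightarrow> real" where
  "heaviside s = (if s < 0 then 0 else 1)"

section \<open>Coefficients\<close>

definition matA :: "real \<Rightarrow> real^4^4" where
  "matA c = (\<chi> i j. if i = j then (vector [1, -1, c, -c] :: real^4) $ i else 0)"

definition matB :: "real \<Rightarrow> real^4^4" where
  "matB c = (1/2) *\<^sub>R vector
     [vector [0, 0, -1 - c, -1 + c],
      vector [0, 0, 1 - c, 1 + c],
      vector [1 + c, -1 + c, 0, 0],
      vector [1 - c, -1 - c, 0, 0]]"

text \<open>Derivatives are taken within \<open>S\<close>, hence one-sided at end points.\<close>

definition C1_deriv_on :: "real set \<Rightarrow> (real \<Rightarrow> real) \<Rightarrow> (real \<Rightarrow> real) \<Rightarrow> bool" where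
  "C1_deriv_on S f f' \<longleftrightarrow>
     (\<forall>x\<in>S. (f has_real_derivative f' x) (at x within S)) \<and> continuous_on S f'"

definition C1_on :: "real set \<Rightarrow> (real \<Rightarrow> real) \<Rightarrow> bool" where
  "C1_on S f \<longleftrightarrow> (\<exists>f'. C1_deriv_on S f f')"

definition C1_dot :: "real \<Rightarrow> (real \<Rightarrow> real) set" where
  "C1_dot Z = {\<beta>. \<exists>\<beta>'. C1_deriv_on {0..Z} \<beta> \<beta>' \<and> \<beta> 0 = 0 \<and> \<beta>' 0 = 0}"

section \<open>The characteristic boundary value problem\<close>

definition char_region :: "real \<Rightarrow> (real \<times> real) set" where
  "char_region Z = {(z, t). 0 \<le> z \<and> z \<le> t \<and> t \<le> 2 * Z - z}"

definition char_solution ::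
    "real \<Rightarrow> (real \<Rightarrow> real) \<Rightarrow> real \<Rightarrow> (real \<times> real \<Rightarrow> real^4) \<Rightarrow> bool" where
  "char_solution c \<beta> Z m \<longleftrightarrow>
     (\<exists>mz mt. continuous_on (char_region Z) mz \<and> continuous_on (char_region Z) mt \<and>
        (\<forall>p\<in>char_region Z.
           (m has_derivative (\<lambda>(h, k). h *\<^sub>R mz p + k *\<^sub>R mt p)) (at p within char_region Z) \<and>
           mt p = matA c *v mz p + \<beta> (fst p) *\<^sub>R (matB c *v m p))) \<and>
     (\<forall>t\<in>{0..2 * Z}. m (0, t) $ 2 = 0 \<and> m (0, t) $ 4 = 0) \<and>
     (\<forall>z\<in>{0..Z}. m (z, z) $ 1 = 0 \<and>
        m (z, z) $ 3 = (c - 1) / (2 * (c + 1)) * \<beta> z \<and>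
        m (z, z) $ 4 = (c + 1) / (2 * (c - 1)) * \<beta> z)"

section \<open>The initial boundary value problem\<close>

text \<open>The boundary values at \<open>z = 0\<close> and the product with \<open>\<beta>\<close>, which is only \<open>C\<^sup>1\<close>, are not
  defined for an arbitrary distribution in \<open>(z,t)\<close>. The unknown is therefore a distribution whose
  restriction \<open>M z\<close> to each line \<open>z = const\<close>, a distribution in \<open>t\<close>, exists and depends continuously
  on \<open>z \<ge> 0\<close>; the distribution in \<open>(z,t)\<close> is recovered by integration over \<open>z\<close>
  (\<open>glue\<close>). As the problem is posed for all \<open>z \<ge> 0\<close>, the coefficient here is a function on
  \<open>[0,\<infinity>)\<close>, i.e. some extension of a \<open>\<beta>\<close> that is given on \<open>[0,Z]\<close> only.\<close>

definition glue :: "(real \<Rightarrow> (real \<Rightarrow> real) \<Rightarrow> real^4) \<Rightarrow> (real \<times> real \<Rightarrow> real) \<Rightarrow> real^4" where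
  "glue M \<psi> = integral {0..} (\<lambda>z. M z (\<lambda>t. \<psi> (z, t)))"

definition ibvp_solution ::
    "real \<Rightarrow> (real \<Rightarrow> real) \<Rightarrow> (real \<Rightarrow> (real \<Rightarrow> real) \<Rightarrow> real^4) \<Rightarrow> bool" where
  "ibvp_solution c \<beta> M \<longleftrightarrow>
     (\<forall>z\<ge>0. distribution_on UNIV (M z)) \<and>
     (\<forall>\<phi>\<in>test_functions UNIV. continuous_on {0..} (\<lambda>z. M z \<phi>)) \<and>
     distribution_on ({0<..} \<times> UNIV) (glue M) \<and>
     (\<forall>\<psi>\<in>test_functions ({0<..} \<times> UNIV).
        dist_deriv (0, 1) (glue M) \<psi> =
          matA c *v dist_deriv (1, 0) (glue M) \<psi> +
          matB c *v glue (\<lambda>z \<phi>. \<beta> z *\<^sub>R M z \<phi>) \<psi>) \<and>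
     (\<forall>\<phi>\<in>test_functions UNIV. M 0 \<phi> $ 2 = dirac 0 \<phi> \<and> M 0 \<phi> $ 4 = 0) \<and>
     (\<forall>z\<ge>0. \<forall>\<phi>\<in>test_functions {..<0}. M z \<phi> = 0)"

end

theory Submission
  imports Defs
begin

text \<open>In the coordinates \<open>(z, s)\<close>, \<open>s = t - z\<close>, and with \<open>\<beta>\<close> extended by \<open>0\<close> to \<open>z < 0\<close> (a \<open>C\<^sup>1\<close> extension,
  because \<open>\<beta>(0) = \<beta>'(0) = 0\<close>), the characteristic problem becomes a system of integral equations on the
  whole plane; its Picard series converges in \<open>C\<^sup>1\<close> with respect to exponentially weighted norms.
  Integration by parts in the quadrant \<open>z, s \<ge> 0\<close> shows that \<open>\<delta>(t - z) [0,1,0,0] + m H(t - z)\<close> solves the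
  initial boundary value problem. Conversely, the coefficients do not depend on \<open>t\<close>, so mollifying
  the difference of two distributional solutions in \<open>t\<close> gives a classical solution with zero data, which
  vanishes by integrating along characteristics.\<close>

section \<open>Smooth functions and test functions\<close>

text \<open>Convergence of the Picard series rests on a single weight \<open>om\<close> that drops
  at least at unit rate along all four families of characteristics, run back to their data lines:
  every line integral then gains a factor \<open>1 / \<mu>\<close>. Differentiating such an integral
  leaves a value at the foot of the characteristic that gains nothing; it is absorbed by granting
  derivatives a larger allowance \<open>E\<close>. The data on t = z come from collecting the
  multiples of \<delta>(t - z) in the equation, which gives (I + A) m = \<beta> B [0,1,0,0]. The
  obstacle to uniqueness is that a solution is continuous in z only after pairing with one fixed
  test function, so its order and constants could vary with z, and mollifying in t need not give
  joint regularity; a uniform boundedness principle removes this. Testing the equation with products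
  turns it into an ordinary differential equation in z for each pairing. Beyond z = Z the
  coefficient is arbitrary: each extension has its own solution, and all are compared on the
  triangle where the characteristic problem determines them.\<close>

lemma ex_antiderivative:
  fixes g :: "real \<Rightarrow> real"
  assumes g: "continuous_on UNIV g"
  obtains F where "F a = 0" "\<And>x. (F has_real_derivative g x) (at x)"
proof -
  define F where "F x = (LBINT y=ereal a..ereal x. g y)" for x
  have "(F has_real_derivative g x) (at x)" for x
  proof -
    define l u where "l = min a x - 1" and "u = max a x + 1"
    have "(F has_vector_derivative g x) (at x within {l..u})"
      unfolding F_def
      by (rule interval_integral_FTC2[OF _ _ continuous_on_subset[OF g]]) (auto simp: l_def u_def)
    then show ?thesis
      by (simp add: has_real_derivative_iff_has_vector_derivative at_within_Icc_at l_def u_def)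
  qed
  then show thesis
    by (intro that[of F]) (simp_all add: F_def)
qed

lemma partialI:
  assumes "(f has_derivative f') (at x)"
  shows "partial v f x = f' v"
  using frechet_derivative_at[OF assms] by (simp add: partial_def)

lemma partial_real:
  assumes "(f has_real_derivative d) (at x)"
  shows "partial 1 f x = d"
  using partialI[of f "(*) d" x 1] assms by (simp add: has_field_derivative_def)

lemma bex_derivativeI:
  assumes "\<And>x. (f has_real_derivative g x) (at x)" "g \<in> S"
  shows "\<exists>f'\<in>S. \<forall>x. (f has_real_derivative f' x) (at x)"
  using assms by blast

text \<open>On the line the only basis vector is 1, so all iterated partials of a member stay inside
  a class that is closed under differentiation. Most smoothness proofs on the line thus amount to
  choosing a suitable class \<open>S\<close>.\<close>

lemma smooth_closed_under_derivative:
  assumes S: "\<And>f. f \<in> S \<Longrightarrow> \<exists>f'\<in>S. \<forall>x. (f has_real_derivative f' x) (at x)"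
    and f: "f \<in> S"
  shows "smooth f"
proof -
  have D: "partial 1 g \<in> S" if g: "g \<in> S" for g
  proof -
    obtain g' where "g' \<in> S" "\<forall>x. (g has_real_derivative g' x) (at x)" using S[OF g] by (elim bexE)
    moreover from this have "partial 1 g = g'" using partial_real by blast
    ultimately show ?thesis by simp
  qed
  have "partials vs f \<in> S" if "set vs \<subseteq> Basis" for vs
    using that by (induction vs) (auto simp: partials_def f intro: D)
  then show ?thesis
    unfolding smooth_def using S by (meson real_differentiable_def)
qed

lemma smooth_partial:
  assumes "smooth f" "v \<in> Basis"
  shows "smooth (partial v f)"
  unfolding smooth_def
proof (intro allI impI)
  fix vs x assume "set vs \<subseteq> (Basis :: 'a set)"
  with assms have "partials (vs @ [v]) f differentiable (at x)"
    unfolding smooth_def by simp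
  then show "partials vs (partial v f) differentiable (at x)"
    by (simp add: partials_def)
qed

lemma smooth_has_derivative:
  assumes "smooth f"
  shows "(f has_derivative (\<lambda>v. partial v f x)) (at x)"
proof -
  have "f differentiable (at x)"
    using assms unfolding smooth_def by (metis empty_subsetI foldr.simps(1) id_apply list.set(1) partials_def)
  then show ?thesis
    unfolding partial_def by (metis (no_types) eta_contract_eq frechet_derivative_works)
qed

lemma smooth_continuous: "smooth f \<Longrightarrow> continuous_on S f"
  by (intro continuous_at_imp_continuous_on ballI) (rule has_derivative_continuous[OF smooth_has_derivative])

lemma smooth_real_derivative:
  fixes f :: "real \<Rightarrow> real"
  assumes "smooth f"
  shows "(f has_real_derivative partial 1 f x) (at x)"
proof -
  have f: "(f has_derivative (\<lambda>v. partial v f x)) (at x)" by (rule smooth_has_derivative[OF assms])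
  then obtain d where "(f has_real_derivative d) (at x)"
    using real_differentiable_def differentiable_def by blast
  then show ?thesis using partial_real by metis
qed

lemma smooth_zero: "smooth (\<lambda>x::real. 0)"
  by (rule smooth_closed_under_derivative[of "{\<lambda>x. 0}"]) auto

lemma smooth_affine:
  fixes f :: "real \<Rightarrow> real"
  assumes "smooth f"
  shows "smooth (\<lambda>x. k * f (a * x + b))"
proof (rule smooth_closed_under_derivative[of "{\<lambda>x. k * f (a * x + b) | k f. smooth f}"])
  fix g assume "g \<in> {\<lambda>x. k * f (a * x + b) | k f. smooth f}"
  then obtain k f where g: "g = (\<lambda>x. k * f (a * x + b))" "smooth f" by blast
  have "(g has_real_derivative (k * a) * partial 1 f (a * x + b)) (at x)" for x
    unfolding g(1)
    by (rule derivative_eq_intros DERIV_chain2[OF smooth_real_derivative[OF g(2)]] refl)+ simp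
  moreover have "(\<lambda>x. (k * a) * partial 1 f (a * x + b)) \<in> {\<lambda>x. k * f (a * x + b) | k f. smooth f}"
    using smooth_partial[OF g(2), of 1] by auto
  ultimately show "\<exists>f'\<in>{\<lambda>x. k * f (a * x + b) | k f. smooth f}. \<forall>x. (g has_real_derivative f' x) (at x)"
    by (rule bex_derivativeI)
qed (use assms in blast)

lemma smooth_add:
  fixes f g :: "real \<Rightarrow> real"
  assumes "smooth f" "smooth g"
  shows "smooth (\<lambda>x. f x + g x)"
proof (rule smooth_closed_under_derivative[of "{\<lambda>x. f x + g x | f g. smooth f \<and> smooth g}"])
  fix h :: "real \<Rightarrow> real" assume "h \<in> {\<lambda>x. f x + g x | f g. smooth f \<and> smooth g}"
  then obtain f g where h: "h = (\<lambda>x. f x + g x)" "smooth f" "smooth g" by blast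
  have "(h has_real_derivative partial 1 f x + partial 1 g x) (at x)" for x
    unfolding h(1) by (intro DERIV_add smooth_real_derivative h)
  moreover have "(\<lambda>x. partial 1 f x + partial 1 g x) \<in> {\<lambda>x. f x + g x | f g. smooth f \<and> smooth g}"
    using smooth_partial[OF h(2), of 1] smooth_partial[OF h(3), of 1] by auto
  ultimately show "\<exists>f'\<in>{\<lambda>x. f x + g x | f g. smooth f \<and> smooth g}. \<forall>x. (h has_real_derivative f' x) (at x)"
    by (rule bex_derivativeI)
qed (use assms in blast)

text \<open>Products of smooth functions alone are not closed under differentiation, since the
  Leibniz rule yields a sum of two products; adding finite sums repairs this.\<close>

inductive_set smooth_span :: "(real \<Rightarrow> real) set" where
  prod: "smooth f \<Longrightarrow> smooth g \<Longrightarrow> (\<lambda>x. f x * g x) \<in> smooth_span"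
| add: "f \<in> smooth_span \<Longrightarrow> g \<in> smooth_span \<Longrightarrow> (\<lambda>x. f x + g x) \<in> smooth_span"

lemma smooth_mult:
  fixes f g :: "real \<Rightarrow> real"
  assumes "smooth f" "smooth g"
  shows "smooth (\<lambda>x. f x * g x)"
proof (rule smooth_closed_under_derivative[of smooth_span])
  show "\<exists>h'\<in>smooth_span. \<forall>x. (h has_real_derivative h' x) (at x)" if "h \<in> smooth_span" for h
    using that
  proof induction
    case (prod f g)
    have "((\<lambda>x. f x * g x) has_real_derivative partial 1 f x * g x + f x * partial 1 g x) (at x)" for x
      using DERIV_mult[OF smooth_real_derivative[OF prod(1)] smooth_real_derivative[OF prod(2)], of x]
      by (simp add: ac_simps)
    moreover have "(\<lambda>x. partial 1 f x * g x + f x * partial 1 g x) \<in> smooth_span"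
      by (intro smooth_span.intros smooth_partial prod) auto
    ultimately show ?case by (rule bex_derivativeI)
  next
    case (add f g)
    from add.IH obtain f' g' where *: "f' \<in> smooth_span" "\<And>x. (f has_real_derivative f' x) (at x)"
      "g' \<in> smooth_span" "\<And>x. (g has_real_derivative g' x) (at x)" by blast
    have "((\<lambda>x. f x + g x) has_real_derivative f' x + g' x) (at x)" for x
      by (intro DERIV_add *)
    moreover have "(\<lambda>x. f' x + g' x) \<in> smooth_span" by (intro smooth_span.add *)
    ultimately show ?case by (rule bex_derivativeI)
  qed
qed (intro smooth_span.prod assms)

text \<open>The smooth functions together with \<open>f\<close> are closed under differentiation,
  because the derivative of \<open>f\<close> falls back among the smooth functions.\<close>

lemma smooth_antiderivative:
  assumes g: "smooth g" and f: "\<And>x. (f has_real_derivative g x) (at x)"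
  shows "smooth f"
proof (rule smooth_closed_under_derivative[of "insert f {h. smooth h}"])
  fix h assume "h \<in> insert f {h. smooth h}"
  then show "\<exists>h'\<in>insert f {h. smooth h}. \<forall>x. (h has_real_derivative h' x) (at x)"
    using g f smooth_real_derivative smooth_partial[of h 1] by auto
qed simp

abbreviation dern :: "nat \<Rightarrow> (real \<Rightarrow> real) \<Rightarrow> real \<Rightarrow> real" where
  "dern k \<equiv> partial 1 ^^ k"

lemma partials_real:
  assumes "set vs \<subseteq> (Basis :: real set)"
  shows "partials vs f = dern (length vs) f"
  using assms by (induction vs) (auto simp: partials_def)

lemma smooth_dern:
  fixes f :: "real \<Rightarrow> real"
  assumes "smooth f" shows "smooth (dern k f)"
  by (induction k) (auto simp: assms intro: smooth_partial)

lemma dern_add: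
  assumes "smooth f" "smooth g"
  shows "dern k (\<lambda>x. f x + g x) = (\<lambda>x. dern k f x + dern k g x)"
proof (induction k)
  case (Suc k)
  have "partial 1 (\<lambda>x. dern k f x + dern k g x) x = partial 1 (dern k f) x + partial 1 (dern k g) x" for x
    by (intro partial_real DERIV_add smooth_real_derivative smooth_dern assms)
  then show ?case unfolding funpow.simps o_apply Suc by (rule ext)
qed simp

lemma dern_cmult:
  assumes "smooth f"
  shows "dern k (\<lambda>x. a * f x) = (\<lambda>x. a * dern k f x)"
proof (induction k)
  case (Suc k)
  have "partial 1 (\<lambda>x. a * dern k f x) x = a * partial 1 (dern k f) x" for x
    by (intro partial_real DERIV_cmult smooth_real_derivative smooth_dern assms)
  then show ?case unfolding funpow.simps o_apply Suc by (rule ext)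
qed simp

lemma dern_shift:
  assumes "smooth f"
  shows "dern k (\<lambda>x. f (x - t)) = (\<lambda>x. dern k f (x - t))"
proof (induction k)
  case (Suc k)
  have "partial 1 (\<lambda>x. dern k f (x - t)) x = partial 1 (dern k f) (x - t)" for x
  proof (rule partial_real)
    show "((\<lambda>x. dern k f (x - t)) has_real_derivative partial 1 (dern k f) (x - t)) (at x)"
      using smooth_real_derivative[OF smooth_dern[OF assms, of k], of "x - t"]
        DERIV_shift[of "dern k f" _ x "- t"] by simp
  qed
  then show ?case unfolding funpow.simps o_apply Suc by (rule ext)
qed simp

section \<open>Supports and test functions\<close>

lemma not_in_supp: "x \<notin> supp f \<Longrightarrow> f x = 0"
  using closure_subset[of "{x. f x \<noteq> 0}"] by (auto simp: supp_def)

lemma supp_subset: "closed C \<Longrightarrow> (\<And>x. x \<notin> C \<Longrightarrow> f x = 0) \<Longrightarrow> supp f \<subseteq> C"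
  unfolding supp_def by (rule closure_minimal) auto

lemma test_functionI:
  assumes "smooth f" "compact C" "C \<subseteq> S" "\<And>x. x \<notin> C \<Longrightarrow> f x = 0"
  shows "f \<in> test_functions S"
proof -
  have "supp f \<subseteq> C" by (rule supp_subset) (use assms compact_imp_closed in auto)
  moreover have "compact (supp f)"
    using calculation assms(2) unfolding supp_def
    by (metis closed_closure closed_Int_compact inf.absorb_iff1)
  ultimately show ?thesis using assms by (auto simp: test_functions_def)
qed

lemma test_functionsD:
  assumes "f \<in> test_functions S"
  shows "smooth f" "compact (supp f)" "supp f \<subseteq> S"
  using assms by (auto simp: test_functions_def)

lemma test_functions_mono: "S \<subseteq> T \<Longrightarrow> test_functions S \<subseteq> test_functions T"
  by (auto simp: test_functions_def)

lemma partial_outside_supp: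
  assumes "x \<notin> supp f" shows "partial v f x = 0"
proof -
  have "open (- supp f)" unfolding supp_def by (intro open_Compl closed_closure)
  moreover have "((\<lambda>x. 0) has_derivative (\<lambda>v. 0)) (at x)" by simp
  ultimately have "(f has_derivative (\<lambda>v. 0)) (at x)"
    using has_derivative_transform_within_open[of "\<lambda>x. 0" "\<lambda>v. 0" x UNIV "- supp f" f] assms not_in_supp[of _ f]
    by auto
  then show ?thesis by (rule partialI)
qed

lemma test_functions_partial:
  assumes "f \<in> test_functions S" "v \<in> Basis"
  shows "partial v f \<in> test_functions S"
proof (rule test_functionI[of _ "supp f"])
  show "smooth (partial v f)" by (intro smooth_partial test_functionsD[OF assms(1)] assms)
qed (use test_functionsD[OF assms(1)] in \<open>simp_all add: partial_outside_supp\<close>)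

lemma test_functions_dern:
  fixes f :: "real \<Rightarrow> real"
  shows "f \<in> test_functions S \<Longrightarrow> dern k f \<in> test_functions S"
  by (induction k) (auto intro: test_functions_partial)

lemma test_functions_add:
  fixes f g :: "real \<Rightarrow> real"
  assumes "f \<in> test_functions S" "g \<in> test_functions S"
  shows "(\<lambda>x. f x + g x) \<in> test_functions S"
proof (rule test_functionI[of _ "supp f \<union> supp g"])
  show "smooth (\<lambda>x. f x + g x)" by (intro smooth_add test_functionsD[OF assms(1)] test_functionsD[OF assms(2)])
qed (use test_functionsD[OF assms(1)] test_functionsD[OF assms(2)] in \<open>simp_all add: not_in_supp compact_Un\<close>)

lemma test_function_bounds:
  fixes f :: "real \<Rightarrow> real"
  assumes "f \<in> test_functions S"
  obtains R where "R > 0" "\<And>x. \<bar>x\<bar> > R \<Longrightarrow> f x = 0"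
proof -
  obtain R where "R > 0" "\<And>x. x \<in> supp f \<Longrightarrow> \<bar>x\<bar> \<le> R"
    using compact_imp_bounded[OF test_functionsD(2)[OF assms]] unfolding bounded_pos real_norm_def by blast
  then show thesis using that not_in_supp by (metis not_less)
qed

lemma test_function_bounded:
  fixes f :: "real \<Rightarrow> real"
  assumes "f \<in> test_functions S"
  obtains B where "B \<ge> 0" "\<And>x. \<bar>f x\<bar> \<le> B"
proof -
  have "bounded (f ` supp f)"
    using compact_continuous_image[OF smooth_continuous test_functionsD(2)] assms
    by (metis compact_imp_bounded test_functionsD(1))
  then obtain B where "B > 0" "\<And>x. x \<in> supp f \<Longrightarrow> \<bar>f x\<bar> \<le> B"
    unfolding bounded_pos real_norm_def by blast
  then show thesis using that[of B] not_in_supp[of _ f] by (metis abs_zero less_imp_le)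
qed

lemma test_function_bounded_dern:
  assumes "f \<in> test_functions S"
  obtains B where "B \<ge> 0" "\<And>x k. k \<le> N \<Longrightarrow> \<bar>dern k f x\<bar> \<le> B"
proof -
  have "\<exists>B\<ge>0. \<forall>x. \<bar>dern k f x\<bar> \<le> B" for k
    using test_function_bounded[OF test_functions_dern[OF assms]] by metis
  then obtain B where B: "\<And>k. B k \<ge> 0" "\<And>k x. \<bar>dern k f x\<bar> \<le> B k" by metis
  show thesis
  proof (rule that[of "\<Sum>k\<le>N. B k"])
    show "0 \<le> (\<Sum>k\<le>N. B k)" by (intro sum_nonneg B)
    fix x k assume "k \<le> N"
    then have "B k \<le> (\<Sum>k\<le>N. B k)" by (intro member_le_sum) (auto simp: B)
    then show "\<bar>dern k f x\<bar> \<le> (\<Sum>k\<le>N. B k)" using B(2) order_trans by blast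
  qed
qed

text \<open>The polynomial in 1/x makes the family closed under differentiation, which the classical
  exp(-1/x), here \<open>flat 1\<close>, is not on its own.\<close>

definition flat :: "real poly \<Rightarrow> real \<Rightarrow> real" where
  "flat p x = (if x \<le> 0 then 0 else poly p (1 / x) * exp (- (1 / x)))"

lemma poly_times_exp_neg_tendsto_0:
  fixes p :: "real poly"
  shows "((\<lambda>y. poly p y * exp (- y)) \<longlongrightarrow> 0) at_top"
proof -
  have "((\<lambda>y. \<Sum>i\<le>degree p. coeff p i * (y ^ i / exp y)) \<longlongrightarrow> (\<Sum>i\<le>degree p. coeff p i * 0)) at_top"
    by (intro tendsto_intros tendsto_power_div_exp_0)
  then show ?thesis
    by (simp add: poly_altdef sum_distrib_right exp_minus divide_inverse mult.assoc)
qed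

text \<open>With y = 1/x the derivative of p(y) exp(-y) in x is y^2 (p(y) - p'(y)) exp(-y), and
  \<open>[:0, 0, 1:]\<close> is y^2. At 0 the two one-sided difference quotients are computed
  separately.\<close>

lemma has_derivative_flat:
  "(flat p has_real_derivative flat ([:0, 0, 1:] * (p - pderiv p)) x) (at x)"
proof -
  consider "x < 0" | "x > 0" | "x = 0" by linarith
  then show ?thesis
  proof cases
    case 1
    have "((\<lambda>x. 0) has_real_derivative 0) (at x)" by simp
    then have "(flat p has_real_derivative 0) (at x)"
      by (rule has_field_derivative_transform_within_open[of _ _ _ "{..<0}"]) (use 1 in \<open>auto simp: flat_def\<close>)
    then show ?thesis using 1 by (simp add: flat_def)
  next
    case 2
    have "((\<lambda>x. poly p (1 / x) * exp (- (1 / x))) has_real_derivative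
        (poly (pderiv p) (1 / x) * (- 1 / x\<^sup>2)) * exp (- (1 / x)) + (exp (- (1 / x)) * (1 / x\<^sup>2)) * poly p (1 / x)) (at x)"
    proof (rule DERIV_mult)
      have i: "((\<lambda>x. 1 / x) has_real_derivative - 1 / x\<^sup>2) (at x)"
        using 2 by (auto intro!: derivative_eq_intros simp: power2_eq_square divide_simps)
      show "((\<lambda>x. poly p (1 / x)) has_real_derivative poly (pderiv p) (1 / x) * (- 1 / x\<^sup>2)) (at x)"
        by (rule DERIV_chain2[OF poly_DERIV i])
      have "((\<lambda>x. - (1 / x)) has_real_derivative 1 / x\<^sup>2) (at x)"
        using DERIV_minus[OF i] by simp
      then show "((\<lambda>x. exp (- (1 / x))) has_real_derivative exp (- (1 / x)) * (1 / x\<^sup>2)) (at x)"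
        by (rule DERIV_chain2[OF DERIV_exp])
    qed
    moreover have "(poly (pderiv p) (1 / x) * (- 1 / x\<^sup>2)) * exp (- (1 / x)) + (exp (- (1 / x)) * (1 / x\<^sup>2)) * poly p (1 / x)
        = flat ([:0, 0, 1:] * (p - pderiv p)) x"
    proof -
      have "poly ([:0, 0, 1:] * (p - pderiv p)) (1 / x) = (1 / x\<^sup>2) * (poly p (1 / x) - poly (pderiv p) (1 / x))"
        by (simp add: power2_eq_square)
      then show ?thesis using 2 by (simp add: flat_def left_diff_distrib right_diff_distrib ac_simps)
    qed
    ultimately have "((\<lambda>x. poly p (1 / x) * exp (- (1 / x))) has_real_derivative
       flat ([:0, 0, 1:] * (p - pderiv p)) x) (at x)" by simp
    then show ?thesis
      by (rule has_field_derivative_transform_within_open[of _ _ _ "{0<..}"]) (use 2 in \<open>auto simp: flat_def\<close>)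
  next
    case 3
    have l: "((\<lambda>h. flat p h / h) \<longlongrightarrow> 0) (at_left 0)"
      by (rule tendsto_eventually) (auto simp: eventually_at flat_def intro!: exI[of _ 1])
    \<comment> \<open>Under h = 1/y the right-hand difference quotient at 0 becomes y p(y) exp(-y),
      hence the extra factor \<open>[:0, 1:]\<close>.\<close>
    have "((\<lambda>y. poly ([:0, 1:] * p) y * exp (- y)) \<longlongrightarrow> 0) at_top"
      by (rule poly_times_exp_neg_tendsto_0)
    then have "((\<lambda>y. flat p (inverse y) / inverse y) \<longlongrightarrow> 0) at_top"
    proof (rule Lim_transform_eventually)
      show "\<forall>\<^sub>F y in at_top. poly ([:0, 1:] * p) y * exp (- y) = flat p (inverse y) / inverse y"
        using eventually_gt_at_top[of 0] by eventually_elim (simp add: flat_def field_simps)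
    qed
    then have r: "((\<lambda>h. flat p h / h) \<longlongrightarrow> 0) (at_right 0)"
      by (simp add: filterlim_at_right_to_top)
    have "((\<lambda>h. flat p h / h) \<longlongrightarrow> 0) (at 0)"
      using l r by (rule filterlim_split_at)
    then show ?thesis
      using 3 by (simp add: DERIV_def flat_def[of _ 0])
  qed
qed

lemma smooth_flat: "smooth (flat p)"
proof (rule smooth_closed_under_derivative[of "range flat"])
  fix f assume "f \<in> range flat"
  then obtain p where "f = flat p" by blast
  then show "\<exists>f'\<in>range flat. \<forall>x. (f has_real_derivative f' x) (at x)"
    using has_derivative_flat[of p] by (intro bex_derivativeI) auto
qed simp

lemma ex_bump:
  assumes "a < b"
  obtains \<eta> :: "real \<Rightarrow> real" where "smooth \<eta>" "\<And>x. \<eta> x \<ge> 0" "\<And>x. \<eta> x > 0 \<longleftrightarrow> a < x \<and> x < b"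
proof
  let ?\<eta> = "\<lambda>x. flat 1 (x - a) * flat 1 (b - x)"
  show "smooth ?\<eta>"
    using smooth_affine[OF smooth_flat[of 1], of 1 1 "- a"] smooth_affine[OF smooth_flat[of 1], of 1 "- 1" b]
    by (intro smooth_mult) simp_all
  show "?\<eta> x \<ge> 0" "?\<eta> x > 0 \<longleftrightarrow> a < x \<and> x < b" for x
    using assms by (auto simp: flat_def)
qed

section \<open>Continuous weak derivatives are classical derivatives\<close>

lemma integral_restrict_support:
  fixes f :: "real \<Rightarrow> 'b::banach"
  assumes "T \<subseteq> S" "\<And>x. x \<in> S - T \<Longrightarrow> f x = 0"
  shows "integral S f = integral T f"
proof -
  have "integral S f = integral S (\<lambda>x. if x \<in> T then f x else 0)"
    by (rule integral_cong) (simp add: assms(2))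
  also have "\<dots> = integral T f"
    using assms(1) by (subst Henstock_Kurzweil_Integration.integral_restrict_Int) (simp add: Int_absorb2)
  finally show ?thesis .
qed

text \<open>A nonempty compact subset of the open half-line contains its infimum and so stays away
  from 0. The empty support has no meaningful infimum and is treated apart.\<close>

lemma test_function_halfline_bounds:
  assumes "\<theta> \<in> test_functions {0::real<..}"
  obtains a b where "0 < a" "a < b" "\<And>x. x \<notin> {a..b} \<Longrightarrow> \<theta> x = 0"
proof -
  obtain R where R: "R > 0" "\<And>x. \<bar>x\<bar> > R \<Longrightarrow> \<theta> x = 0" using test_function_bounds[OF assms] by metis
  note \<theta> = test_functionsD[OF assms]
  show thesis
  proof (cases "supp \<theta> = {}")
    case True
    then show thesis using that[of 1 2] not_in_supp[of _ \<theta>] by simp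
  next
    case False
    define a where "a = Inf (supp \<theta>)"
    have "a \<in> supp \<theta>" unfolding a_def
      using \<theta>(2) False by (intro closed_contains_Inf compact_imp_closed bounded_imp_bdd_below compact_imp_bounded)
    then have a0: "a > 0" using \<theta>(3) by auto
    have "a \<le> x" if "x \<in> supp \<theta>" for x
      unfolding a_def using that \<theta>(2) by (intro cInf_lower bounded_imp_bdd_below compact_imp_bounded)
    then have z: "\<theta> x = 0" if "x < a" for x
      using that not_in_supp[of x \<theta>] by fastforce
    show thesis
    proof (rule that[of a "max (a + 1) R"])
      fix x assume "x \<notin> {a..max (a + 1) R}"
      then have "x < a \<or> \<bar>x\<bar> > R" by auto
      then show "\<theta> x = 0" using z R by blast
    qed (use a0 in auto)
  qed
qed

text \<open>A du Bois-Reymond lemma. The test function is a smooth step near \<open>a\<close> minus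
  its translate by \<open>k = b - a\<close>; its derivative is a bump near \<open>a\<close> minus
  the same bump near \<open>b\<close>, so the hypothesis equates averages of \<open>F\<close> near
  the two points.\<close>

lemma weak_derivative_const:
  fixes F :: "real \<Rightarrow> real"
  assumes F: "continuous_on {0..} F"
    and weak: "\<And>\<theta>. \<theta> \<in> test_functions {0<..} \<Longrightarrow> integral {0..} (\<lambda>z. partial 1 \<theta> z * F z) = 0"
    and ab: "0 < a" "a < b"
  shows "F a = F b"
proof (rule ccontr)
  assume ne: "F a \<noteq> F b"
  define k where "k = b - a"
  \<comment> \<open>The sign factor makes \<open>K\<close> positive at \<open>a\<close>, so that the
    final integrand has one sign.\<close>
  define K where "K x = (F x - F (x + k)) * sgn (F a - F b)" for x
  have cK: "continuous_on {0..} K"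
    unfolding K_def using ab
    by (intro continuous_intros F continuous_on_compose2[OF F]) (auto simp: k_def)
  have "K a > 0" using ne by (simp add: K_def k_def mult_sgn_abs linorder_not_less[symmetric] sgn_if)
  moreover have "isCont K a"
    using continuous_on_interior[OF cK] ab by simp
  ultimately have "\<forall>\<^sub>F x in at a. K x > 0"
    unfolding isCont_def by (rule order_tendstoD(1)[rotated])
  then obtain \<delta>0 where \<delta>0: "\<delta>0 > 0" "\<And>x. x \<noteq> a \<Longrightarrow> dist x a < \<delta>0 \<Longrightarrow> K x > 0"
    unfolding eventually_at by auto
  define \<delta> where "\<delta> = \<delta>0 / 2"
  have \<delta>: "\<delta> > 0" "\<And>x. x \<in> {a..a + \<delta>} \<Longrightarrow> K x > 0"
  proof -
    show "\<delta> > 0" using \<delta>0 by (simp add: \<delta>_def)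
    show "K x > 0" if "x \<in> {a..a + \<delta>}" for x
      using that \<delta>0(1) \<delta>0(2)[of x] \<open>K a > 0\<close> by (cases "x = a") (auto simp: \<delta>_def dist_real_def)
  qed
  obtain \<eta> where \<eta>: "smooth \<eta>" "\<And>x. \<eta> x \<ge> 0" "\<And>x. \<eta> x > 0 \<longleftrightarrow> a < x \<and> x < a + \<delta>"
    using ex_bump[of a "a + \<delta>"] \<delta>(1) by auto
  have \<eta>0: "\<eta> x = 0" if "x \<le> a \<or> a + \<delta> \<le> x" for x
    using that \<eta>(2)[of x] \<eta>(3)[of x] by linarith
  obtain S where S: "S a = 0" "\<And>x. (S has_real_derivative \<eta> x) (at x)"
    using ex_antiderivative[OF smooth_continuous[OF \<eta>(1)], of a] by metis
  have smS: "smooth S" by (rule smooth_antiderivative[OF \<eta>(1) S(2)])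
  have Sl: "S x = 0" if "x \<le> a" for x
  proof -
    have "\<exists>c. \<forall>x\<in>{..a}. S x = c"
    proof (rule has_field_derivative_zero_constant)
      show "(S has_real_derivative 0) (at x within {..a})" if "x \<in> {..a}" for x
        using has_field_derivative_at_within[OF S(2)[of x]] \<eta>0[of x] that by simp
    qed simp
    then show ?thesis using S(1) that by (metis atMost_iff order_refl)
  qed
  have Sr: "S x = S (a + \<delta>)" if "x \<ge> a + \<delta>" for x
  proof -
    have "\<exists>c. \<forall>x\<in>{a + \<delta>..}. S x = c"
    proof (rule has_field_derivative_zero_constant)
      show "(S has_real_derivative 0) (at x within {a + \<delta>..})" if "x \<in> {a + \<delta>..}" for x
        using has_field_derivative_at_within[OF S(2)[of x]] \<eta>0[of x] that by simp
    qed simp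
    then show ?thesis using that by (metis atLeast_iff order_refl)
  qed
  \<comment> \<open>Beyond \<open>b + \<delta>\<close> both steps have the value
    \<open>S (a + \<delta>)\<close>, so the difference has compact support. The spelling of the
    translate fits \<open>smooth_affine\<close>.\<close>
  define \<theta> where "\<theta> x = S x + - 1 * S (1 * x + - k)" for x
  have \<theta>: "\<theta> \<in> test_functions {0<..}"
  proof (rule test_functionI[of _ "{a..b + \<delta>}"])
    show "smooth \<theta>" unfolding \<theta>_def by (intro smooth_add smooth_affine smS)
    fix x assume "x \<notin> {a..b + \<delta>}"
    then consider "x < a" | "x > b + \<delta>" by fastforce
    then show "\<theta> x = 0"
    proof cases
      case 1
      then have "S x = 0" "S (x - k) = 0" using ab by (auto intro!: Sl simp: k_def)
      then show ?thesis by (simp add: \<theta>_def)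
    next
      case 2
      then have "S x = S (a + \<delta>)" "S (x - k) = S (a + \<delta>)"
        using ab by (intro Sr; simp add: k_def)+
      then show ?thesis by (simp add: \<theta>_def)
    qed
  qed (use ab in auto)
  have d\<theta>: "partial 1 \<theta> x = \<eta> x - \<eta> (x - k)" for x
  proof (rule partial_real)
    have "((\<lambda>x. S (x - k)) has_real_derivative \<eta> (x - k)) (at x)"
      using DERIV_shift[of S _ x "- k"] S(2)[of "x - k"] by simp
    then show "(\<theta> has_real_derivative \<eta> x - \<eta> (x - k)) (at x)"
      unfolding \<theta>_def using DERIV_diff[OF S(2)[of x]] by simp
  qed
  have c\<eta>: "continuous_on U \<eta>" for U by (rule smooth_continuous[OF \<eta>(1)])
  have cF: "continuous_on {a..b + \<delta>} F" by (rule continuous_on_subset[OF F]) (use ab in auto)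
  have i1: "(\<lambda>x. \<eta> x * F x) integrable_on {a..b + \<delta>}"
    by (intro integrable_continuous_interval continuous_intros c\<eta> cF)
  have i2: "(\<lambda>x. \<eta> (x - k) * F x) integrable_on {a..b + \<delta>}"
    by (intro integrable_continuous_interval continuous_intros cF continuous_on_compose2[OF c\<eta>[of UNIV]]) auto
  have "0 = integral {0..} (\<lambda>z. partial 1 \<theta> z * F z)" using weak[OF \<theta>] by simp
  also have "\<dots> = integral {a..b + \<delta>} (\<lambda>z. \<eta> z * F z - \<eta> (z - k) * F z)"
  proof -
    have "integral {0..} (\<lambda>z. partial 1 \<theta> z * F z) = integral {a..b + \<delta>} (\<lambda>z. partial 1 \<theta> z * F z)"
    proof (rule integral_restrict_support)
      fix x assume "x \<in> {0..} - {a..b + \<delta>}"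
      then consider "x < a" | "x > b + \<delta>" by fastforce
      then show "partial 1 \<theta> x * F x = 0"
        by cases (use ab \<delta> in \<open>auto simp: d\<theta> \<eta>0 k_def\<close>)
    qed (use ab in auto)
    then show ?thesis by (simp add: d\<theta> left_diff_distrib)
  qed
  also have "\<dots> = integral {a..b + \<delta>} (\<lambda>z. \<eta> z * F z) - integral {a..b + \<delta>} (\<lambda>z. \<eta> (z - k) * F z)"
    by (rule Henstock_Kurzweil_Integration.integral_diff[OF i1 i2])
  also have "integral {a..b + \<delta>} (\<lambda>z. \<eta> z * F z) = integral {a..a + \<delta>} (\<lambda>z. \<eta> z * F z)"
    by (rule integral_restrict_support) (use ab in \<open>auto simp: \<eta>0\<close>)
  also have "integral {a..b + \<delta>} (\<lambda>z. \<eta> (z - k) * F z) = integral {b..b + \<delta>} (\<lambda>z. \<eta> (z - k) * F z)"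
    by (rule integral_restrict_support) (use ab in \<open>auto simp: \<eta>0 k_def\<close>)
  also have "\<dots> = integral {a..a + \<delta>} (\<lambda>z. \<eta> z * F (z + k))"
  proof -
    have *: "b - k = a" "b + \<delta> - k = a + \<delta>" by (simp_all add: k_def)
    show ?thesis
      using integral_shift_real_ivl[of b k "b + \<delta>" "\<lambda>z. \<eta> (z - k) * F z"] unfolding * by simp
  qed
  also have "integral {a..a + \<delta>} (\<lambda>z. \<eta> z * F z) - integral {a..a + \<delta>} (\<lambda>z. \<eta> z * F (z + k))
      = integral {a..a + \<delta>} (\<lambda>z. \<eta> z * (F z - F (z + k)))"
  proof -
    have "(\<lambda>x. \<eta> x * F x) integrable_on {a..a + \<delta>}" "(\<lambda>x. \<eta> x * F (x + k)) integrable_on {a..a + \<delta>}"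
      using ab by (intro integrable_continuous_interval continuous_intros c\<eta> continuous_on_compose2[OF F]; auto simp: k_def)+
    from Henstock_Kurzweil_Integration.integral_diff[OF this] show ?thesis
      by (simp add: right_diff_distrib)
  qed
  finally have "integral {a..a + \<delta>} (\<lambda>z. \<eta> z * (F z - F (z + k))) * sgn (F a - F b) = 0" by simp
  then have "integral {a..a + \<delta>} (\<lambda>z. \<eta> z * K z) = 0"
    unfolding integral_mult_left[symmetric] by (simp add: K_def mult.assoc)
  moreover have "continuous_on {a..a + \<delta>} (\<lambda>z. \<eta> z * K z)"
    by (intro continuous_intros c\<eta> continuous_on_subset[OF cK]) (use ab in auto)
  moreover have "\<eta> x * K x \<ge> 0" if "x \<in> {a..a + \<delta>}" for x
    by (rule mult_nonneg_nonneg[OF \<eta>(2) less_imp_le[OF \<delta>(2)[OF that]]])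
  ultimately have "\<forall>x\<in>{a..a + \<delta>}. \<eta> x * K x = 0"
    using \<delta>(1) integral_eq_0_iff[of a "a + \<delta>" "\<lambda>z. \<eta> z * K z"] by simp
  moreover have "\<eta> (a + \<delta> / 2) > 0" "K (a + \<delta> / 2) > 0" using \<delta>(1) \<eta>(3) \<delta>(2)[of "a + \<delta> / 2"] by auto
  moreover have "a + \<delta> / 2 \<in> {a..a + \<delta>}" using \<delta>(1) by simp
  ultimately show False by (metis mult_eq_0_iff order_less_irrefl)
qed

text \<open>Subtracting an antiderivative of \<open>g\<close> leaves a continuous function with weak
  derivative zero, which \<open>weak_derivative_const\<close> shows to be constant.\<close>

lemma weak_derivative_imp_derivative:
  fixes f g :: "real \<Rightarrow> real"
  assumes f: "continuous_on {0..} f" and g: "continuous_on {0..} g"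
    and weak: "\<And>\<theta>. \<theta> \<in> test_functions {0<..} \<Longrightarrow>
      integral {0..} (\<lambda>z. partial 1 \<theta> z * f z) = - integral {0..} (\<lambda>z. \<theta> z * g z)"
    and x: "x > 0"
  shows "(f has_real_derivative g x) (at x)"
proof -
  \<comment> \<open>\<open>g\<close> is continued to the left by the constant \<open>g 0\<close>, so
    that an antiderivative exists on the whole line.\<close>
  have "continuous_on UNIV (\<lambda>x. g (max 0 x))"
    by (rule continuous_on_compose2[OF g]) (auto intro!: continuous_intros)
  then obtain G where G: "\<And>x. (G has_real_derivative g (max 0 x)) (at x)"
    using ex_antiderivative[of "\<lambda>x. g (max 0 x)" 0] by metis
  have cG: "continuous_on S G" for S
    using G DERIV_isCont continuous_at_imp_continuous_on by blast
  have "f y - G y = f x - G x" if "y > 0" for y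
  proof -
    have w: "integral {0..} (\<lambda>z. partial 1 \<theta> z * (f z - G z)) = 0" if \<theta>: "\<theta> \<in> test_functions {0<..}" for \<theta>
    proof -
      obtain a b where ab: "0 < a" "a < b" "\<And>x. x \<notin> {a..b} \<Longrightarrow> \<theta> x = 0"
        using test_function_halfline_bounds[OF \<theta>] by metis
      \<comment> \<open>\<open>\<theta>\<close> vanishes at both ends of \<open>{0..B}\<close>, so
        integration by parts has no boundary terms.\<close>
      define B where "B = b + 1"
      have sm: "smooth \<theta>" "smooth (partial 1 \<theta>)"
        using test_functionsD(1)[OF \<theta>] by (auto intro: smooth_partial)
      have supp: "supp \<theta> \<subseteq> {a..b}" by (rule supp_subset) (use ab in auto)
      have p0: "partial 1 \<theta> x = 0" if "x \<notin> {a..b}" for x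
        using partial_outside_supp supp that by blast
      have cut: "integral {0..} (\<lambda>z. h z * r z) = integral {0..B} (\<lambda>z. h z * r z)"
        if "\<And>x. x \<notin> {a..b} \<Longrightarrow> h x = 0" for h r :: "real \<Rightarrow> real"
        by (rule integral_restrict_support) (use that ab in \<open>auto simp: B_def\<close>)
      have c0: "continuous_on {0..B} f" "continuous_on {0..B} g"
        by (rule continuous_on_subset[OF f], simp) (rule continuous_on_subset[OF g], simp)
      note c = smooth_continuous[OF sm(1)] smooth_continuous[OF sm(2)] c0 cG
      have i: "(\<lambda>z. partial 1 \<theta> z * f z) integrable_on {0..B}" "(\<lambda>z. partial 1 \<theta> z * G z) integrable_on {0..B}"
        "(\<lambda>z. \<theta> z * g z) integrable_on {0..B}"
        by (intro integrable_continuous_interval continuous_intros c)+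
      have "((\<lambda>z. partial 1 \<theta> z * G z + \<theta> z * g z) has_integral \<theta> B * G B - \<theta> 0 * G 0) {0..B}"
      proof (rule fundamental_theorem_of_calculus)
        fix z assume z: "z \<in> {0..B}"
        have "((\<lambda>z. \<theta> z * G z) has_real_derivative partial 1 \<theta> z * G z + \<theta> z * g z) (at z within {0..B})"
          using DERIV_mult[OF smooth_real_derivative[OF sm(1)] G, of z] z
          by (simp add: has_field_derivative_at_within mult.commute max_absorb2)
        then show "((\<lambda>z. \<theta> z * G z) has_vector_derivative partial 1 \<theta> z * G z + \<theta> z * g z) (at z within {0..B})"
          by (simp add: has_real_derivative_iff_has_vector_derivative)
      qed (use ab in \<open>simp add: B_def\<close>)
      moreover have "\<theta> B = 0" "\<theta> 0 = 0" using ab by (auto simp: B_def)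
      ultimately have "integral {0..B} (\<lambda>z. partial 1 \<theta> z * G z + \<theta> z * g z) = 0"
        by (simp add: integral_unique)
      then have parts: "integral {0..B} (\<lambda>z. partial 1 \<theta> z * G z) = - integral {0..B} (\<lambda>z. \<theta> z * g z)"
        using Henstock_Kurzweil_Integration.integral_add[OF i(2,3)] by linarith
      have "integral {0..B} (\<lambda>z. partial 1 \<theta> z * f z) = - integral {0..B} (\<lambda>z. \<theta> z * g z)"
        using weak[OF \<theta>] cut[OF p0] cut[OF ab(3)] by simp
      then have "integral {0..B} (\<lambda>z. partial 1 \<theta> z * (f z - G z)) = 0"
        using Henstock_Kurzweil_Integration.integral_diff[OF i(1,2)] parts by (simp add: right_diff_distrib)
      then show ?thesis using cut[OF p0, where r = "\<lambda>z. f z - G z"] by simp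
    qed
    have cfG: "continuous_on {0..} (\<lambda>z. f z - G z)" by (intro continuous_intros f cG)
    show ?thesis
      using weak_derivative_const[OF cfG w, of x y] weak_derivative_const[OF cfG w, of y x] x that
      by (metis linorder_cases)
  qed
  then have f_eq: "f y = G y + (f x - G x)" if "y > 0" for y using that by (simp add: algebra_simps)
  have "((\<lambda>y. G y + (f x - G x)) has_real_derivative g x) (at x)"
    using G[of x] x by (auto intro!: derivative_eq_intros)
  then show ?thesis
  proof (rule has_field_derivative_transform_within_open[of _ _ _ "{0<..}"])
    show "G y + (f x - G x) = f y" if "y \<in> {0<..}" for y
      by (rule f_eq[symmetric]) (use that in simp)
  qed (use x in simp_all)
qed

section \<open>The uniform boundedness principle for distributions\<close>

text \<open>Termwise differentiation at every order. The majorant \<open>a\<close> is required only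
  from an index that depends on the order \<open>j\<close>: in the gliding hump argument the k-th
  function is controlled only up to an order that grows with k.\<close>

lemma smooth_suminf:
  fixes f :: "nat \<Rightarrow> real \<Rightarrow> real"
  assumes f: "\<And>n. smooth (f n)" and a: "summable a"
    and bd: "\<And>j. \<exists>k0. \<forall>k\<ge>k0. \<forall>x. \<bar>dern j (f k) x\<bar> \<le> a k"
  shows "smooth (\<lambda>x. \<Sum>k. f k x)" "dern j (\<lambda>x. \<Sum>k. f k x) = (\<lambda>x. \<Sum>k. dern j (f k) x)"
proof -
  define G where "G j x = (\<Sum>k. dern j (f k) x)" for j x
  have uc: "uniformly_convergent_on UNIV (\<lambda>n x. \<Sum>k<n. dern j (f k) x)" for j
  proof -
    obtain k0 where "\<forall>k\<ge>k0. \<forall>x. \<bar>dern j (f k) x\<bar> \<le> a k" using bd by blast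
    then have "\<forall>\<^sub>F k in sequentially. \<forall>x\<in>UNIV. norm (dern j (f k) x) \<le> a k"
      by (auto simp: eventually_sequentially)
    from Weierstrass_m_test_ev[OF this a] show ?thesis
      unfolding uniformly_convergent_on_def by blast
  qed
  have sm: "summable (\<lambda>k. dern j (f k) x)" for j x
  proof -
    obtain k0 where "\<forall>k\<ge>k0. \<forall>x. \<bar>dern j (f k) x\<bar> \<le> a k" using bd by blast
    then show ?thesis by (intro summable_comparison_test[OF _ a]) auto
  qed
  have dG: "(G j has_real_derivative G (Suc j) x) (at x)" for j x
  proof -
    have "(dern j (f n) has_real_derivative dern (Suc j) (f n) x) (at x within UNIV)" for n x
      using smooth_real_derivative[OF smooth_dern[OF f, of j n], of x] by simp
    from has_field_derivative_series'(2)[OF convex_UNIV this uc UNIV_I sm]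
    show ?thesis by (simp add: G_def[abs_def])
  qed
  have "smooth (G 0)"
  proof (rule smooth_closed_under_derivative[of "range G"])
    fix h assume "h \<in> range G"
    then obtain j where "h = G j" by blast
    then show "\<exists>h'\<in>range G. \<forall>x. (h has_real_derivative h' x) (at x)"
      using dG[of j] by (intro bex_derivativeI) auto
  qed simp
  moreover have "dern j (G 0) = G j" for j
  proof (induction j)
    case (Suc j)
    have "partial 1 (G j) x = G (Suc j) x" for x by (rule partial_real[OF dG])
    then show ?case unfolding funpow.simps o_apply Suc by (rule ext)
  qed simp
  ultimately show "smooth (\<lambda>x. \<Sum>k. f k x)" "dern j (\<lambda>x. \<Sum>k. f k x) = (\<lambda>x. \<Sum>k. dern j (f k) x)"
    by (simp_all add: G_def[abs_def])
qed

text \<open>One fixed interval for all members, so that a series of members converging with all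
  derivatives has its sum in the same set.\<close>

definition tests_on :: "real \<Rightarrow> (real \<Rightarrow> real) set" where
  "tests_on R = {\<phi>. smooth \<phi> \<and> (\<forall>x. \<bar>x\<bar> > R \<longrightarrow> \<phi> x = 0)}"

lemma tests_on_test: "\<phi> \<in> tests_on R \<Longrightarrow> \<phi> \<in> test_functions UNIV"
  by (rule test_functionI[of _ "{-R..R}"]) (auto simp: tests_on_def)

text \<open>The premise of the continuity estimate in \<open>distribution_on\<close>, rewritten for
  the line; \<open>b\<close> is any common bound, so that no suprema occur.\<close>

definition dbound :: "nat \<Rightarrow> (real \<Rightarrow> real) \<Rightarrow> real \<Rightarrow> bool" where
  "dbound N \<phi> b \<longleftrightarrow> (\<forall>k\<le>N. \<forall>x. \<bar>dern k \<phi> x\<bar> \<le> b)"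

lemma dbound_nonneg: "dbound N \<phi> b \<Longrightarrow> 0 \<le> b"
  unfolding dbound_def by (meson abs_ge_zero le0 order_trans)

lemma distribution_add:
  assumes "distribution_on S u" "\<phi> \<in> test_functions S" "\<psi> \<in> test_functions S"
  shows "u (\<lambda>x. \<phi> x + \<psi> x) = u \<phi> + u \<psi>"
  using assms unfolding distribution_on_def by blast

lemma distribution_cmult:
  assumes "distribution_on S u" "\<phi> \<in> test_functions S"
  shows "u (\<lambda>x. a * \<phi> x) = a *\<^sub>R u \<phi>"
  using assms unfolding distribution_on_def by blast

lemma distribution_zero:
  fixes u :: "(real \<Rightarrow> real) \<Rightarrow> 'b::real_normed_vector"
  assumes "distribution_on UNIV u"
  shows "u (\<lambda>x. 0) = 0"
proof -
  have "(\<lambda>x::real. 0) \<in> test_functions UNIV"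
    by (rule test_functionI[of _ "{}"]) (auto intro: smooth_zero)
  from distribution_cmult[OF assms this, of 0] show ?thesis by simp
qed

lemma distribution_bound:
  fixes u :: "(real \<Rightarrow> real) \<Rightarrow> 'b::real_normed_vector"
  assumes u: "distribution_on UNIV u"
  obtains C N where "C \<ge> 0" "\<And>\<phi> b. \<phi> \<in> tests_on R \<Longrightarrow> dbound N \<phi> b \<Longrightarrow> norm (u \<phi>) \<le> C * b"
proof -
  have "compact {-R..R} \<and> {-R..R} \<subseteq> UNIV" by simp
  with u obtain C N where CN: "\<And>\<phi> b. \<phi> \<in> test_functions UNIV \<Longrightarrow> supp \<phi> \<subseteq> {-R..R} \<Longrightarrow>
      (\<forall>vs x. set vs \<subseteq> Basis \<and> length vs \<le> N \<longrightarrow> \<bar>partials vs \<phi> x\<bar> \<le> b) \<Longrightarrow> norm (u \<phi>) \<le> C * b"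
    unfolding distribution_on_def by meson
  show thesis
  \<comment> \<open>\<open>distribution_on\<close> does not fix the sign of its constant.\<close>
  proof (rule that[of "max 0 C" N])
    fix \<phi> b assume \<phi>: "\<phi> \<in> tests_on R" and b: "dbound N \<phi> b"
    have "supp \<phi> \<subseteq> {-R..R}" by (rule supp_subset) (use \<phi> in \<open>auto simp: tests_on_def\<close>)
    moreover have "\<bar>partials vs \<phi> x\<bar> \<le> b" if "set vs \<subseteq> Basis" "length vs \<le> N" for vs x
      using b that by (simp add: partials_real dbound_def)
    ultimately have "norm (u \<phi>) \<le> C * b" using CN[OF tests_on_test[OF \<phi>]] by blast
    also have "\<dots> \<le> max 0 C * b" using dbound_nonneg[OF b] by (intro mult_right_mono) auto
    finally show "norm (u \<phi>) \<le> max 0 C * b" .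
  qed simp
qed

lemma tests_on_sum:
  fixes f :: "nat \<Rightarrow> real \<Rightarrow> real"
  assumes "\<And>k. f k \<in> tests_on R"
  shows "(\<lambda>x. \<Sum>k<n. f k x) \<in> tests_on R"
proof (induction n)
  case 0
  then show ?case by (simp add: tests_on_def smooth_zero)
next
  case (Suc n)
  then show ?case using assms[of n] by (auto simp: tests_on_def intro: smooth_add)
qed

lemma distribution_sum:
  fixes u :: "(real \<Rightarrow> real) \<Rightarrow> 'b::real_normed_vector"
    and f :: "nat \<Rightarrow> real \<Rightarrow> real"
  assumes u: "distribution_on UNIV u" and f: "\<And>k. f k \<in> tests_on R"
  shows "u (\<lambda>x. \<Sum>k<n. f k x) = (\<Sum>k<n. u (f k))"
proof (induction n)
  case 0
  then show ?case by (simp add: distribution_zero[OF u])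
next
  case (Suc n)
  then show ?case
    using distribution_add[OF u tests_on_test[OF tests_on_sum[OF f, where n = n]] tests_on_test[OF f[of n]]] by simp
qed

text \<open>The gliding hump argument: if no uniform bound existed, one could choose \<open>z\<^sub>n\<close> and
  rapidly decreasing \<open>f\<^sub>n\<close> such that \<open>u z\<^sub>n\<close> is large on \<open>f\<^sub>n\<close>, compared with its values on the earlier
  functions, and small on the later ones; then \<open>u z\<^sub>n\<close> is unbounded on \<open>\<Sum>n. f\<^sub>n\<close>.\<close>

lemma distributions_uniformly_bounded:
  fixes u :: "'i \<Rightarrow> (real \<Rightarrow> real) \<Rightarrow> 'b::real_normed_vector"
  assumes u: "\<And>z. z \<in> J \<Longrightarrow> distribution_on UNIV (u z)"
    and ptw: "\<And>\<phi>. \<phi> \<in> test_functions UNIV \<Longrightarrow> bounded ((\<lambda>z. u z \<phi>) ` J)"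
  obtains C N where "C \<ge> 0"
    "\<And>z \<phi> b. z \<in> J \<Longrightarrow> \<phi> \<in> tests_on R \<Longrightarrow> dbound N \<phi> b \<Longrightarrow> norm (u z \<phi>) \<le> C * b"
proof (rule ccontr)
  assume "\<not> thesis"
  with that have neg: "\<exists>z \<phi> b. z \<in> J \<and> \<phi> \<in> tests_on R \<and> dbound N \<phi> b \<and> C * b < norm (u z \<phi>)" if "C \<ge> 0" for C N
    using \<open>C \<ge> 0\<close> by (meson not_le)
  \<comment> \<open>Homogeneity rescales a violating pair: with
    \<open>C = max 0 S / \<delta>\<close>, multiplying the function by \<open>\<delta> / b\<close>
    gives one that is bounded by \<open>\<delta>\<close> up to order \<open>N\<close> and on which
    some \<open>u z\<close> exceeds \<open>S\<close>.\<close>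
  have large: "\<exists>z \<phi>. z \<in> J \<and> \<phi> \<in> tests_on R \<and> dbound N \<phi> \<delta> \<and> S < norm (u z \<phi>)" if \<delta>: "\<delta> > 0" for \<delta> S :: real and N
  proof -
    have "max 0 S / \<delta> \<ge> 0" using \<delta> by simp
    from neg[OF this, of N] obtain z \<phi> b where *: "z \<in> J" "\<phi> \<in> tests_on R" "dbound N \<phi> b"
      "max 0 S / \<delta> * b < norm (u z \<phi>)" by (elim exE conjE)
    have b: "b > 0"
    proof (rule ccontr)
      assume "\<not> b > 0"
      with dbound_nonneg[OF *(3)] have "b = 0" by simp
      with *(3) have "\<phi> = (\<lambda>x. 0)" unfolding dbound_def by (force intro!: ext)
      then show False using *(4) \<open>b = 0\<close> distribution_zero[OF u[OF *(1)]] by simp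
    qed
    have sm: "smooth \<phi>" using *(2) by (simp add: tests_on_def)
    have "(\<lambda>x. \<delta> / b * \<phi> x) \<in> tests_on R"
      using *(2) smooth_affine[OF sm, of "\<delta> / b" 1 0] by (simp add: tests_on_def)
    moreover have "dbound N (\<lambda>x. \<delta> / b * \<phi> x) \<delta>"
      unfolding dbound_def
    proof (intro allI impI)
      fix k x assume "k \<le> N"
      then have "\<bar>dern k \<phi> x\<bar> \<le> b" using *(3) by (simp add: dbound_def)
      then have "\<delta> / b * \<bar>dern k \<phi> x\<bar> \<le> \<delta> / b * b" using \<delta> b by (intro mult_left_mono) auto
      then show "\<bar>dern k (\<lambda>x. \<delta> / b * \<phi> x) x\<bar> \<le> \<delta>"
        using \<delta> b by (simp only: dern_cmult[OF sm] abs_mult) simp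
    qed
    moreover have "S < norm (u z (\<lambda>x. \<delta> / b * \<phi> x))"
    proof -
      have "S \<le> \<delta> / b * (max 0 S / \<delta> * b)" using \<delta> b by simp
      also have "\<dots> < \<delta> / b * norm (u z \<phi>)" using *(4) \<delta> b by (intro mult_strict_left_mono) auto
      finally show ?thesis
        unfolding distribution_cmult[OF u[OF *(1)] tests_on_test[OF *(2)]] using \<delta> b by simp
    qed
    ultimately show ?thesis using *(1) by blast
  qed
  have "\<exists>E N. E \<ge> 0 \<and> (\<forall>\<phi> b. \<phi> \<in> tests_on R \<longrightarrow> dbound N \<phi> b \<longrightarrow> norm (u z \<phi>) \<le> E * b)" if "z \<in> J" for z
    using distribution_bound[OF u[OF that], of R] by metis
  then obtain E N where E: "\<And>z. z \<in> J \<Longrightarrow> E z \<ge> 0"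
    and EN: "\<And>z \<phi> b. z \<in> J \<Longrightarrow> \<phi> \<in> tests_on R \<Longrightarrow> dbound (N z) \<phi> b \<Longrightarrow> norm (u z \<phi>) \<le> E z * b"
    by metis
  have "\<exists>S\<ge>0. \<forall>z\<in>J. norm (u z \<phi>) \<le> S" if "\<phi> \<in> tests_on R" for \<phi>
    using ptw[OF tests_on_test[OF that]] unfolding bounded_pos by (metis imageI less_imp_le)
  then obtain S where S: "\<And>\<phi>. \<phi> \<in> tests_on R \<Longrightarrow> S \<phi> \<ge> 0"
    "\<And>z \<phi>. \<phi> \<in> tests_on R \<Longrightarrow> z \<in> J \<Longrightarrow> norm (u z \<phi>) \<le> S \<phi>" by metis
  \<comment> \<open>In a state, \<open>s\<close> is the sum of the pointwise bounds \<open>S\<close>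
    of the functions chosen after the initial one, while \<open>e\<close> and \<open>m\<close>
    dominate \<open>E\<close> and \<open>N\<close> of all functionals chosen so far. By
    \<open>Q\<close> the next function is so small relative to \<open>e\<close> and \<open>m\<close>
    that the earlier functionals hardly see it, yet its value under the new functional outweighs
    \<open>s\<close>. The condition \<open>m \<ge> n\<close> brings every order of derivative under
    control eventually.\<close>
  define P where "P n = (\<lambda>(z, \<phi>, s::real, e, m). z \<in> J \<and> \<phi> \<in> tests_on R \<and> s \<ge> 0 \<and> e \<ge> 1 \<and> e \<ge> E z \<and> m \<ge> N z \<and> m \<ge> n)" for n :: nat
  define Q where "Q n = (\<lambda>(z::'i, \<phi>::real \<Rightarrow> real, s::real, e::real, m::nat) (z', \<phi>', s', e', m'). dbound m \<phi>' ((1 / 2) ^ n / e) \<and>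
      s + real n + 3 < norm (u z' \<phi>') \<and> s + S \<phi>' \<le> s' \<and> e \<le> e' \<and> m \<le> m')" for n :: nat
  have "\<exists>st. \<forall>n. P n (st n) \<and> Q n (st n) (st (Suc n))"
  proof (rule dependent_nat_choice)
    obtain z \<phi> where "z \<in> J" "\<phi> \<in> tests_on R" using large[of 1 0 0] by auto
    then have "P 0 (z, \<phi>, 0, max 1 (E z), N z)" by (simp add: P_def)
    then show "\<exists>x. P 0 x" ..
  next
    fix x n assume x: "P n x"
    obtain z \<phi> s e m where xe: "x = (z, \<phi>, s, e, m)" by (cases x)
    have e: "e \<ge> 1" "s \<ge> 0" "m \<ge> n" using x by (auto simp: P_def xe)
    then have "(1 / 2) ^ n / e > 0" by simp
    from large[OF this, of m "s + real n + 3"] obtain z' \<phi>' where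
      *: "z' \<in> J" "\<phi>' \<in> tests_on R" "dbound m \<phi>' ((1 / 2) ^ n / e)" "s + real n + 3 < norm (u z' \<phi>')"
      by (elim exE conjE)
    let ?y = "(z', \<phi>', s + S \<phi>', max e (E z'), max (max m (N z')) (Suc n))"
    have "P (Suc n) ?y" using * e S(1)[OF *(2)] by (auto simp: P_def)
    moreover have "Q n x ?y" using * by (simp add: Q_def xe le_max_iff_disj)
    ultimately show "\<exists>y. P (Suc n) y \<and> Q n x y" by blast
  qed
  then obtain st where st: "\<And>n. P n (st n)" "\<And>n. Q n (st n) (st (Suc n))" by blast
  define z where "z n = fst (st n)" for n
  define f where "f n = fst (snd (st n))" for n
  define s where "s n = fst (snd (snd (st n)))" for n
  define e where "e n = fst (snd (snd (snd (st n))))" for n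
  define m where "m n = snd (snd (snd (snd (st n))))" for n
  have Pn: "z n \<in> J" "f n \<in> tests_on R" "s n \<ge> 0" "e n \<ge> 1" "e n \<ge> E (z n)" "m n \<ge> N (z n)" "m n \<ge> n" for n
    using st(1)[of n] by (auto simp: P_def z_def f_def s_def e_def m_def split: prod.splits)
  have Qn: "dbound (m n) (f (Suc n)) ((1 / 2) ^ n / e n)" "s n + real n + 3 < norm (u (z (Suc n)) (f (Suc n)))"
     "s n + S (f (Suc n)) \<le> s (Suc n)" "e n \<le> e (Suc n)" "m n \<le> m (Suc n)" for n
    using st(2)[of n] by (auto simp: Q_def z_def f_def s_def e_def m_def split: prod.splits)
  have emono: "e n \<le> e k" "m n \<le> m k" if "n \<le> k" for n k
    using that lift_Suc_mono_le[of e] lift_Suc_mono_le[of m] Qn(4,5) by blast+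
  have dsmall: "\<bar>dern j (f (Suc k)) x\<bar> \<le> (1 / 2) ^ k / e n" if "j \<le> m n" "n \<le> k" for j k n x
  proof -
    have "j \<le> m k" using that emono(2) order_trans by blast
    then have "\<bar>dern j (f (Suc k)) x\<bar> \<le> (1 / 2) ^ k / e k" using Qn(1)[of k] by (simp add: dbound_def)
    also have "\<dots> \<le> (1 / 2) ^ k / e n" using emono(1)[OF that(2)] Pn(4)[of n] by (intro divide_left_mono) auto
    finally show ?thesis .
  qed
  define a :: "nat \<Rightarrow> real" where "a k = 2 * (1 / 2) ^ k" for k
  have sa: "summable a" unfolding a_def by (intro summable_mult summable_geometric) simp
  \<comment> \<open>The derivatives of \<open>f (Suc l)\<close> up to order
    \<open>m l \<ge> l\<close> are bounded by (1/2)^l; hence the start at \<open>Suc j\<close>, and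
    the factor 2 in \<open>a\<close> pays for the shifted index.\<close>
  have bd: "\<exists>k0. \<forall>k\<ge>k0. \<forall>x. \<bar>dern j (f (k + i)) x\<bar> \<le> a k" for i j
  proof (intro exI[of _ "Suc j"] allI impI)
    fix k x assume k: "Suc j \<le> k"
    then obtain l where l: "k + i = Suc l" "k \<le> Suc l" "j \<le> l" by (cases "k + i") auto
    have "j \<le> m j" by (rule Pn)
    then have "\<bar>dern j (f (Suc l)) x\<bar> \<le> (1 / 2) ^ l / e j" by (rule dsmall) (use l in auto)
    also have "\<dots> \<le> (1 / 2) ^ l" using Pn(4)[of j] by (simp add: divide_le_eq mult_le_cancel_left1)
    also have "\<dots> = 2 * (1 / 2) ^ Suc l" by simp
    also have "\<dots> \<le> a k" unfolding a_def using l(2) by (intro mult_left_mono power_decreasing) auto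
    finally show "\<bar>dern j (f (k + i)) x\<bar> \<le> a k" using l(1) by simp
  qed
  have smf: "smooth (f n)" for n using Pn(2)[of n] by (simp add: tests_on_def)
  have tail: "(\<lambda>x. \<Sum>k. f (k + i) x) \<in> tests_on R"
     "dern j (\<lambda>x. \<Sum>k. f (k + i) x) = (\<lambda>x. \<Sum>k. dern j (f (k + i)) x)" for i j
  proof -
    show "dern j (\<lambda>x. \<Sum>k. f (k + i) x) = (\<lambda>x. \<Sum>k. dern j (f (k + i)) x)"
      by (rule smooth_suminf(2)[OF smf sa bd])
    have "smooth (\<lambda>x. \<Sum>k. f (k + i) x)" by (rule smooth_suminf(1)[OF smf sa bd])
    then show "(\<lambda>x. \<Sum>k. f (k + i) x) \<in> tests_on R" using Pn(2) by (simp add: tests_on_def)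
  qed
  define \<Phi> where "\<Phi> x = (\<Sum>k. f k x)" for x
  have \<Phi>: "\<Phi> \<in> tests_on R" using tail(1)[of 0] by (simp add: \<Phi>_def[abs_def])
  \<comment> \<open>Under \<open>u (z (Suc n))\<close> the earlier functions contribute at most
    \<open>S (f 0) + s n\<close> and the later ones together at most 2, the sum of a geometric
    series. The margin \<open>n + 3\<close> built into the choice of \<open>f (Suc n)\<close>
    therefore survives as more than \<open>n\<close>.\<close>
  have "real n < S \<Phi> + S (f 0)" for n
  proof -
    let ?z = "z (Suc n)"
    define g where "g x = (\<Sum>k<Suc n. f k x)" for x
    define \<psi> where "\<psi> x = (\<Sum>k. f (k + Suc (Suc n)) x)" for x
    have g: "g \<in> tests_on R" unfolding g_def[abs_def] by (rule tests_on_sum[OF Pn(2)])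
    have \<psi>: "\<psi> \<in> tests_on R" unfolding \<psi>_def[abs_def] by (rule tail(1))
    have uz: "distribution_on UNIV (u ?z)" by (rule u[OF Pn(1)])
    have sf: "summable (\<lambda>k. f k x)" for x
    proof -
      obtain k0 where "\<forall>k\<ge>k0. \<forall>x. \<bar>dern 0 (f (k + 0)) x\<bar> \<le> a k" using bd by blast
      then show ?thesis by (intro summable_comparison_test[OF _ sa]) auto
    qed
    have "\<Phi> = (\<lambda>x. (g x + f (Suc n) x) + \<psi> x)"
      unfolding \<Phi>_def g_def \<psi>_def using suminf_split_initial_segment[OF sf, where k = "Suc (Suc n)"]
      by (simp add: fun_eq_iff)
    then have "u ?z \<Phi> = u ?z (\<lambda>x. g x + f (Suc n) x) + u ?z \<psi>"
      using distribution_add[OF uz test_functions_add[OF tests_on_test[OF g] tests_on_test[OF Pn(2)]]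
        tests_on_test[OF \<psi>]] by simp
    also have "u ?z (\<lambda>x. g x + f (Suc n) x) = u ?z g + u ?z (f (Suc n))"
      by (rule distribution_add[OF uz tests_on_test[OF g] tests_on_test[OF Pn(2)]])
    also have "u ?z g = (\<Sum>k<Suc n. u ?z (f k))"
      unfolding g_def[abs_def] by (rule distribution_sum[OF uz Pn(2)])
    finally have eq: "u ?z (f (Suc n)) = u ?z \<Phi> - (\<Sum>k<Suc n. u ?z (f k)) - u ?z \<psi>" by simp
    have "(\<Sum>k<Suc n. S (f k)) \<le> S (f 0) + s n"
    proof (induction n)
      case (Suc n)
      then show ?case using Qn(3)[of n] by simp
    qed (use Pn(3)[of 0] in simp)
    then have 1: "norm (\<Sum>k<Suc n. u ?z (f k)) \<le> S (f 0) + s n"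
      using norm_sum[of "\<lambda>k. u ?z (f k)" "{..<Suc n}"] sum_mono[of "{..<Suc n}" "\<lambda>k. norm (u ?z (f k))" "\<lambda>k. S (f k)"]
        S(2)[OF Pn(2) Pn(1)] by fastforce
    have d\<psi>: "dern j \<psi> = (\<lambda>x. \<Sum>k. dern j (f (k + Suc (Suc n))) x)" for j
      unfolding \<psi>_def[abs_def] by (rule tail(2))
    have "dbound (N ?z) \<psi> (2 / e (Suc n))"
      unfolding dbound_def d\<psi>
    proof (intro allI impI)
      fix j x assume "j \<le> N ?z"
      then have j: "j \<le> m (Suc n)" using Pn(6)[of "Suc n"] by simp
      have *: "\<bar>dern j (f (k + Suc (Suc n))) x\<bar> \<le> (1 / 2) ^ k / e (Suc n)" for k
      proof -
        have "\<bar>dern j (f (Suc (k + Suc n))) x\<bar> \<le> (1 / 2) ^ (k + Suc n) / e (Suc n)"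
          by (rule dsmall[OF j]) simp
        also have "\<dots> \<le> (1 / 2) ^ k / e (Suc n)"
          using Pn(4)[of "Suc n"] by (intro divide_right_mono power_decreasing) auto
        finally show ?thesis by simp
      qed
      have sg: "summable (\<lambda>k. (1 / 2) ^ k / e (Suc n))" by (intro summable_divide summable_geometric) simp
      have "norm (\<Sum>k. dern j (f (k + Suc (Suc n))) x) \<le> (\<Sum>k. (1 / 2) ^ k / e (Suc n))"
        by (rule norm_suminf_le) (use * sg in auto)
      also have "\<dots> = 2 / e (Suc n)"
        by (subst suminf_divide) (simp_all add: suminf_geometric)
      finally show "\<bar>\<Sum>k. dern j (f (k + Suc (Suc n))) x\<bar> \<le> 2 / e (Suc n)" by simp
    qed
    then have "norm (u ?z \<psi>) \<le> E ?z * (2 / e (Suc n))" by (rule EN[OF Pn(1) \<psi>])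
    also have "\<dots> \<le> e (Suc n) * (2 / e (Suc n))"
      using Pn(4,5)[of "Suc n"] by (intro mult_right_mono) auto
    also have "\<dots> = 2" using Pn(4)[of "Suc n"] by simp
    finally have 2: "norm (u ?z \<psi>) \<le> 2" .
    have "s n + real n + 3 < norm (u ?z \<Phi>) + (S (f 0) + s n) + 2"
      using Qn(2)[of n] 1 2 norm_triangle_ineq4[of "u ?z \<Phi> - (\<Sum>k<Suc n. u ?z (f k))" "u ?z \<psi>"]
        norm_triangle_ineq4[of "u ?z \<Phi>" "\<Sum>k<Suc n. u ?z (f k)"] unfolding eq by linarith
    then show ?thesis using S(2)[OF \<Phi> Pn(1)[of "Suc n"]] by linarith
  qed
  then show False using reals_Archimedean2[of "S \<Phi> + S (f 0)"] less_asym by blast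
qed

section \<open>Integration along characteristics\<close>

text \<open>The partial derivatives are explicit arguments because the Picard iteration runs on
  triples of a function and its two derivatives.\<close>

definition C1_plane ::
    "(real \<times> real \<Rightarrow> 'b::real_normed_vector) \<Rightarrow> (real \<times> real \<Rightarrow> 'b) \<Rightarrow> (real \<times> real \<Rightarrow> 'b) \<Rightarrow> bool" where
  "C1_plane f fx fy \<longleftrightarrow> continuous_on UNIV fx \<and> continuous_on UNIV fy \<and>
     (\<forall>p. (f has_derivative (\<lambda>(h, k). h *\<^sub>R fx p + k *\<^sub>R fy p)) (at p))"

lemma C1_planeD:
  assumes "C1_plane f fx fy"
  shows "continuous_on UNIV f" "continuous_on UNIV fx" "continuous_on UNIV fy"
    "(f has_derivative (\<lambda>(h, k). h *\<^sub>R fx p + k *\<^sub>R fy p)) (at p within S)"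
proof -
  have d: "(f has_derivative (\<lambda>(h, k). h *\<^sub>R fx p + k *\<^sub>R fy p)) (at p)" for p
    using assms unfolding C1_plane_def by blast
  show "continuous_on UNIV f"
    using d by (meson continuous_at_imp_continuous_on has_derivative_continuous)
  show "(f has_derivative (\<lambda>(h, k). h *\<^sub>R fx p + k *\<^sub>R fy p)) (at p within S)"
    using d has_derivative_at_withinI by blast
qed (use assms in \<open>auto simp: C1_plane_def\<close>)

lemma C1_plane_line:
  assumes "C1_plane f fx fy"
  shows "((\<lambda>r. f (p + r *\<^sub>R d)) has_vector_derivative
    (fst d *\<^sub>R fx (p + r *\<^sub>R d) + snd d *\<^sub>R fy (p + r *\<^sub>R d))) (at r within S)"
proof -
  have "((\<lambda>r. p + r *\<^sub>R d) has_derivative (\<lambda>h. h *\<^sub>R d)) (at r within S)"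
    by (auto intro!: derivative_eq_intros)
  from has_derivative_compose[OF this C1_planeD(4)[OF assms, where S=UNIV]]
  show ?thesis
    by (auto simp: has_vector_derivative_def case_prod_beta algebra_simps)
qed

text \<open>For \<open>d \<bullet> e = 1\<close> this is the integral of \<open>g\<close> from the line \<open>p \<bullet> e = 0\<close> to \<open>p\<close> in direction \<open>d\<close>.\<close>

definition char_int :: "real \<times> real \<Rightarrow> real \<times> real \<Rightarrow> (real \<times> real \<Rightarrow> real) \<Rightarrow> real \<times> real \<Rightarrow> real" where
  "char_int e d g p = (p \<bullet> e) * integral {0..1} (\<lambda>r. g (p - (r * (p \<bullet> e)) *\<^sub>R d))"

lemma continuous_on_line_integrand:
  assumes "continuous_on UNIV g"
  shows "continuous_on UNIV (\<lambda>(p, r). g (p - (r * (p \<bullet> e)) *\<^sub>R d))"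
  by (auto intro!: continuous_intros continuous_on_compose2[OF assms] simp: case_prod_beta)

lemma integrable_line_integrand:
  fixes g :: "'a::real_inner \<Rightarrow> 'b::banach"
  assumes "continuous_on UNIV g"
  shows "(\<lambda>r. g (p - (r * k) *\<^sub>R d)) integrable_on {0..1::real}"
  by (intro integrable_continuous_interval continuous_on_compose2[OF assms] continuous_intros) auto

lemma continuous_char_int:
  assumes "continuous_on UNIV g"
  shows "continuous_on UNIV (char_int e d g)"
proof -
  have "continuous_on UNIV (\<lambda>p. integral (cbox 0 1) (\<lambda>r::real. g (p - (r * (p \<bullet> e)) *\<^sub>R d)))"
    by (rule integral_continuous_on_param)
      (rule continuous_on_subset[OF continuous_on_line_integrand[OF assms]], simp)
  then show ?thesis
    unfolding char_int_def by (auto intro!: continuous_intros)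
qed

text \<open>The length of the path depends on \<open>p\<close>, so differentiation under the
  integral yields, besides the integrals of \<open>gx\<close> and \<open>gy\<close>, terms with the
  derivative of \<open>g\<close> along \<open>d\<close>. These collapse to one value at the foot
  \<open>p - (p \<bullet> e) *\<^sub>R d\<close> of the characteristic.\<close>

lemma C1_plane_char_int:
  assumes g: "C1_plane g gx gy"
  shows "C1_plane (char_int e d g)
    (\<lambda>p. fst e * g (p - (p \<bullet> e) *\<^sub>R d) + char_int e d gx p)
    (\<lambda>p. snd e * g (p - (p \<bullet> e) *\<^sub>R d) + char_int e d gy p)"
proof -
  note gc = C1_planeD(1-3)[OF g]
  have "(char_int e d g has_derivative
     (\<lambda>(h, k). h *\<^sub>R (fst e * g (p - (p \<bullet> e) *\<^sub>R d) + char_int e d gx p)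
       + k *\<^sub>R (snd e * g (p - (p \<bullet> e) *\<^sub>R d) + char_int e d gy p))) (at p)" for p
  proof -
    define q where "q p r = p - (r * (p \<bullet> e)) *\<^sub>R d" for p and r :: real
    define D where "D r = fst d * gx (q p r) + snd d * gy (q p r)" for r
    \<comment> \<open>\<open>F p r\<close> is the derivative of the integrand as a bounded linear
      map, the form in which \<open>leibniz_rule\<close> takes it.\<close>
    define F :: "real \<times> real \<Rightarrow> real \<Rightarrow> (real \<times> real) \<Rightarrow>\<^sub>L real" where "F p r =
      (gx (q p r) - r * fst e * (fst d * gx (q p r) + snd d * gy (q p r))) *\<^sub>R fst_blinfun +
      (gy (q p r) - r * snd e * (fst d * gx (q p r) + snd d * gy (q p r))) *\<^sub>R snd_blinfun" for p r
    have cq: "continuous_on UNIV (\<lambda>x. q (fst x) (snd x))"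
      unfolding q_def by (auto intro!: continuous_intros)
    have cqr: "continuous_on S (q p)" for S p
      unfolding q_def by (auto intro!: continuous_intros)
    have F_apply: "blinfun_apply (F p r) v =
       fst v * gx (q p r) + snd v * gy (q p r) - (v \<bullet> e) * (r * (fst d * gx (q p r) + snd d * gy (q p r)))" for p r v
      by (simp add: F_def blinfun.bilinear_simps inner_prod_def algebra_simps)
    have Dq: "((\<lambda>p. g (q p r)) has_derivative blinfun_apply (F p r)) (at p)" for p r
    proof -
      have "((\<lambda>p. q p r) has_derivative (\<lambda>v. v - (r * (v \<bullet> e)) *\<^sub>R d)) (at p)"
        unfolding q_def by (auto intro!: derivative_eq_intros)
      from has_derivative_compose[OF this C1_planeD(4)[OF g, where S=UNIV]]
      show ?thesis
        by (rule has_derivative_eq_rhs) (auto simp: F_apply case_prod_beta inner_prod_def algebra_simps)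
    qed
    have cF: "continuous_on UNIV (\<lambda>(p, r). F p r)"
      unfolding F_def case_prod_beta
      by (intro continuous_intros continuous_on_compose2[OF gc(2) cq] continuous_on_compose2[OF gc(3) cq]) auto
    have int: "((\<lambda>p. integral (cbox 0 1) (\<lambda>r. g (q p r))) has_derivative integral (cbox 0 1) (F p)) (at p)"
    proof (rule leibniz_rule[where U=UNIV])
      show "(\<lambda>r. g (q x r)) integrable_on cbox 0 1" for x
        using integrable_line_integrand[OF gc(1)] by (simp add: q_def)
      show "continuous_on (UNIV \<times> cbox 0 1) (\<lambda>(x, t). F x t)"
        using cF continuous_on_subset by blast
    qed (use Dq in auto)
    have Fint: "F p integrable_on {0..1}"
      unfolding F_def by (intro integrable_continuous_interval continuous_intros
        continuous_on_compose2[OF gc(2) cqr] continuous_on_compose2[OF gc(3) cqr]) auto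
    note ix = integrable_continuous_interval[OF continuous_on_compose2[OF gc(2) cqr[of "{0..1}" p]]]
    note iy = integrable_continuous_interval[OF continuous_on_compose2[OF gc(3) cqr[of "{0..1}" p]]]
    have iD: "(\<lambda>r. r * D r) integrable_on {0..1}"
      unfolding D_def by (intro integrable_continuous_interval continuous_intros
        continuous_on_compose2[OF gc(2) cqr] continuous_on_compose2[OF gc(3) cqr]) auto
    have Fv: "blinfun_apply (integral {0..1} (F p)) v =
       fst v * integral {0..1} (\<lambda>r. gx (q p r)) + snd v * integral {0..1} (\<lambda>r. gy (q p r))
       - (v \<bullet> e) * integral {0..1} (\<lambda>r. r * D r)" for v
    proof -
      have "blinfun_apply (integral {0..1} (F p)) v = integral {0..1} (\<lambda>r. F p r v)"
        using integral_linear[OF Fint blinfun.bounded_linear_left[of v]] by (simp add: o_def)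
      also have "\<dots> = integral {0..1} (\<lambda>r. fst v * gx (q p r) + snd v * gy (q p r) - (v \<bullet> e) * (r * D r))"
        by (simp add: F_apply D_def)
      also have "\<dots> = fst v * integral {0..1} (\<lambda>r. gx (q p r)) + snd v * integral {0..1} (\<lambda>r. gy (q p r))
       - (v \<bullet> e) * integral {0..1} (\<lambda>r. r * D r)"
        by (intro integral_unique has_integral_add has_integral_diff has_integral_mult_right
            integrable_integral ix iy iD) auto
      finally show ?thesis .
    qed
    \<comment> \<open>integrating \<open>d/dr (r g(q p r))\<close> turns the weighted terms into the boundary term\<close>
    have ftc: "integral {0..1} (\<lambda>r. g (q p r)) - (p \<bullet> e) * integral {0..1} (\<lambda>r. r * D r) = g (q p 1)"
    proof -
      have "((\<lambda>r. g (q p r) - (p \<bullet> e) * (r * D r)) has_integral 1 * g (q p 1) - 0 * g (q p 0)) {0..1}"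
      proof (rule fundamental_theorem_of_calculus)
        fix r :: real
        have "((\<lambda>r. g (p + r *\<^sub>R (- (p \<bullet> e) *\<^sub>R d))) has_vector_derivative - (p \<bullet> e) * D r) (at r within {0..1})"
          using C1_plane_line[OF g, of p "- (p \<bullet> e) *\<^sub>R d" r "{0..1}"]
          by (rule has_vector_derivative_eq_rhs) (simp add: D_def q_def algebra_simps)
        then have "((\<lambda>r. g (q p r)) has_real_derivative - (p \<bullet> e) * D r) (at r within {0..1})"
          by (simp add: q_def has_real_derivative_iff_has_vector_derivative)
        then have "((\<lambda>r. r * g (q p r)) has_real_derivative g (q p r) - (p \<bullet> e) * (r * D r)) (at r within {0..1})"
          by (auto intro!: derivative_eq_intros simp: algebra_simps)
        then show "((\<lambda>r. r * g (q p r)) has_vector_derivative g (q p r) - (p \<bullet> e) * (r * D r)) (at r within {0..1})"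
          by (simp add: has_real_derivative_iff_has_vector_derivative)
      qed auto
      then have "integral {0..1} (\<lambda>r. g (q p r) - (p \<bullet> e) * (r * D r)) = g (q p 1)"
        by (simp add: integral_unique)
      moreover have "integral {0..1} (\<lambda>r. g (q p r) - (p \<bullet> e) * (r * D r))
          = integral {0..1} (\<lambda>r. g (q p r)) - (p \<bullet> e) * integral {0..1} (\<lambda>r. r * D r)"
        using integrable_line_integrand[OF gc(1)] unfolding q_def
        by (intro integral_unique has_integral_diff has_integral_mult_right integrable_integral iD) auto
      ultimately show ?thesis by simp
    qed
    have "((\<lambda>p. (p \<bullet> e) * integral (cbox 0 1) (\<lambda>r. g (q p r))) has_derivative
       (\<lambda>v. (p \<bullet> e) * blinfun_apply (integral {0..1} (F p)) v + (v \<bullet> e) * integral {0..1} (\<lambda>r. g (q p r)))) (at p)"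
      using int by (auto intro!: derivative_eq_intros)
    moreover have "(p \<bullet> e) * blinfun_apply (integral {0..1} (F p)) v + (v \<bullet> e) * integral {0..1} (\<lambda>r. g (q p r))
       = (v \<bullet> e) * g (q p 1) + fst v * char_int e d gx p + snd v * char_int e d gy p" for v
      unfolding Fv ftc[symmetric] char_int_def q_def[symmetric] by (simp add: algebra_simps)
    ultimately show ?thesis
      unfolding char_int_def[abs_def] q_def
      by (auto simp: case_prod_beta inner_prod_def algebra_simps elim!: has_derivative_eq_rhs)
  qed
  moreover have "continuous_on UNIV (\<lambda>p. fst e * g (p - (p \<bullet> e) *\<^sub>R d) + char_int e d gx p)"
    "continuous_on UNIV (\<lambda>p. snd e * g (p - (p \<bullet> e) *\<^sub>R d) + char_int e d gy p)"
    by (intro continuous_intros continuous_on_compose2[OF gc(1)] continuous_char_int gc; auto)+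
  ultimately show ?thesis
    by (simp add: C1_plane_def)
qed

text \<open>Along \<open>d\<close> the partial derivatives combine to a derivative along the path,
  whose integral is \<open>g p\<close> minus the value at the foot; \<open>d \<bullet> e = 1\<close>
  lets the foot terms cancel. So \<open>char_int\<close> inverts differentiation in the direction
  \<open>d\<close>.\<close>

lemma char_int_transport:
  assumes g: "C1_plane g gx gy" and "d \<bullet> e = 1"
  shows "fst d * (fst e * g (p - (p \<bullet> e) *\<^sub>R d) + char_int e d gx p)
       + snd d * (snd e * g (p - (p \<bullet> e) *\<^sub>R d) + char_int e d gy p) = g p"
proof -
  define q where "q r = p - (r * (p \<bullet> e)) *\<^sub>R d" for r :: real
  define D where "D r = fst d * gx (q r) + snd d * gy (q r)" for r
  have cq: "continuous_on S q" for S unfolding q_def by (auto intro!: continuous_intros)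
  note gc = C1_planeD(1-3)[OF g]
  note ix = integrable_continuous_interval[OF continuous_on_compose2[OF gc(2) cq[of "{0..1}"]]]
  note iy = integrable_continuous_interval[OF continuous_on_compose2[OF gc(3) cq[of "{0..1}"]]]
  have "((\<lambda>r. - (p \<bullet> e) * D r) has_integral g (q 1) - g (q 0)) {0..1}"
  proof (rule fundamental_theorem_of_calculus)
    fix r :: real
    have "((\<lambda>r. g (p + r *\<^sub>R (- (p \<bullet> e) *\<^sub>R d))) has_vector_derivative - (p \<bullet> e) * D r) (at r within {0..1})"
      using C1_plane_line[OF g, of p "- (p \<bullet> e) *\<^sub>R d" r "{0..1}"]
      by (rule has_vector_derivative_eq_rhs) (simp add: D_def q_def algebra_simps)
    then show "((\<lambda>r. g (q r)) has_vector_derivative - (p \<bullet> e) * D r) (at r within {0..1})"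
      by (simp add: q_def)
  qed auto
  from has_integral_neg[OF this] have "integral {0..1} (\<lambda>r. (p \<bullet> e) * D r) = g p - g (q 1)"
    by (intro integral_unique) (simp add: q_def)
  then have "(p \<bullet> e) * integral {0..1} D = g p - g (q 1)"
    by simp
  moreover have "integral {0..1} D = fst d * integral {0..1} (\<lambda>r. gx (q r)) + snd d * integral {0..1} (\<lambda>r. gy (q r))"
    unfolding D_def
    by (intro integral_unique has_integral_add has_integral_mult_right integrable_integral ix iy) auto
  moreover have "g (q 1) = g (p - (p \<bullet> e) *\<^sub>R d)" by (simp add: q_def)
  ultimately have *: "(p \<bullet> e) * (fst d * integral {0..1} (\<lambda>r. gx (q r)) + snd d * integral {0..1} (\<lambda>r. gy (q r)))
     = g p - g (p - (p \<bullet> e) *\<^sub>R d)" by simp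
  have "fst d * fst e + snd d * snd e = 1"
    using assms(2) by (simp add: inner_prod_def)
  then have "fst d * fst e * g (p - (p \<bullet> e) *\<^sub>R d) + snd d * snd e * g (p - (p \<bullet> e) *\<^sub>R d)
     = g (p - (p \<bullet> e) *\<^sub>R d)"
    by (metis distrib_right mult_1)
  with * show ?thesis
    unfolding char_int_def q_def by (simp add: algebra_simps)
qed

text \<open>The gain of \<open>1 / \<mu>\<close>: on the path \<open>om\<close> falls at least at
  the rate \<open>\<bar>p \<bullet> e\<bar>\<close> in r, and integrating the resulting exponential
  divides by \<open>\<mu>\<close>. The bound on \<open>g\<close> is assumed where \<open>om\<close>
  does not exceed \<open>om p\<close>, so the estimate localises to sublevel sets of
  \<open>om\<close>.\<close>

lemma char_int_bound:
  assumes g: "continuous_on UNIV g" and lam: "\<mu> > 0" and A: "A \<ge> 0"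
    and om: "\<And>r. 0 \<le> r \<Longrightarrow> r \<le> 1 \<Longrightarrow> om (p - (r * (p \<bullet> e)) *\<^sub>R d) \<le> om p - r * \<bar>p \<bullet> e\<bar>"
    and b: "\<And>q. om q \<le> om p \<Longrightarrow> \<bar>g q\<bar> \<le> A * exp (\<mu> * om q)"
  shows "\<bar>char_int e d g p\<bar> \<le> A / \<mu> * exp (\<mu> * om p)"
proof (cases "p \<bullet> e = 0")
  case True
  then show ?thesis using assms by (simp add: char_int_def)
next
  case False
  define l where "l = \<bar>p \<bullet> e\<bar>"
  have l: "l > 0" using False by (simp add: l_def)
  define h where "h r = A * exp (\<mu> * (om p - r * l))" for r
  have bd: "\<bar>g (p - (r * (p \<bullet> e)) *\<^sub>R d)\<bar> \<le> h r" if "r \<in> {0..1}" for r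
  proof -
    have o: "om (p - (r * (p \<bullet> e)) *\<^sub>R d) \<le> om p - r * l" using om that by (simp add: l_def)
    have "om (p - (r * (p \<bullet> e)) *\<^sub>R d) \<le> om p" using o l that by (smt (verit) atLeastAtMost_iff mult_nonneg_nonneg)
    then have "\<bar>g (p - (r * (p \<bullet> e)) *\<^sub>R d)\<bar> \<le> A * exp (\<mu> * om (p - (r * (p \<bullet> e)) *\<^sub>R d))" by (rule b)
    also have "\<dots> \<le> h r" unfolding h_def using o lam A by (intro mult_left_mono) auto
    finally show ?thesis .
  qed
  have "(h has_integral (- A / (\<mu> * l) * exp (\<mu> * (om p - 1 * l))) - (- A / (\<mu> * l) * exp (\<mu> * (om p - 0 * l)))) {0..1}"
  proof (rule fundamental_theorem_of_calculus)
    fix r :: real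
    have "((\<lambda>r. - A / (\<mu> * l) * exp (\<mu> * (om p - r * l))) has_real_derivative h r) (at r within {0..1})"
      using l lam by (auto intro!: derivative_eq_intros simp: h_def)
    then show "((\<lambda>r. - A / (\<mu> * l) * exp (\<mu> * (om p - r * l))) has_vector_derivative h r) (at r within {0..1})"
      by (simp add: has_real_derivative_iff_has_vector_derivative)
  qed auto
  then have h: "h integrable_on {0..1}" "integral {0..1} h \<le> A / (\<mu> * l) * exp (\<mu> * om p)"
    using A l lam by (auto simp: integral_unique integrable_on_def)
  have "\<bar>integral {0..1} (\<lambda>r. g (p - (r * (p \<bullet> e)) *\<^sub>R d))\<bar> \<le> integral {0..1} h"
    using integral_norm_bound_integral[OF integrable_line_integrand[OF g] h(1)] bd by auto
  then have "\<bar>char_int e d g p\<bar> \<le> l * (A / (\<mu> * l) * exp (\<mu> * om p))"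
    unfolding char_int_def abs_mult l_def[symmetric] using h l by (intro mult_left_mono) auto
  then show ?thesis using l by simp
qed

lemma C1_plane_componentwise:
  fixes f :: "real \<times> real \<Rightarrow> real ^ 'n"
  shows "C1_plane f fx fy \<longleftrightarrow> (\<forall>i. C1_plane (\<lambda>p. f p $ i) (\<lambda>p. fx p $ i) (\<lambda>p. fy p $ i))"
proof -
  have "(f has_derivative (\<lambda>(h, k). h *\<^sub>R fx p + k *\<^sub>R fy p)) (at p) \<longleftrightarrow>
    (\<forall>i. ((\<lambda>p. f p $ i) has_derivative (\<lambda>(h, k). h *\<^sub>R fx p $ i + k *\<^sub>R fy p $ i)) (at p))" for p
    by (subst has_derivative_componentwise_within)
      (auto simp: Basis_vec_def inner_axis case_prod_unfold)
  moreover have "continuous_on UNIV g \<longleftrightarrow> (\<forall>i. continuous_on UNIV (\<lambda>p. g p $ i))"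
    for g :: "real \<times> real \<Rightarrow> real ^ 'n"
    by (subst continuous_on_componentwise) (auto simp: Basis_vec_def inner_axis)
  ultimately show ?thesis
    unfolding C1_plane_def by blast
qed

lemma C1_plane_add:
  assumes "C1_plane f fx fy" "C1_plane g gx gy"
  shows "C1_plane (\<lambda>p. f p + g p) (\<lambda>p. fx p + gx p) (\<lambda>p. fy p + gy p)"
  using assms unfolding C1_plane_def
  by (auto intro!: continuous_intros derivative_eq_intros simp: algebra_simps fun_eq_iff)

lemma norm_le_4:
  fixes x :: "real^4"
  assumes "\<And>i. \<bar>x $ i\<bar> \<le> k" shows "norm x \<le> 4 * k"
proof -
  have "norm x \<le> (\<Sum>i\<in>UNIV. \<bar>x $ i\<bar>)" by (rule norm_le_l1_cart)
  also have "\<dots> \<le> (\<Sum>i\<in>(UNIV::4 set). k)" by (rule sum_mono) (rule assms)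
  finally show ?thesis by simp
qed

lemma char_int_diff:
  assumes "continuous_on UNIV f" "continuous_on UNIV g"
  shows "char_int e d (\<lambda>p. f p - g p) p = char_int e d f p - char_int e d g p"
  unfolding char_int_def
  by (simp add: Henstock_Kurzweil_Integration.integral_diff integrable_line_integrand assms right_diff_distrib)

lemma matA_nth:
  "(matA c *v x) $ 1 = x $ 1" "(matA c *v x) $ 2 = - x $ 2"
  "(matA c *v x) $ 3 = c * x $ 3" "(matA c *v x) $ 4 = - c * x $ 4"
  by (simp_all add: matA_def matrix_vector_mult_def vector_def sum_4)

lemma matB_nth:
  "(matB c *v x) $ 1 = ((- 1 - c) * x $ 3 + (- 1 + c) * x $ 4) / 2"
  "(matB c *v x) $ 2 = ((1 - c) * x $ 3 + (1 + c) * x $ 4) / 2"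
  "(matB c *v x) $ 3 = ((1 + c) * x $ 1 + (- 1 + c) * x $ 2) / 2"
  "(matB c *v x) $ 4 = ((1 - c) * x $ 1 + (- 1 - c) * x $ 2) / 2"
  by (simp_all add: matB_def matrix_vector_mult_def vector_def sum_4 field_simps)

text \<open>In the coordinates \<open>(z, s)\<close> with \<open>s = t - z\<close> the \<open>i\<close>th equation prescribes the derivative of
  \<open>m\<^sub>i\<close> in the direction \<open>dir i\<close>. Extending the coefficient by \<open>0\<close> to \<open>z < 0\<close> turns the
  characteristic problem into a Cauchy problem on the whole plane: the conditions at
  \<open>z = 0\<close> become automatic.\<close>

locale char_system =
  fixes c :: real and \<beta> \<beta>' :: "real \<Rightarrow> real"
  assumes c: "0 < c" "c < 1"
    and \<beta>: "\<And>x. (\<beta> has_real_derivative \<beta>' x) (at x)" and \<beta>': "continuous_on UNIV \<beta>'"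
    and \<beta>0: "\<And>x. x \<le> 0 \<Longrightarrow> \<beta> x = 0"
begin

text \<open>With s = t - z and a the i-th diagonal entry of A, the i-th equation says that (1 + a)
  times the s-derivative minus a times the z-derivative of the i-th component is \<beta> (B m)_i.
  \<open>dir\<close> is (-a, 1 + a) divided by 1 + a, and \<open>wt\<close> is the factor 1 / (1 +
  a) left on the right-hand side; for i = 2, where 1 + a = 0, the vector is already (1, 0).\<close>

definition dir :: "4 \<Rightarrow> real \<times> real" where
  "dir i = (if i = 1 then (- 1 / 2, 1) else if i = 2 then (1, 0)
     else if i = 3 then (- c / (1 + c), 1) else (c / (1 - c), 1))"

text \<open>The line on which \<open>p \<bullet> covec i\<close> vanishes carries the data: z = 0
  for the second component, whose characteristics are parallel to s = 0, and s = 0 for the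
  others.\<close>

definition covec :: "4 \<Rightarrow> real \<times> real" where
  "covec i = (if i = 2 then (1, 0) else (0, 1))"

definition wt :: "4 \<Rightarrow> real" where
  "wt i = (if i = 1 then 1 / 2 else if i = 2 then 1 else if i = 3 then 1 / (1 + c) else 1 / (1 - c))"

lemma dir_covec: "dir i \<bullet> covec i = 1"
  using exhaust_4[of i] by (auto simp: dir_def covec_def)

lemma wt_bounds: "0 \<le> wt i" "wt i \<le> 1 / (1 - c)"
  using exhaust_4[of i] c by (auto simp: wt_def field_simps)

text \<open>Moving back along \<open>dir i\<close> by r in s changes z by at most (1 + c/(1 - c)) r;
  the coefficient of \<bar>s\<bar> exceeds this slope by 1, so the weight still falls at unit
  rate.\<close>

definition om :: "real \<times> real \<Rightarrow> real" where
  "om p = \<bar>fst p\<bar> + (2 + c / (1 - c)) * \<bar>snd p\<bar>"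

lemma om_nonneg: "om p \<ge> 0"
  using c by (auto simp: om_def intro!: add_nonneg_nonneg mult_nonneg_nonneg)

lemma om_shift:
  assumes "0 \<le> r" "r \<le> 1"
  shows "om (p - (r * (p \<bullet> covec i)) *\<^sub>R dir i) \<le> om p - r * \<bar>p \<bullet> covec i\<bar>"
proof -
  obtain z s where p: "p = (z, s)" by (cases p)
  have r: "\<bar>x - r * x\<bar> = \<bar>x\<bar> - r * \<bar>x\<bar>" for x
  proof -
    have "\<bar>x - r * x\<bar> = \<bar>(1 - r) * x\<bar>" by (simp add: algebra_simps)
    then have "\<bar>x - r * x\<bar> = (1 - r) * \<bar>x\<bar>" using assms by (simp add: abs_mult)
    then show ?thesis by (simp add: algebra_simps)
  qed
  show ?thesis
  proof (cases "i = 2")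
    case True
    then show ?thesis
      using r[of z] by (simp add: p om_def covec_def dir_def)
  next
    case False
    define k where "k = fst (dir i)"
    \<comment> \<open>A crude common bound for the three slopes -1/2, -c/(1 + c) and c/(1 -
      c).\<close>
    have k: "\<bar>k\<bar> \<le> 1 + c / (1 - c)"
    proof -
      have "0 \<le> c / (1 - c)" "0 \<le> c / (1 + c)" "c / (1 + c) \<le> 1" using c by (auto simp: field_simps)
      moreover have "k = - 1 / 2 \<or> k = - (c / (1 + c)) \<or> k = c / (1 - c)"
        using exhaust_4[of i] False by (auto simp: k_def dir_def)
      ultimately show ?thesis by (elim disjE; linarith)
    qed
    have d: "dir i = (k, 1)" "covec i = (0, 1)"
      using exhaust_4[of i] False by (auto simp: k_def dir_def covec_def)
    have "\<bar>r * s * k\<bar> = r * \<bar>s\<bar> * \<bar>k\<bar>" using assms by (simp add: abs_mult)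
    also have "\<dots> \<le> r * \<bar>s\<bar> * (1 + c / (1 - c))" using k assms by (intro mult_left_mono) auto
    finally have "\<bar>z - r * s * k\<bar> \<le> \<bar>z\<bar> + r * \<bar>s\<bar> * (1 + c / (1 - c))" by linarith
    moreover have "om (p - (r * (p \<bullet> covec i)) *\<^sub>R dir i) = \<bar>z - r * s * k\<bar> + (2 + c / (1 - c)) * (\<bar>s\<bar> - r * \<bar>s\<bar>)"
      unfolding r[symmetric] by (simp add: p om_def d)
    moreover have "om p = \<bar>z\<bar> + (2 + c / (1 - c)) * \<bar>s\<bar>" "p \<bullet> covec i = s"
      by (simp_all add: p om_def d)
    ultimately show ?thesis
      by (simp add: algebra_simps)
  qed
qed

lemma om_base: "om (p - (p \<bullet> covec i) *\<^sub>R dir i) \<le> om p"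
  using om_shift[of 1 p i] by (simp; linarith)

definition src :: "(real \<times> real \<Rightarrow> real^4) \<Rightarrow> 4 \<Rightarrow> real \<times> real \<Rightarrow> real" where
  "src f i q = wt i * (\<beta> (fst q) * (matB c *v f q) $ i)"

text \<open>The coefficient depends on z alone, so \<open>\<beta>'\<close> enters only here; the
  s-derivative of \<open>src f i\<close> is \<open>src fs i\<close>.\<close>

definition src_z :: "(real \<times> real \<Rightarrow> real^4) \<Rightarrow> (real \<times> real \<Rightarrow> real^4) \<Rightarrow> 4 \<Rightarrow> real \<times> real \<Rightarrow> real" where
  "src_z f fz i q = wt i * (\<beta>' (fst q) * (matB c *v f q) $ i + \<beta> (fst q) * (matB c *v fz q) $ i)"

definition pic :: "(real \<times> real \<Rightarrow> real^4) \<Rightarrow> real \<times> real \<Rightarrow> real^4" where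
  "pic f p = (\<chi> i. char_int (covec i) (dir i) (src f i) p)"

text \<open>This and \<open>pic_s\<close> are the derivative formulas of
  \<open>C1_plane_char_int\<close>, read as operators on \<open>fz\<close> and \<open>fs\<close>;
  the term outside the integral is the value at the foot.\<close>

definition pic_z :: "(real \<times> real \<Rightarrow> real^4) \<Rightarrow> (real \<times> real \<Rightarrow> real^4) \<Rightarrow> real \<times> real \<Rightarrow> real^4" where
  "pic_z f fz p = (\<chi> i. fst (covec i) * src f i (p - (p \<bullet> covec i) *\<^sub>R dir i) +
     char_int (covec i) (dir i) (src_z f fz i) p)"

definition pic_s :: "(real \<times> real \<Rightarrow> real^4) \<Rightarrow> (real \<times> real \<Rightarrow> real^4) \<Rightarrow> real \<times> real \<Rightarrow> real^4" where
  "pic_s f fs p = (\<chi> i. snd (covec i) * src f i (p - (p \<bullet> covec i) *\<^sub>R dir i) +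
     char_int (covec i) (dir i) (src fs i) p)"

lemma continuous_\<beta>: "continuous_on S \<beta>"
  using \<beta> DERIV_isCont continuous_at_imp_continuous_on by blast

lemma C1_plane_src:
  assumes "C1_plane f fz fs"
  shows "C1_plane (src f i) (src_z f fz i) (src fs i)"
proof -
  note f = C1_planeD[OF assms]
  have cB: "continuous_on UNIV (\<lambda>q. (matB c *v g q) $ i)" if "continuous_on UNIV g" for g :: "real \<times> real \<Rightarrow> real^4"
    using that by (auto intro!: continuous_intros matrix_vector_mult_linear_continuous_on[THEN continuous_on_compose2])
  have cb: "continuous_on UNIV (\<lambda>q::real\<times>real. \<beta> (fst q))" "continuous_on UNIV (\<lambda>q::real\<times>real. \<beta>' (fst q))"
    by (rule continuous_on_compose2[OF continuous_\<beta>[of UNIV]], auto intro!: continuous_intros)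
      (rule continuous_on_compose2[OF \<beta>'], auto intro!: continuous_intros)
  have "(src f i has_derivative (\<lambda>(h, k). h *\<^sub>R src_z f fz i p + k *\<^sub>R src fs i p)) (at p)" for p
  proof -
    have B: "((\<lambda>q. (matB c *v f q) $ i) has_derivative
      (\<lambda>(h, k). h *\<^sub>R (matB c *v fz p) $ i + k *\<^sub>R (matB c *v fs p) $ i)) (at p)"
    proof -
      have "bounded_linear (\<lambda>x. (matB c *v x) $ i)"
        using bounded_linear_compose[OF bounded_linear_vec_nth matrix_vector_mul_bounded_linear] by blast
      from bounded_linear.has_derivative[OF this f(4)[of p UNIV]]
      show ?thesis
        by (rule has_derivative_eq_rhs)
          (auto simp: case_prod_beta fun_eq_iff matrix_vector_right_distrib matrix_vector_mult_scaleR)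
    qed
    have "((\<lambda>q. \<beta> (fst q)) has_derivative (\<lambda>v. \<beta>' (fst p) * fst v)) (at p)"
      by (rule has_derivative_compose[OF bounded_linear_imp_has_derivative[OF bounded_linear_fst]])
        (use \<beta>[of "fst p"] in \<open>simp add: has_field_derivative_def\<close>)
    from has_derivative_mult_right[OF has_derivative_mult[OF this B], of "wt i"]
    show ?thesis
      unfolding src_def[abs_def]
      by (rule has_derivative_eq_rhs) (auto simp: src_z_def src_def case_prod_beta fun_eq_iff algebra_simps)
  qed
  moreover have "continuous_on UNIV (src_z f fz i)" "continuous_on UNIV (src fs i)"
    unfolding src_z_def[abs_def] src_def[abs_def] by (intro continuous_intros cB cb f)+
  ultimately show ?thesis by (simp add: C1_plane_def)
qed

lemma continuous_src:
  assumes "continuous_on UNIV f" shows "continuous_on UNIV (src f i)"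
proof -
  have "continuous_on UNIV (\<lambda>q. (matB c *v f q) $ i)"
    using assms by (auto intro!: continuous_intros matrix_vector_mult_linear_continuous_on[THEN continuous_on_compose2])
  moreover have "continuous_on UNIV (\<lambda>q::real\<times>real. \<beta> (fst q))"
    by (rule continuous_on_compose2[OF continuous_\<beta>[of UNIV]], auto intro!: continuous_intros)
  ultimately show ?thesis
    unfolding src_def[abs_def] by (intro continuous_on_mult continuous_on_const)
qed

lemma C1_plane_pic:
  assumes "C1_plane f fz fs"
  shows "C1_plane (pic f) (pic_z f fz) (pic_s f fs)"
  unfolding C1_plane_componentwise pic_def pic_z_def pic_s_def
  using C1_plane_char_int[OF C1_plane_src[OF assms]] by simp

lemma pic_diff:
  assumes "continuous_on UNIV f" "continuous_on UNIV g"
  shows "pic (\<lambda>p. f p - g p) p = pic f p - pic g p"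
proof -
  have "src (\<lambda>p. f p - g p) i = (\<lambda>q. src f i q - src g i q)" for i
    by (auto simp: src_def matrix_vector_mult_diff_distrib algebra_simps)
  then show ?thesis
    using assms by (simp add: pic_def vec_eq_iff char_int_diff continuous_src)
qed

text \<open>Contraction by 1/2 in sup norms weighted with exp(-\<mu> om) on the set
  \<open>om \<le> L\<close>, which contains the characteristic segments from its points back to the
  data lines and on which \<open>\<beta>\<close> and \<open>\<beta>'\<close> are bounded. In the
  second estimate the foot values gain no \<open>1 / \<mu>\<close>, but they are of size
  \<open>A\<close> and so small against the allowance \<open>E * A\<close> for derivatives.\<close>

lemma pic_bounds:
  obtains \<mu> E where "\<mu> > 0" "E \<ge> 1"
    "\<And>A f q. \<lbrakk>A \<ge> 0; continuous_on UNIV f; \<And>q. om q \<le> L \<Longrightarrow> norm (f q) \<le> A * exp (\<mu> * om q); om q \<le> L\<rbrakk>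
       \<Longrightarrow> norm (pic f q) \<le> A / 2 * exp (\<mu> * om q)"
    "\<And>A f fz fs q. \<lbrakk>A \<ge> 0; C1_plane f fz fs; \<And>q. om q \<le> L \<Longrightarrow> norm (f q) \<le> A * exp (\<mu> * om q);
        \<And>q. om q \<le> L \<Longrightarrow> norm (fz q) \<le> E * A * exp (\<mu> * om q);
        \<And>q. om q \<le> L \<Longrightarrow> norm (fs q) \<le> E * A * exp (\<mu> * om q); om q \<le> L\<rbrakk>
       \<Longrightarrow> norm (pic_z f fz q) \<le> E * (A / 2) * exp (\<mu> * om q) \<and> norm (pic_s f fs q) \<le> E * (A / 2) * exp (\<mu> * om q)"
proof -
  obtain K where K: "K > 0" "\<And>x. norm (matB c *v x) \<le> norm x * K"
    using bounded_linear.pos_bounded[OF matrix_vector_mul_bounded_linear[of "matB c"]] by blast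
  have "bounded (\<beta> ` {-L..L})" "bounded (\<beta>' ` {-L..L})"
    by (intro compact_imp_bounded compact_continuous_image continuous_\<beta> compact_Icc
        continuous_on_subset[OF \<beta>'] subset_UNIV)+
  then obtain b1 b2 where b12: "\<And>x. x \<in> {-L..L} \<Longrightarrow> \<bar>\<beta> x\<bar> \<le> b1" "\<And>x. x \<in> {-L..L} \<Longrightarrow> \<bar>\<beta>' x\<bar> \<le> b2"
    unfolding bounded_iff by force
  define b where "b = max 0 (max b1 b2)"
  have b: "b \<ge> 0" "\<And>q. om q \<le> L \<Longrightarrow> \<bar>\<beta> (fst q)\<bar> \<le> b \<and> \<bar>\<beta>' (fst q)\<bar> \<le> b"
  proof -
    fix q assume "om q \<le> L"
    moreover have "\<bar>fst q\<bar> \<le> om q" using c by (simp add: om_def)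
    ultimately have "fst q \<in> {-L..L}" by auto
    from b12[OF this] show "\<bar>\<beta> (fst q)\<bar> \<le> b \<and> \<bar>\<beta>' (fst q)\<bar> \<le> b" by (auto simp: b_def)
  qed (simp add: b_def)
  define C0 where "C0 = 1 / (1 - c) * (b * K)"
  have C0: "C0 \<ge> 0" using b K c by (simp add: C0_def)
  have tm: "wt i * \<bar>y * (matB c *v x) $ i\<bar> \<le> C0 * norm x" if "\<bar>y\<bar> \<le> b" for y x i
  proof -
    have "\<bar>(matB c *v x) $ i\<bar> \<le> K * norm x"
      using K(2)[of x] component_le_norm_cart[of "matB c *v x" i] by (simp add: mult.commute)
    then have "\<bar>y * (matB c *v x) $ i\<bar> \<le> b * (K * norm x)"
      unfolding abs_mult using that b by (intro mult_mono) auto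
    then have "wt i * \<bar>y * (matB c *v x) $ i\<bar> \<le> 1 / (1 - c) * (b * (K * norm x))"
      using wt_bounds[of i] c by (intro mult_mono) auto
    then show ?thesis by (simp add: C0_def)
  qed
  have src: "\<bar>src f i q\<bar> \<le> C0 * norm (f q)" if "om q \<le> L" for f i q
    using tm[of "\<beta> (fst q)" i "f q"] b(2)[OF that] wt_bounds(1)[of i] by (simp add: src_def abs_mult)
  have src_z: "\<bar>src_z f fz i q\<bar> \<le> C0 * norm (f q) + C0 * norm (fz q)" if "om q \<le> L" for f fz i q
  proof -
    have "\<bar>src_z f fz i q\<bar> \<le> wt i * (\<bar>\<beta>' (fst q) * (matB c *v f q) $ i\<bar> + \<bar>\<beta> (fst q) * (matB c *v fz q) $ i\<bar>)"
      unfolding src_z_def abs_mult[of "wt i"] abs_of_nonneg[OF wt_bounds(1)]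
      by (rule mult_left_mono[OF abs_triangle_ineq wt_bounds(1)])
    then show ?thesis
      using tm[of "\<beta>' (fst q)" i "f q"] tm[of "\<beta> (fst q)" i "fz q"] b(2)[OF that]
      by (simp add: distrib_left)
  qed
  \<comment> \<open>This choice gives \<open>C0 / \<mu> \<le> 1 / 16\<close>, which with the factor
    4 of \<open>norm_le_4\<close> leaves 1/4 for \<open>pic\<close>, and
    \<open>\<mu> / 8 = 2 * C0 + 1 / 2\<close>, which covers \<open>C0 + (C0 / \<mu> + C0)\<close> in
    the derivative estimate.\<close>
  define \<mu> where "\<mu> = 16 * C0 + 4"
  have \<mu>: "\<mu> \<ge> 4" "C0 / \<mu> \<le> 1 / 16" using C0 by (auto simp: \<mu>_def field_simps)
  have exp: "exp (\<mu> * om q) \<le> exp (\<mu> * om p)" if "om q \<le> om p" for p q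
    using that \<mu> by simp
  show ?thesis
  proof
    \<comment> \<open>The witness for \<open>E\<close> is \<open>\<mu>\<close> itself.\<close>
    show "\<mu> > 0" "\<mu> \<ge> 1" using \<mu> by auto
  next
    fix A and f :: "real \<times> real \<Rightarrow> real^4" and q
    assume A: "A \<ge> 0" and f: "continuous_on UNIV f"
      and bd: "\<And>q. om q \<le> L \<Longrightarrow> norm (f q) \<le> A * exp (\<mu> * om q)" and q: "om q \<le> L"
    have "\<bar>char_int (covec i) (dir i) (src f i) q\<bar> \<le> C0 * A / \<mu> * exp (\<mu> * om q)" for i
    proof (rule char_int_bound[OF continuous_src[OF f] _ _ om_shift])
      fix p assume "om p \<le> om q"
      with q have p: "om p \<le> L" by simp
      have "\<bar>src f i p\<bar> \<le> C0 * norm (f p)" by (rule src[OF p])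
      also have "\<dots> \<le> C0 * (A * exp (\<mu> * om p))" using bd[OF p] C0 by (rule mult_left_mono)
      finally show "\<bar>src f i p\<bar> \<le> C0 * A * exp (\<mu> * om p)" by simp
    qed (use \<mu> A C0 in auto)
    then have "norm (pic f q) \<le> 4 * (C0 * A / \<mu> * exp (\<mu> * om q))"
      by (intro norm_le_4) (simp add: pic_def)
    also have "\<dots> = (C0 / \<mu>) * (4 * A * exp (\<mu> * om q))" by simp
    also have "\<dots> \<le> 1 / 16 * (4 * A * exp (\<mu> * om q))" using \<mu>(2) A by (intro mult_right_mono) auto
    also have "\<dots> \<le> A / 2 * exp (\<mu> * om q)" using A by simp
    finally show "norm (pic f q) \<le> A / 2 * exp (\<mu> * om q)" .
  next
    fix A and f fz fs :: "real \<times> real \<Rightarrow> real^4" and q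
    assume A: "A \<ge> 0" and f: "C1_plane f fz fs"
      and bd: "\<And>q. om q \<le> L \<Longrightarrow> norm (f q) \<le> A * exp (\<mu> * om q)"
        "\<And>q. om q \<le> L \<Longrightarrow> norm (fz q) \<le> \<mu> * A * exp (\<mu> * om q)"
        "\<And>q. om q \<le> L \<Longrightarrow> norm (fs q) \<le> \<mu> * A * exp (\<mu> * om q)" and q: "om q \<le> L"
    have base: "\<bar>k * src f i (q - (q \<bullet> covec i) *\<^sub>R dir i)\<bar> \<le> C0 * (A * exp (\<mu> * om q))" if "\<bar>k\<bar> \<le> 1" for i k
    proof -
      let ?q = "q - (q \<bullet> covec i) *\<^sub>R dir i"
      have *: "om ?q \<le> L" using om_base[of q i] q by linarith
      have "\<bar>k * src f i ?q\<bar> \<le> \<bar>src f i ?q\<bar>" using that by (simp add: abs_mult mult_left_le_one_le)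
      also have "\<dots> \<le> C0 * norm (f ?q)" by (rule src[OF *])
      also have "\<dots> \<le> C0 * (A * exp (\<mu> * om ?q))" by (rule mult_left_mono[OF bd(1)[OF *] C0])
      also have "\<dots> \<le> C0 * (A * exp (\<mu> * om q))" using exp[OF om_base[of q i]] A C0 by (intro mult_left_mono)
      finally show ?thesis .
    qed
    have int_z: "\<bar>char_int (covec i) (dir i) (src_z f fz i) q\<bar> \<le> (C0 * (A + \<mu> * A)) / \<mu> * exp (\<mu> * om q)" for i
    proof (rule char_int_bound[OF C1_planeD(2)[OF C1_plane_src[OF f]] _ _ om_shift])
      fix p assume "om p \<le> om q"
      with q have p: "om p \<le> L" by simp
      have "\<bar>src_z f fz i p\<bar> \<le> C0 * norm (f p) + C0 * norm (fz p)" by (rule src_z[OF p])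
      also have "\<dots> \<le> C0 * (A * exp (\<mu> * om p)) + C0 * (\<mu> * A * exp (\<mu> * om p))"
        using bd(1,2)[OF p] C0 by (intro add_mono mult_left_mono)
      finally show "\<bar>src_z f fz i p\<bar> \<le> (C0 * (A + \<mu> * A)) * exp (\<mu> * om p)" by (simp add: algebra_simps)
    qed (use \<mu> A C0 in auto)
    have int_s: "\<bar>char_int (covec i) (dir i) (src fs i) q\<bar> \<le> (C0 * (A + \<mu> * A)) / \<mu> * exp (\<mu> * om q)" for i
    proof (rule char_int_bound[OF C1_planeD(3)[OF C1_plane_src[OF f]] _ _ om_shift])
      fix p assume "om p \<le> om q"
      with q have p: "om p \<le> L" by simp
      have "\<bar>src fs i p\<bar> \<le> C0 * norm (fs p)" by (rule src[OF p])
      also have "\<dots> \<le> C0 * (A * exp (\<mu> * om p)) + C0 * (\<mu> * A * exp (\<mu> * om p))"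
        using mult_left_mono[OF bd(3)[OF p] C0] A C0 by (simp add: add_increasing)
      finally show "\<bar>src fs i p\<bar> \<le> (C0 * (A + \<mu> * A)) * exp (\<mu> * om p)" by (simp add: algebra_simps)
    qed (use \<mu> A C0 in auto)
    let ?T = "C0 * (A * exp (\<mu> * om q)) + (C0 * (A + \<mu> * A)) / \<mu> * exp (\<mu> * om q)"
    have cov: "\<bar>fst (covec i)\<bar> \<le> 1" "\<bar>snd (covec i)\<bar> \<le> 1" for i by (auto simp: covec_def)
    have nz: "norm (pic_z f fz q) \<le> 4 * ?T"
      by (rule norm_le_4, unfold pic_z_def vec_lambda_beta)
        (rule order_trans[OF abs_triangle_ineq add_mono[OF base[OF cov(1)] int_z]])
    have ns: "norm (pic_s f fs q) \<le> 4 * ?T"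
      by (rule norm_le_4, unfold pic_s_def vec_lambda_beta)
        (rule order_trans[OF abs_triangle_ineq add_mono[OF base[OF cov(2)] int_s]])
    have "C0 + (C0 / \<mu> + C0) \<le> \<mu> / 8"
    proof -
      have "\<mu> / 8 = 2 * C0 + 1 / 2" by (simp add: \<mu>_def)
      then show ?thesis using \<mu>(2) by linarith
    qed
    then have "(C0 + (C0 / \<mu> + C0)) * (4 * (A * exp (\<mu> * om q))) \<le> \<mu> / 8 * (4 * (A * exp (\<mu> * om q)))"
      using A by (intro mult_right_mono) auto
    moreover have "4 * ?T = (C0 + (C0 / \<mu> + C0)) * (4 * (A * exp (\<mu> * om q)))"
      using \<mu>(1) by (simp add: field_simps)
    moreover have "\<mu> / 8 * (4 * (A * exp (\<mu> * om q))) = \<mu> * (A / 2) * exp (\<mu> * om q)" by simp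
    ultimately have "4 * ?T \<le> \<mu> * (A / 2) * exp (\<mu> * om q)" by metis
    with nz ns show "norm (pic_z f fz q) \<le> \<mu> * (A / 2) * exp (\<mu> * om q) \<and>
        norm (pic_s f fs q) \<le> \<mu> * (A / 2) * exp (\<mu> * om q)" by linarith
  qed
qed

end

lemma (in char_system) compact_om: "compact {q. om q \<le> L}"
proof -
  have "\<bar>fst q\<bar> \<le> om q \<and> \<bar>snd q\<bar> \<le> om q" for q
  proof -
    have "1 * \<bar>snd q\<bar> \<le> (2 + c / (1 - c)) * \<bar>snd q\<bar>" using c by (intro mult_right_mono) auto
    moreover have "0 \<le> (2 + c / (1 - c)) * \<bar>snd q\<bar>" using c by simp
    ultimately show ?thesis by (simp add: om_def)
  qed
  then have "norm q \<le> 2 * L" if "om q \<le> L" for q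
    using that norm_Pair_le[of "fst q" "snd q"] by (simp, smt (verit))
  then have "bounded {q. om q \<le> L}"
    unfolding bounded_iff by blast
  moreover have "closed {q. om q \<le> L}"
    unfolding om_def by (intro closed_Collect_le continuous_intros)
  ultimately show ?thesis
    by (simp add: compact_eq_bounded_closed)
qed

lemma (in char_system) om_ball:
  assumes "q \<in> ball p 1" shows "om q \<le> om p + 3 + c / (1 - c)"
proof -
  have "\<bar>fst q - fst p\<bar> \<le> 1" "\<bar>snd q - snd p\<bar> \<le> 1"
    using assms dist_fst_le[of q p] dist_snd_le[of q p] by (auto simp: dist_real_def dist_commute)
  moreover from this have "(2 + c / (1 - c)) * \<bar>snd q\<bar> \<le> (2 + c / (1 - c)) * (\<bar>snd p\<bar> + 1)"
    using c by (intro mult_left_mono) auto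
  ultimately show ?thesis by (simp add: om_def distrib_left)
qed

text \<open>Differentiability is local, so majorants on unit balls suffice; they may depend on the
  ball, as the Picard bounds do through \<open>L\<close>.\<close>

lemma C1_plane_suminf:
  fixes f :: "nat \<Rightarrow> real \<times> real \<Rightarrow> 'b::banach"
  assumes f: "\<And>n. C1_plane (f n) (fx n) (fy n)"
    and bd: "\<And>p. \<exists>B. summable B \<and> (\<forall>n. \<forall>q\<in>ball p 1.
      norm (f n q) \<le> B n \<and> norm (fx n q) \<le> B n \<and> norm (fy n q) \<le> B n)"
  shows "C1_plane (\<lambda>p. \<Sum>n. f n p) (\<lambda>p. \<Sum>n. fx n p) (\<lambda>p. \<Sum>n. fy n p)"
proof -
  have cont: "continuous_on UNIV (\<lambda>p. \<Sum>n. g n p)"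
    if c: "\<And>n. continuous_on UNIV (g n)"
      and b: "\<And>p. \<exists>B. summable B \<and> (\<forall>n. \<forall>q\<in>ball p 1. norm (g n q) \<le> B n)" for g :: "nat \<Rightarrow> real \<times> real \<Rightarrow> 'b"
  proof (rule continuous_at_imp_continuous_on, rule ballI)
    fix p :: "real \<times> real"
    obtain B where "summable B" "\<And>n q. q \<in> ball p 1 \<Longrightarrow> norm (g n q) \<le> B n" using b[of p] by blast
    then have "uniform_limit (ball p 1) (\<lambda>n q. \<Sum>i<n. g i q) (\<lambda>q. \<Sum>i. g i q) sequentially"
      by (intro Weierstrass_m_test) auto
    then have "continuous_on (ball p 1) (\<lambda>q. \<Sum>i. g i q)"
      by (rule uniform_limit_theorem[rotated])
        (auto intro!: always_eventually continuous_on_sum continuous_on_subset[OF c])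
    then show "isCont (\<lambda>p. \<Sum>n. g n p) p"
      by (simp add: continuous_on_eq_continuous_at)
  qed
  have "((\<lambda>p. \<Sum>n. f n p) has_derivative (\<lambda>(h, k). h *\<^sub>R (\<Sum>n. fx n p) + k *\<^sub>R (\<Sum>n. fy n p))) (at p)" for p
  proof -
    obtain B where B: "summable B" "\<And>n q. q \<in> ball p 1 \<Longrightarrow>
        norm (f n q) \<le> B n \<and> norm (fx n q) \<le> B n \<and> norm (fy n q) \<le> B n" using bd[of p] by blast
    have ux: "uniform_limit (ball p 1) (\<lambda>n q. \<Sum>i<n. fx i q) (\<lambda>q. \<Sum>i. fx i q) sequentially"
      and uy: "uniform_limit (ball p 1) (\<lambda>n q. \<Sum>i<n. fy i q) (\<lambda>q. \<Sum>i. fy i q) sequentially"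
      using B by (intro Weierstrass_m_test; auto)+
    have sums: "(\<lambda>n. f n q) sums (\<Sum>n. f n q)" if "q \<in> ball p 1" for q
      using summable_comparison_test[of "\<lambda>n. f n q" B] B that by (auto intro: summable_sums)
    have "\<exists>g. \<forall>x\<in>ball p 1. (\<lambda>n. f n x) sums g x \<and>
       (g has_derivative (\<lambda>(h, k). h *\<^sub>R (\<Sum>n. fx n x) + k *\<^sub>R (\<Sum>n. fy n x))) (at x within ball p 1)"
    proof (rule has_derivative_series)
      show "(f n has_derivative (\<lambda>(h, k). h *\<^sub>R fx n x + k *\<^sub>R fy n x)) (at x within ball p 1)" for n x
        by (rule C1_planeD(4)[OF f])
      fix e :: real assume e: "e > 0"
      have "\<forall>\<^sub>F n in sequentially. \<forall>x\<in>ball p 1. dist (\<Sum>i<n. fx i x) (\<Sum>i. fx i x) < e / 2"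
        "\<forall>\<^sub>F n in sequentially. \<forall>x\<in>ball p 1. dist (\<Sum>i<n. fy i x) (\<Sum>i. fy i x) < e / 2"
        using ux uy e unfolding uniform_limit_iff by (meson half_gt_zero)+
      then show "\<forall>\<^sub>F n in sequentially. \<forall>x\<in>ball p 1. \<forall>h.
        norm ((\<Sum>i<n. (\<lambda>(h, k). h *\<^sub>R fx i x + k *\<^sub>R fy i x) h) - (\<lambda>(h, k). h *\<^sub>R (\<Sum>n. fx n x) + k *\<^sub>R (\<Sum>n. fy n x)) h) \<le> e * norm h"
      proof (eventually_elim, intro ballI allI)
        fix n x and v :: "real \<times> real"
        assume "\<forall>x\<in>ball p 1. dist (\<Sum>i<n. fx i x) (\<Sum>i. fx i x) < e / 2"
          "\<forall>x\<in>ball p 1. dist (\<Sum>i<n. fy i x) (\<Sum>i. fy i x) < e / 2" "x \<in> ball p 1"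
        then have d: "norm ((\<Sum>i<n. fx i x) - (\<Sum>i. fx i x)) \<le> e / 2" "norm ((\<Sum>i<n. fy i x) - (\<Sum>i. fy i x)) \<le> e / 2"
          by (auto simp: dist_norm less_imp_le)
        obtain h k where v: "v = (h, k)" by (cases v)
        have hk: "\<bar>h\<bar> \<le> norm v" "\<bar>k\<bar> \<le> norm v"
          using norm_fst_le[of h k] norm_snd_le[of k h] by (simp_all only: v real_norm_def)
        have lin: "(\<Sum>i<n. h *\<^sub>R fx i x + k *\<^sub>R fy i x) = h *\<^sub>R (\<Sum>i<n. fx i x) + k *\<^sub>R (\<Sum>i<n. fy i x)"
          by (simp only: sum.distrib scaleR_sum_right)
        have "norm ((\<Sum>i<n. h *\<^sub>R fx i x + k *\<^sub>R fy i x) - (h *\<^sub>R (\<Sum>n. fx n x) + k *\<^sub>R (\<Sum>n. fy n x)))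
          = norm (h *\<^sub>R ((\<Sum>i<n. fx i x) - (\<Sum>i. fx i x)) + k *\<^sub>R ((\<Sum>i<n. fy i x) - (\<Sum>i. fy i x)))"
          by (simp only: lin scaleR_diff_right add_diff_add)
        also have "\<dots> \<le> \<bar>h\<bar> * norm ((\<Sum>i<n. fx i x) - (\<Sum>i. fx i x)) + \<bar>k\<bar> * norm ((\<Sum>i<n. fy i x) - (\<Sum>i. fy i x))"
          by (rule order_trans[OF norm_triangle_ineq]) simp
        also have "\<dots> \<le> norm v * (e / 2) + norm v * (e / 2)"
          using d hk by (intro add_mono mult_mono) auto
        finally show "norm ((\<Sum>i<n. (\<lambda>(h, k). h *\<^sub>R fx i x + k *\<^sub>R fy i x) v) - (\<lambda>(h, k). h *\<^sub>R (\<Sum>n. fx n x) + k *\<^sub>R (\<Sum>n. fy n x)) v) \<le> e * norm v"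
          by (simp add: v mult.commute)
      qed
    qed (use sums[of p] in auto)
    then obtain g where g: "\<And>x. x \<in> ball p 1 \<Longrightarrow> (\<lambda>n. f n x) sums g x"
      "\<And>x. x \<in> ball p 1 \<Longrightarrow> (g has_derivative (\<lambda>(h, k). h *\<^sub>R (\<Sum>n. fx n x) + k *\<^sub>R (\<Sum>n. fy n x))) (at x within ball p 1)"
      by blast
    have "((\<lambda>p. \<Sum>n. f n p) has_derivative (\<lambda>(h, k). h *\<^sub>R (\<Sum>n. fx n p) + k *\<^sub>R (\<Sum>n. fy n p))) (at p within ball p 1)"
      by (rule has_derivative_transform[OF _ _ g(2)]) (use g(1) in \<open>auto simp: sums_iff\<close>)
    then show ?thesis
      by (simp add: at_within_open[of p "ball p 1"])
  qed
  moreover have "continuous_on UNIV (\<lambda>p. \<Sum>n. fx n p)"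
  proof (rule cont[OF C1_planeD(2)[OF f]])
    fix p from bd[of p] show "\<exists>B. summable B \<and> (\<forall>n. \<forall>q\<in>ball p 1. norm (fx n q) \<le> B n)" by metis
  qed
  moreover have "continuous_on UNIV (\<lambda>p. \<Sum>n. fy n p)"
  proof (rule cont[OF C1_planeD(3)[OF f]])
    fix p from bd[of p] show "\<exists>B. summable B \<and> (\<forall>n. \<forall>q\<in>ball p 1. norm (fy n q) \<le> B n)" by metis
  qed
  ultimately show ?thesis by (simp add: C1_plane_def)
qed

context char_system begin

text \<open>The Neumann series: \<open>m\<close> is the sum of the iterates of \<open>pic\<close> on
  \<open>b\<close>. On each set \<open>om \<le> L\<close> the iterates and their derivatives decay
  like 2^-n, with constants depending on \<open>L\<close>.\<close>

lemma ex_pic_fixpoint: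
  assumes b: "C1_plane b bz bs"
  obtains m mz ms where "C1_plane m mz ms" "\<And>p. m p = b p + pic m p"
proof -
  define it where "it = rec_nat (b, bz, bs) (\<lambda>_ (f, fz, fs). (pic f, pic_z f fz, pic_s f fs))"
  define f where "f n = fst (it n)" for n
  define fz where "fz n = fst (snd (it n))" for n
  define fs where "fs n = snd (snd (it n))" for n
  have f0: "f 0 = b" "fz 0 = bz" "fs 0 = bs" by (auto simp: f_def fz_def fs_def it_def)
  have fS: "f (Suc n) = pic (f n)" "fz (Suc n) = pic_z (f n) (fz n)" "fs (Suc n) = pic_s (f n) (fs n)" for n
    by (auto simp: f_def fz_def fs_def it_def case_prod_beta)
  have C1: "C1_plane (f n) (fz n) (fs n)" for n
    by (induction n) (auto simp: f0 fS b C1_plane_pic)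
  \<comment> \<open>\<open>G\<close> records the contraction for the same \<open>\<mu>\<close> that
    governs the decay of the iterates; it is applied again to the tail of the series.\<close>
  define G where "G L \<mu> E \<longleftrightarrow> \<mu> > 0 \<and> (E::real) \<ge> 1 \<and>
    (\<forall>A h q. A \<ge> 0 \<longrightarrow> continuous_on UNIV h \<longrightarrow> (\<forall>q. om q \<le> L \<longrightarrow> norm (h q) \<le> A * exp (\<mu> * om q)) \<longrightarrow> om q \<le> L
       \<longrightarrow> norm (pic h q) \<le> A / 2 * exp (\<mu> * om q))" for L \<mu> E
  have bounds: "\<exists>\<mu> E A. A \<ge> 0 \<and> G L \<mu> E \<and> (\<forall>n q. om q \<le> L \<longrightarrow>
      norm (f n q) \<le> A / 2 ^ n * exp (\<mu> * om q) \<and>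
      norm (fz n q) \<le> E * (A / 2 ^ n) * exp (\<mu> * om q) \<and> norm (fs n q) \<le> E * (A / 2 ^ n) * exp (\<mu> * om q))" for L
  proof -
    obtain \<mu> E where E: "\<mu> > 0" "E \<ge> 1" and
      P0: "\<And>A f q. \<lbrakk>A \<ge> 0; continuous_on UNIV f; \<And>q. om q \<le> L \<Longrightarrow> norm (f q) \<le> A * exp (\<mu> * om q); om q \<le> L\<rbrakk>
       \<Longrightarrow> norm (pic f q) \<le> A / 2 * exp (\<mu> * om q)" and
      P1: "\<And>A f fz fs q. \<lbrakk>A \<ge> 0; C1_plane f fz fs; \<And>q. om q \<le> L \<Longrightarrow> norm (f q) \<le> A * exp (\<mu> * om q);
        \<And>q. om q \<le> L \<Longrightarrow> norm (fz q) \<le> E * A * exp (\<mu> * om q);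
        \<And>q. om q \<le> L \<Longrightarrow> norm (fs q) \<le> E * A * exp (\<mu> * om q); om q \<le> L\<rbrakk>
       \<Longrightarrow> norm (pic_z f fz q) \<le> E * (A / 2) * exp (\<mu> * om q) \<and> norm (pic_s f fs q) \<le> E * (A / 2) * exp (\<mu> * om q)"
      using pic_bounds[of L] by blast
    have "bounded (g ` {q. om q \<le> L})" if "continuous_on UNIV g" for g :: "real \<times> real \<Rightarrow> real^4"
      by (intro compact_imp_bounded compact_continuous_image compact_om continuous_on_subset[OF that]) auto
    from this[OF C1_planeD(1)[OF b]] this[OF C1_planeD(2)[OF b]] this[OF C1_planeD(3)[OF b]]
    obtain A1 A2 A3 where A13: "\<And>q. om q \<le> L \<Longrightarrow> norm (b q) \<le> A1" "\<And>q. om q \<le> L \<Longrightarrow> norm (bz q) \<le> A2"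
      "\<And>q. om q \<le> L \<Longrightarrow> norm (bs q) \<le> A3" unfolding bounded_iff by (metis imageI mem_Collect_eq)
    define A where "A = max 0 (max A1 (max A2 A3))"
    have A: "A \<ge> 0" by (simp add: A_def)
    have Aq: "A \<le> A * exp (\<mu> * om q)" "A \<le> E * A * exp (\<mu> * om q)" for q
    proof -
      have "1 \<le> exp (\<mu> * om q)" using E om_nonneg by simp
      then show "A \<le> A * exp (\<mu> * om q)" using A by (simp add: mult_le_cancel_left1)
      then show "A \<le> E * A * exp (\<mu> * om q)"
        using E A by (smt (verit) mult_le_cancel_right1 mult.assoc exp_ge_zero mult_nonneg_nonneg)
    qed
    have "\<forall>q. om q \<le> L \<longrightarrow>
      norm (f n q) \<le> A / 2 ^ n * exp (\<mu> * om q) \<and>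
      norm (fz n q) \<le> E * (A / 2 ^ n) * exp (\<mu> * om q) \<and> norm (fs n q) \<le> E * (A / 2 ^ n) * exp (\<mu> * om q)" for n
    proof (induction n)
      case 0
      have "norm (b q) \<le> A \<and> norm (bz q) \<le> A \<and> norm (bs q) \<le> A" if "om q \<le> L" for q
        using A13[OF that] by (auto simp: A_def)
      then have "norm (b q) \<le> A * exp (\<mu> * om q) \<and> norm (bz q) \<le> E * A * exp (\<mu> * om q)
          \<and> norm (bs q) \<le> E * A * exp (\<mu> * om q)" if "om q \<le> L" for q
        using that Aq[of q] by (meson order_trans)
      then show ?case by (simp add: f0)
    next
      case (Suc n)
      have n: "A / 2 ^ n \<ge> 0" "A / 2 ^ Suc n = A / 2 ^ n / 2" using A by auto
      show ?case
        unfolding fS n(2) using P0[OF n(1) C1_planeD(1)[OF C1[of n]]] P1[OF n(1) C1[of n]] Suc by blast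
    qed
    moreover have "G L \<mu> E" unfolding G_def using E P0 by blast
    ultimately show ?thesis using A by blast
  qed
  have sB: "summable (\<lambda>n. C / 2 ^ n)" for C :: real
    using summable_mult[OF summable_geometric[of "1/2::real"], of C] by (simp add: power_divide)
  have loc: "\<exists>B. summable B \<and> (\<forall>n. \<forall>q\<in>ball p 1.
      norm (f n q) \<le> B n \<and> norm (fz n q) \<le> B n \<and> norm (fs n q) \<le> B n)" for p
  proof -
    define L where "L = om p + 3 + c / (1 - c)"
    obtain \<mu> E A where A: "A \<ge> 0" "\<mu> > 0" "E \<ge> 1" and
      bd: "\<And>n q. om q \<le> L \<Longrightarrow>
      norm (f n q) \<le> A / 2 ^ n * exp (\<mu> * om q) \<and>
      norm (fz n q) \<le> E * (A / 2 ^ n) * exp (\<mu> * om q) \<and> norm (fs n q) \<le> E * (A / 2 ^ n) * exp (\<mu> * om q)"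
      using bounds[of L] unfolding G_def by blast
    have "norm (f n q) \<le> E * A * exp (\<mu> * L) / 2 ^ n \<and> norm (fz n q) \<le> E * A * exp (\<mu> * L) / 2 ^ n
        \<and> norm (fs n q) \<le> E * A * exp (\<mu> * L) / 2 ^ n" if "q \<in> ball p 1" for n q
    proof -
      have q: "om q \<le> L" using om_ball[OF that] by (simp add: L_def)
      have "E * (A / 2 ^ n) * exp (\<mu> * om q) \<le> E * (A / 2 ^ n) * exp (\<mu> * L)"
        using q A by (intro mult_left_mono) auto
      moreover have "A / 2 ^ n * exp (\<mu> * om q) \<le> E * (A / 2 ^ n) * exp (\<mu> * om q)"
        using A by (intro mult_right_mono) (auto simp: mult_le_cancel_right1 divide_simps)
      ultimately show ?thesis using bd[OF q, of n] by (simp add: algebra_simps)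
    qed
    then show ?thesis using sB by blast
  qed
  define m where "m p = (\<Sum>n. f n p)" for p
  have m: "C1_plane m (\<lambda>p. \<Sum>n. fz n p) (\<lambda>p. \<Sum>n. fs n p)"
    unfolding m_def[abs_def] by (rule C1_plane_suminf[OF C1 loc])
  have cm: "continuous_on UNIV m" by (rule C1_planeD(1)[OF m])
  have cS: "continuous_on UNIV (\<lambda>p. \<Sum>k<n. f k p)" for n
    by (intro continuous_on_sum C1_planeD(1)[OF C1])
  \<comment> \<open>Linearity of \<open>pic\<close> turns the recursion of the iterates into one for
    the partial sums.\<close>
  have S: "(\<Sum>k<Suc n. f k p) = b p + pic (\<lambda>p. \<Sum>k<n. f k p) p" for n p
  proof (induction n)
    case 0
    then show ?case by (simp add: f0 pic_def char_int_def src_def vec_eq_iff)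
  next
    case (Suc n)
    have "f (Suc n) p = pic (\<lambda>p. (\<Sum>k<Suc n. f k p) - (\<Sum>k<n. f k p)) p"
      by (simp add: fS)
    also have "\<dots> = pic (\<lambda>p. \<Sum>k<Suc n. f k p) p - pic (\<lambda>p. \<Sum>k<n. f k p) p"
      by (rule pic_diff[OF cS cS])
    finally show ?case using Suc by (simp del: sum.lessThan_Suc add: sum.lessThan_Suc[of _ "Suc n"])
  qed
  have "m p = b p + pic m p" for p
  proof -
    obtain \<mu> E A where A: "A \<ge> 0" and G: "G (om p) \<mu> E" and
      bd: "\<And>n q. om q \<le> om p \<Longrightarrow> norm (f n q) \<le> A / 2 ^ n * exp (\<mu> * om q)"
      using bounds[of "om p"] by blast
    have G': "norm (pic h p) \<le> A' / 2 * exp (\<mu> * om p)"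
      if "A' \<ge> 0" "continuous_on UNIV h" "\<And>q. om q \<le> om p \<Longrightarrow> norm (h q) \<le> A' * exp (\<mu> * om q)" for A' h
      using G that unfolding G_def by blast
    have tail: "norm (m q - (\<Sum>k<n. f k q)) \<le> 2 * A / 2 ^ n * exp (\<mu> * om q)" if q: "om q \<le> om p" for n q
    proof -
      have s: "summable (\<lambda>k. A / 2 ^ k * exp (\<mu> * om q))"
        using summable_mult2[OF sB] by simp
      have "norm (f k q) \<le> A / 2 ^ k * exp (\<mu> * om q)" for k by (rule bd[OF q])
      then have sf: "summable (\<lambda>k. norm (f k q))" by (intro summable_comparison_test[OF _ s]) simp
      have "m q - (\<Sum>k<n. f k q) = (\<Sum>k. f (k + n) q)"
        unfolding m_def using suminf_minus_initial_segment[OF summable_norm_cancel[OF sf]] by simp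
      also have "norm \<dots> \<le> (\<Sum>k. A / 2 ^ (k + n) * exp (\<mu> * om q))"
        by (rule norm_suminf_le) (use bd[OF q] s summable_ignore_initial_segment[OF s, of n] in auto)
      also have "\<dots> = A / 2 ^ n * exp (\<mu> * om q) * (\<Sum>k. (1 / 2) ^ k)"
        by (subst suminf_mult[symmetric]) (auto simp: power_add power_divide field_simps)
      also have "\<dots> = 2 * A / 2 ^ n * exp (\<mu> * om q)"
        by (subst suminf_geometric) simp_all
      finally show ?thesis .
    qed
    \<comment> \<open>The defect of \<open>m\<close> is a tail of the series minus
      \<open>pic\<close> of the preceding tail, and both are of size 2^-n.\<close>
    have "norm (m p - (b p + pic m p)) \<le> 2 * A * exp (\<mu> * om p) * (1 / 2) ^ n" for n
    proof -
      have "norm (pic (\<lambda>q. m q - (\<Sum>k<n. f k q)) p) \<le> 2 * A / 2 ^ n / 2 * exp (\<mu> * om p)"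
      proof (rule G')
        show "continuous_on UNIV (\<lambda>q. m q - (\<Sum>k<n. f k q))" by (rule continuous_on_diff[OF cm cS])
      qed (use A tail in auto)
      then have 1: "norm (pic m p - pic (\<lambda>q. \<Sum>k<n. f k q) p) \<le> A / 2 ^ n * exp (\<mu> * om p)"
        by (simp add: pic_diff[OF cm cS])
      have 2: "norm (m p - (\<Sum>k<Suc n. f k p)) \<le> A / 2 ^ n * exp (\<mu> * om p)"
        using tail[of p "Suc n"] by simp
      have "m p - (b p + pic m p) = (m p - (\<Sum>k<Suc n. f k p)) - (pic m p - pic (\<lambda>q. \<Sum>k<n. f k q) p)"
        unfolding S by simp
      also have "norm \<dots> \<le> A / 2 ^ n * exp (\<mu> * om p) + A / 2 ^ n * exp (\<mu> * om p)"
        by (rule order_trans[OF norm_triangle_ineq4 add_mono[OF 2 1]])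
      finally show ?thesis by (simp add: power_divide)
    qed
    moreover have "(\<lambda>n. 2 * A * exp (\<mu> * om p) * (1 / 2) ^ n) \<longlonglongrightarrow> 2 * A * exp (\<mu> * om p) * 0"
      by (intro tendsto_intros LIMSEQ_realpow_zero) auto
    ultimately have "norm (m p - (b p + pic m p)) \<le> 0"
      by (intro LIMSEQ_le_const[where X="\<lambda>n. 2 * A * exp (\<mu> * om p) * (1 / 2) ^ n"]) auto
    then show ?thesis by simp
  qed
  with m that show thesis by blast
qed

end

text \<open>It is the derivative that is extended: \<open>\<beta>'\<close> is composed with a
  retraction \<open>r\<close> of the line onto \<open>S\<close> and then integrated. For x \<le> 0
  the retraction gives 0, so \<open>\<beta>' 0 = 0\<close> makes the result vanish there. Both
  shapes of \<open>S\<close> occur: the interval for \<open>\<beta>\<close>, the half-line for its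
  extensions.\<close>

lemma char_system_extend:
  assumes c: "0 < c" "c < 1" and S: "S = {0..} \<or> (\<exists>Z>0. S = {0..Z})"
    and \<beta>: "C1_deriv_on S \<beta> \<beta>'" "\<beta> 0 = 0" "\<beta>' 0 = 0"
  obtains b b' where "char_system c b b'" "\<And>z. z \<in> S \<Longrightarrow> b z = \<beta> z"
proof -
  obtain r where r: "continuous_on UNIV r" "\<And>x. r x \<in> S" "\<And>x. x \<in> S \<Longrightarrow> r x = x" "\<And>x. x \<le> 0 \<Longrightarrow> r x = 0"
  proof (cases "S = {0..}")
    case True
    then show thesis
      by (intro that[of "\<lambda>x. max 0 x"]) (auto intro!: continuous_intros)
  next
    case False
    then obtain Z where "Z > 0" "S = {0..Z}" using S by blast
    then show thesis
      by (intro that[of "\<lambda>x. max 0 (min Z x)"]) (auto intro!: continuous_intros)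
  qed
  have S': "convex S" "0 \<in> S" using S by auto
  have g: "continuous_on UNIV (\<lambda>x. \<beta>' (r x))"
    using \<beta>(1) r(1,2) unfolding C1_deriv_on_def
    by (auto intro: continuous_on_compose2[of S \<beta>'])
  then obtain b where b: "b 0 = 0" "\<And>x. (b has_real_derivative \<beta>' (r x)) (at x)"
    using ex_antiderivative[of "\<lambda>x. \<beta>' (r x)" 0] by blast
  have "b z - \<beta> z = b 0 - \<beta> 0" if "z \<in> S" for z
  proof (rule has_field_derivative_zero_constant[OF S'(1), of "\<lambda>z. b z - \<beta> z", THEN exE])
    fix x assume x: "x \<in> S"
    have "(b has_real_derivative \<beta>' x) (at x within S)"
      using b(2)[of x] r(3)[OF x] by (simp add: has_field_derivative_at_within)
    moreover have "(\<beta> has_real_derivative \<beta>' x) (at x within S)"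
      using \<beta>(1) x by (auto simp: C1_deriv_on_def)
    ultimately show "((\<lambda>z. b z - \<beta> z) has_real_derivative 0) (at x within S)"
      by (auto intro!: derivative_eq_intros)
  next
    fix k assume "\<forall>x\<in>S. b x - \<beta> x = k"
    then show ?thesis using that S'(2) by metis
  qed
  then have 1: "b z = \<beta> z" if "z \<in> S" for z using that b(1) \<beta>(2) by fastforce
  have "b x = 0" if "x \<le> 0" for x
  proof (rule has_field_derivative_zero_constant[of "{..0}" b, THEN exE])
    fix x :: real assume "x \<in> {..0}"
    then show "(b has_real_derivative 0) (at x within {..0})"
      using b(2)[of x] r(4)[of x] \<beta>(3) by (simp add: has_field_derivative_at_within)
  next
    fix k assume "\<forall>x\<in>{..0}. b x = k"
    then show ?thesis using that b(1) by (metis atMost_iff order_refl)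
  qed simp
  with c b g have "char_system c b (\<lambda>x. \<beta>' (r x))"
    by (simp add: char_system_def)
  with 1 that show thesis by blast
qed

section \<open>From the Picard fixpoint to the characteristic problem\<close>

context char_system begin

text \<open>If \<open>dir i\<close> is \<open>(- a, 1)\<close>, this wave is constant along the
  characteristics of the i-th component and takes the value \<open>k * \<beta> z\<close> on s =
  0.\<close>

lemma C1_plane_wave: "C1_plane (\<lambda>p. k * \<beta> (fst p + a * snd p)) (\<lambda>p. k * \<beta>' (fst p + a * snd p))
    (\<lambda>p. k * a * \<beta>' (fst p + a * snd p))"
proof -
  have "((\<lambda>p. k * \<beta> (fst p + a * snd p)) has_derivative
      (\<lambda>(h, j). h *\<^sub>R (k * \<beta>' (fst p + a * snd p)) + j *\<^sub>R (k * a * \<beta>' (fst p + a * snd p)))) (at p)" for p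
  proof -
    have "((\<lambda>p. fst p + a * snd p) has_derivative (\<lambda>v. fst v + a * snd v)) (at p)"
      by (auto intro!: derivative_eq_intros)
    from has_derivative_mult_right[OF has_derivative_compose[OF this \<beta>[unfolded has_field_derivative_def]], of k]
    show ?thesis by (rule has_derivative_eq_rhs) (auto simp: algebra_simps)
  qed
  then show ?thesis
    unfolding C1_plane_def
    by (auto intro!: continuous_intros continuous_on_compose2[OF \<beta>'])
qed

end

text \<open>The characteristic problem in the coordinates (z, s), posed on the whole plane. The last
  condition is restricted to s \<ge> 0 because from there the backward characteristic of the fourth
  component runs from z = 0 into z < 0, where the coefficient vanishes.\<close>

locale quadrant_solution = char_system +
  fixes m mz ms :: "real \<times> real \<Rightarrow> real^4"
  assumes m: "C1_plane m mz ms"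
    and pde: "\<And>p. ms p + matA c *v ms p = matA c *v mz p + \<beta> (fst p) *\<^sub>R (matB c *v m p)"
    and m1: "\<And>z. m (z, 0) $ 1 = 0" and m3: "\<And>z. m (z, 0) $ 3 = (c - 1) / (2 * (c + 1)) * \<beta> z"
    and m4: "\<And>z. m (z, 0) $ 4 = (c + 1) / (2 * (c - 1)) * \<beta> z"
    and m0: "\<And>s. m (0, s) $ 2 = 0" "\<And>s. s \<ge> 0 \<Longrightarrow> m (0, s) $ 4 = 0"
begin

lemma char_solution_of_quadrant:
  assumes eq: "\<And>z. z \<in> {0..Z} \<Longrightarrow> \<beta> z = b z"
  shows "char_solution c b Z (\<lambda>(z, t). m (z, t - z))"
proof -
  define q :: "real \<times> real \<Rightarrow> real \<times> real" where "q p = (fst p, snd p - fst p)" for p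
  have q: "continuous_on S q" for S unfolding q_def by (intro continuous_intros)
  have der: "((\<lambda>(z, t). m (z, t - z)) has_derivative
      (\<lambda>(h, k). h *\<^sub>R (mz (q p) - ms (q p)) + k *\<^sub>R ms (q p))) (at p within S)" for p S
  proof -
    have "(q has_derivative (\<lambda>v. (fst v, snd v - fst v))) (at p within S)"
      unfolding q_def by (auto intro!: derivative_eq_intros)
    from has_derivative_compose[OF this C1_planeD(4)[OF m, where S=UNIV]]
    show ?thesis
      by (auto simp: q_def case_prod_unfold algebra_simps elim!: has_derivative_eq_rhs)
  qed
  have "ms (q p) = matA c *v (mz (q p) - ms (q p)) + b (fst p) *\<^sub>R (matB c *v (\<lambda>(z, t). m (z, t - z)) p)"
    if "p \<in> char_region Z" for p
  proof -
    have "fst p \<in> {0..Z}" using that by (auto simp: char_region_def)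
    from eq[OF this] pde[of "q p"] show ?thesis
      by (simp add: q_def case_prod_unfold matrix_vector_mult_diff_distrib algebra_simps)
  qed
  then show ?thesis
    unfolding char_solution_def using der m1 m3 m4 m0 eq
    by (intro conjI exI[of _ "\<lambda>p. mz (q p) - ms (q p)"] exI[of _ "\<lambda>p. ms (q p)"])
      (auto intro!: continuous_intros continuous_on_compose2[OF C1_planeD(2)[OF m] q]
        continuous_on_compose2[OF C1_planeD(3)[OF m] q])
qed

end

lemma (in char_system) ex_quadrant_solution:
  obtains m mz ms where "quadrant_solution c \<beta> \<beta>' m mz ms"
proof -
  \<comment> \<open>\<open>k\<close> holds the data on s = 0, and for the third and fourth
    components \<open>a\<close> is minus the z-component of \<open>dir i\<close>, so that
    \<open>b\<close> carries the data unchanged along characteristics; \<open>pic\<close> adds the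
    effect of the source.\<close>
  define k :: "4 \<Rightarrow> real" where "k i = (if i = 3 then (c - 1) / (2 * (c + 1)) else
     if i = 4 then (c + 1) / (2 * (c - 1)) else 0)" for i
  define a :: "4 \<Rightarrow> real" where "a i = (if i = 3 then c / (1 + c) else - (c / (1 - c)))" for i
  define b :: "real \<times> real \<Rightarrow> real^4" where "b p = (\<chi> i. k i * \<beta> (fst p + a i * snd p))" for p
  define bz :: "real \<times> real \<Rightarrow> real^4" where "bz p = (\<chi> i. k i * \<beta>' (fst p + a i * snd p))" for p
  define bs :: "real \<times> real \<Rightarrow> real^4" where "bs p = (\<chi> i. k i * a i * \<beta>' (fst p + a i * snd p))" for p
  have b: "C1_plane b bz bs"
    unfolding C1_plane_componentwise b_def bz_def bs_def by (simp add: C1_plane_wave)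
  obtain m mz0 ms0 where m0: "C1_plane m mz0 ms0" and fx: "\<And>p. m p = b p + pic m p"
    using ex_pic_fixpoint[OF b] by blast
  define mz where "mz p = bz p + pic_z m mz0 p" for p
  define ms where "ms p = bs p + pic_s m ms0 p" for p
  have m: "C1_plane m mz ms"
    using C1_plane_add[OF b C1_plane_pic[OF m0]] fx[symmetric] by (simp add: mz_def[abs_def] ms_def[abs_def])
  \<comment> \<open>\<open>b\<close> is constant along \<open>dir i\<close>, and the derivative of
    \<open>pic m\<close> in that direction is \<open>src m i\<close>; multiplied out, this is the
    i-th equation.\<close>
  have tr: "fst (dir i) * mz p $ i + snd (dir i) * ms p $ i = src m i p" for i p
  proof -
    have "fst (dir i) * bz p $ i + snd (dir i) * bs p $ i = 0"
      using exhaust_4[of i] by (auto simp: bz_def bs_def dir_def k_def a_def)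
    moreover have "fst (dir i) * pic_z m mz0 p $ i + snd (dir i) * pic_s m ms0 p $ i = src m i p"
      using char_int_transport[OF C1_plane_src[OF m0] dir_covec] by (simp add: pic_z_def pic_s_def)
    ultimately show ?thesis by (simp add: mz_def ms_def algebra_simps)
  qed
  have base: "m p $ i = b p $ i" if "p \<bullet> covec i = 0" for p i
    using that fx[of p] by (simp add: pic_def char_int_def)
  show thesis
  proof (rule that, unfold_locales)
    show "C1_plane m mz ms" by fact
    show "ms p + matA c *v ms p = matA c *v mz p + \<beta> (fst p) *\<^sub>R (matB c *v m p)" for p
      unfolding vec_eq_iff forall_4 vector_add_component vector_scaleR_component matA_nth
      using tr[of 1 p] tr[of 2 p] tr[of 3 p] tr[of 4 p] c
      by (simp add: dir_def src_def wt_def field_simps)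
    show "m (z, 0) $ 1 = 0" for z
      using base[of "(z, 0)" 1] by (simp add: covec_def b_def k_def)
    show "m (z, 0) $ 3 = (c - 1) / (2 * (c + 1)) * \<beta> z" for z
      using base[of "(z, 0)" 3] by (simp add: covec_def b_def k_def)
    show "m (z, 0) $ 4 = (c + 1) / (2 * (c - 1)) * \<beta> z" for z
      using base[of "(z, 0)" 4] by (simp add: covec_def b_def k_def)
    show "m (0, s) $ 2 = 0" for s
      using base[of "(0, s)" 2] by (simp add: covec_def b_def k_def)
    \<comment> \<open>Going back from (0, s), the characteristic stays in z \<le> 0, so both the
      transported data and the source vanish.\<close>
    show "m (0, s) $ 4 = 0" if s: "s \<ge> 0" for s
    proof -
      have "src m 4 ((0, s) - (r * ((0, s) \<bullet> covec 4)) *\<^sub>R dir 4) = 0" if "r \<in> {0..1}" for r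
      proof -
        have "0 \<le> r * s * (c / (1 - c))" using that s c by (intro mult_nonneg_nonneg) auto
        then show ?thesis unfolding src_def by (subst \<beta>0) (auto simp: dir_def covec_def)
      qed
      then have "integral {0..1} (\<lambda>r. src m 4 ((0, s) - (r * ((0, s) \<bullet> covec 4)) *\<^sub>R dir 4)) = integral {0..1::real} (\<lambda>r. 0)"
        by (rule integral_cong)
      then have "pic m (0, s) $ 4 = 0"
        by (simp add: pic_def char_int_def)
      moreover have "0 \<le> c * s / (1 - c)" using c s by simp
      then have "b (0, s) $ 4 = 0"
        by (simp add: b_def a_def \<beta>0)
      ultimately show ?thesis using fx[of "(0, s)"] by simp
    qed
  qed
qed

section \<open>Uniqueness along characteristics\<close>

text \<open>The maximum of \<open>exp (-\<mu> t) |u|\<close> over \<open>R\<close> is bounded by half of itself, by integrating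
  each component along its characteristic.\<close>

lemma zero_by_characteristics:
  fixes u :: "real \<times> real \<Rightarrow> real^4"
  assumes R: "compact R" and u: "continuous_on R u" and b: "b \<ge> 0"
    and path: "\<And>z t i. (z, t) \<in> R \<Longrightarrow> \<exists>t0 v. t0 \<le> t \<and> (\<forall>\<tau>\<in>{t0..t}. (z + v * (\<tau> - t), \<tau>) \<in> R) \<and>
      u (z + v * (t0 - t), t0) $ i = 0 \<and>
      (\<forall>\<tau>\<in>{t0<..<t}. \<exists>d. ((\<lambda>\<tau>. u (z + v * (\<tau> - t), \<tau>) $ i) has_real_derivative d) (at \<tau>) \<and>
         \<bar>d\<bar> \<le> b * norm (u (z + v * (\<tau> - t), \<tau>)))"
    and p: "p \<in> R"
  shows "u p = 0"
proof -
  \<comment> \<open>Chosen to make \<open>4 * b / \<mu> \<le> 1 / 2\<close>; the 4 comes from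
    \<open>norm_le_4\<close>.\<close>
  define \<mu> where "\<mu> = 8 * b + 1"
  have \<mu>: "\<mu> > 0" using b by (simp add: \<mu>_def)
  have "continuous_on R (\<lambda>p. exp (- \<mu> * snd p) * norm (u p))"
    by (intro continuous_intros u)
  then obtain q where q: "q \<in> R" "\<And>p. p \<in> R \<Longrightarrow> exp (- \<mu> * snd p) * norm (u p) \<le> exp (- \<mu> * snd q) * norm (u q)"
    using continuous_attains_sup[OF R] p by blast
  define S where "S = exp (- \<mu> * snd q) * norm (u q)"
  have S0: "S \<ge> 0" by (simp add: S_def)
  have bd: "norm (u p) \<le> S * exp (\<mu> * snd p)" if "p \<in> R" for p
    using q(2)[OF that] by (simp add: S_def exp_minus field_simps)
  obtain z t where zt: "q = (z, t)" by (cases q)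
  have comp: "\<bar>u q $ i\<bar> \<le> b * S * exp (\<mu> * t) / \<mu>" for i
  proof -
    obtain t0 v where *: "t0 \<le> t \<and> (\<forall>\<tau>\<in>{t0..t}. (z + v * (\<tau> - t), \<tau>) \<in> R) \<and>
      u (z + v * (t0 - t), t0) $ i = 0 \<and>
      (\<forall>\<tau>\<in>{t0<..<t}. \<exists>d. ((\<lambda>\<tau>. u (z + v * (\<tau> - t), \<tau>) $ i) has_real_derivative d) (at \<tau>) \<and>
         \<bar>d\<bar> \<le> b * norm (u (z + v * (\<tau> - t), \<tau>)))"
      using path[OF q(1)[unfolded zt], of i] by (elim exE)
    have t0: "t0 \<le> t" and inR: "\<And>\<tau>. \<tau> \<in> {t0..t} \<Longrightarrow> (z + v * (\<tau> - t), \<tau>) \<in> R"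
      and start: "u (z + v * (t0 - t), t0) $ i = 0"
      using * by simp_all
    have der: "\<exists>d. ((\<lambda>\<tau>. u (z + v * (\<tau> - t), \<tau>) $ i) has_real_derivative d) (at \<tau>) \<and>
         \<bar>d\<bar> \<le> b * norm (u (z + v * (\<tau> - t), \<tau>))" if "\<tau> \<in> {t0<..<t}" for \<tau>
      using *[THEN conjunct2, THEN conjunct2, THEN conjunct2, THEN bspec, OF that] .
    define f where "f \<tau> = u (z + v * (\<tau> - t), \<tau>) $ i" for \<tau>
    define \<phi> where "\<phi> \<tau> = b * S * exp (\<mu> * \<tau>) / \<mu>" for \<tau>
    define d where "d = deriv f"
    have d: "(f has_real_derivative d \<tau>) (at \<tau>) \<and>
         \<bar>d \<tau>\<bar> \<le> b * norm (u (z + v * (\<tau> - t), \<tau>))" if \<tau>: "\<tau> \<in> {t0<..<t}" for \<tau>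
    proof -
      obtain d' where d': "(f has_real_derivative d') (at \<tau>)" "\<bar>d'\<bar> \<le> b * norm (u (z + v * (\<tau> - t), \<tau>))"
        using der[OF \<tau>] unfolding f_def by (elim exE conjE)
      then show ?thesis by (simp add: d_def DERIV_imp_deriv)
    qed
    have cf: "continuous_on {t0..t} f"
      unfolding f_def
      by (intro continuous_on_component continuous_on_compose2[OF u] continuous_intros) (use inR in auto)
    have "\<bar>f t - f t0\<bar> \<le> \<phi> t - \<phi> t0"
    proof (cases "t0 = t")
      case False
      have "norm (f t - f t0) \<le> \<phi> t - \<phi> t0"
      proof (rule differentiable_bound_general[where f' = d and \<phi>' = "\<lambda>\<tau>. b * S * exp (\<mu> * \<tau>)"])
        show "t0 < t" using False t0 by simp
        show "continuous_on {t0..t} \<phi>" unfolding \<phi>_def using \<mu> by (intro continuous_intros) auto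
        fix \<tau> assume \<tau>: "t0 < \<tau>" "\<tau> < t"
        then show "(f has_vector_derivative d \<tau>) (at \<tau>)"
          using d[of \<tau>] by (simp add: has_real_derivative_iff_has_vector_derivative)
        have "(\<phi> has_real_derivative b * S * exp (\<mu> * \<tau>)) (at \<tau>)"
          unfolding \<phi>_def using \<mu> by (auto intro!: derivative_eq_intros)
        then show "(\<phi> has_vector_derivative b * S * exp (\<mu> * \<tau>)) (at \<tau>)"
          by (simp add: has_real_derivative_iff_has_vector_derivative)
        have "\<bar>d \<tau>\<bar> \<le> b * norm (u (z + v * (\<tau> - t), \<tau>))" using d \<tau> by auto
        also have "\<dots> \<le> b * (S * exp (\<mu> * \<tau>))"
          using bd[OF inR[of \<tau>]] \<tau> b by (intro mult_left_mono) auto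
        finally show "norm (d \<tau>) \<le> b * S * exp (\<mu> * \<tau>)" by simp
      qed (rule cf)
      then show ?thesis by simp
    qed simp
    moreover have "\<phi> t0 \<ge> 0" using b S0 \<mu> by (simp add: \<phi>_def)
    moreover have "f t0 = 0" "f t = u q $ i" using start by (simp_all add: f_def zt)
    ultimately show ?thesis by (simp add: \<phi>_def)
  qed
  have "norm (u q) \<le> 4 * (b * S * exp (\<mu> * t) / \<mu>)"
    by (rule norm_le_4) (rule comp)
  then have "S \<le> exp (- \<mu> * t) * (4 * (b * S * exp (\<mu> * t) / \<mu>))"
    unfolding S_def zt snd_conv by (rule mult_left_mono) simp
  also have "\<dots> = (4 * b / \<mu>) * S" by (simp add: exp_minus)
  also have "\<dots> \<le> 1 / 2 * S"
    using S0 b by (intro mult_right_mono) (auto simp: \<mu>_def divide_simps)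
  finally have "S = 0" using S0 by simp
  then show ?thesis using bd[OF p] by simp
qed

text \<open>Solutions are differentiable only within a closed region, and characteristics may run
  along its boundary. Restriction to the image of an open time interval under the path still gives a
  full derivative in time.\<close>

lemma has_real_derivative_along_path:
  fixes u :: "real \<times> real \<Rightarrow> real^'n"
  assumes u: "(u has_derivative (\<lambda>(h, k). h *\<^sub>R uz + k *\<^sub>R ut)) (at (z + v * (\<tau> - t), \<tau>) within R)"
    and R: "\<And>\<sigma>. \<sigma> \<in> {t0<..<t} \<Longrightarrow> (z + v * (\<sigma> - t), \<sigma>) \<in> R" and \<tau>: "\<tau> \<in> {t0<..<t}"
  shows "((\<lambda>\<tau>. u (z + v * (\<tau> - t), \<tau>) $ i) has_real_derivative v * uz $ i + ut $ i) (at \<tau>)"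
proof -
  let ?g = "\<lambda>\<tau>. (z + v * (\<tau> - t), \<tau>)"
  have "(?g has_derivative (\<lambda>h. (v * h, h))) (at \<tau> within {t0<..<t})"
    by (auto intro!: derivative_eq_intros)
  moreover have "(u has_derivative (\<lambda>(h, k). h *\<^sub>R uz + k *\<^sub>R ut)) (at (?g \<tau>) within ?g ` {t0<..<t})"
    by (rule has_derivative_subset[OF u]) (use R in auto)
  ultimately have "((\<lambda>\<tau>. u (?g \<tau>)) has_derivative (\<lambda>h. (v * h) *\<^sub>R uz + h *\<^sub>R ut)) (at \<tau> within {t0<..<t})"
    using has_derivative_in_compose[of ?g _ \<tau> "{t0<..<t}" u] by fastforce
  from bounded_linear.has_derivative[OF bounded_linear_vec_nth[of i] this]
  have "((\<lambda>\<tau>. u (?g \<tau>) $ i) has_derivative (\<lambda>h. ((v * h) *\<^sub>R uz + h *\<^sub>R ut) $ i)) (at \<tau>)"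
    using \<tau> at_within_open[OF \<tau> open_greaterThanLessThan] by simp
  moreover have "(\<lambda>h. ((v * h) *\<^sub>R uz + h *\<^sub>R ut) $ i) = (*) (v * uz $ i + ut $ i)"
    by (auto simp: fun_eq_iff algebra_simps)
  ultimately show ?thesis
    unfolding has_field_derivative_def by simp
qed

text \<open>The diagonal of A; in the (z, t) plane the characteristics of the i-th equation have
  velocity \<open>- spd c i\<close>.\<close>

definition spd :: "real \<Rightarrow> 4 \<Rightarrow> real" where
  "spd c i = (if i = 1 then 1 else if i = 2 then - 1 else if i = 3 then c else - c)"

lemma matA_spd: "(matA c *v x) $ i = spd c i * x $ i"
  using exhaust_4[of i] by (auto simp: spd_def matA_nth)

lemma matB_bound:
  obtains K where "K \<ge> 0" "\<And>x i. \<bar>(matB c *v x) $ i\<bar> \<le> K * norm x"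
proof -
  obtain K where K: "K > 0" "\<And>x. norm (matB c *v x) \<le> norm x * K"
    using bounded_linear.pos_bounded[OF matrix_vector_mul_bounded_linear[of "matB c"]] by blast
  have "\<bar>(matB c *v x) $ i\<bar> \<le> K * norm x" for x i
    using order_trans[OF component_le_norm_cart K(2)] by (simp add: mult.commute)
  with K that show thesis by (meson less_imp_le)
qed

section \<open>Uniqueness for the characteristic problem\<close>

lemma compact_char_region: "compact (char_region Z)"
proof -
  have "closed (char_region Z)"
    unfolding char_region_def case_prod_unfold
    by (intro closed_Collect_conj closed_Collect_le continuous_intros)
  moreover have "char_region Z \<subseteq> cbox (0, 0) (Z, 2 * Z)"
    by (auto simp: char_region_def cbox_Pair_eq)
  ultimately show ?thesis
    by (meson bounded_cbox bounded_subset compact_eq_bounded_closed)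
qed

text \<open>Traced back in time, components 1 and 3 move right until they hit the diagonal, and
  component 2 moves left, parallel to it, to z = 0. Component 4 moves left more slowly than the
  diagonal recedes, so it ends on the diagonal or on z = 0 according to the sign of z - c t. Speeds
  of at most 1 keep the path below the upper edge t = 2Z - z.\<close>

lemma char_characteristic:
  assumes c: "0 < c" "c < 1" and zt: "(z, t) \<in> char_region Z"
  obtains t0 where "t0 \<le> t" "\<And>\<tau>. \<tau> \<in> {t0..t} \<Longrightarrow> (z - spd c i * (\<tau> - t), \<tau>) \<in> char_region Z"
    "(i = 2 \<or> i = 4) \<and> z - spd c i * (t0 - t) = 0 \<and> t0 \<in> {0..2 * Z} \<or>
     (i = 1 \<or> i = 3 \<or> i = 4) \<and> z - spd c i * (t0 - t) = t0 \<and> t0 \<in> {0..Z}"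
proof -
  have h: "0 \<le> z" "z \<le> t" "t + z \<le> 2 * Z" using zt by (auto simp: char_region_def)
  consider "i = 1" | "i = 2" | "i = 3" | "i = 4" "z - c * t \<ge> 0" | "i = 4" "z - c * t < 0"
    using exhaust_4[of i] by linarith
  then show thesis
  proof cases
    case 1
    show thesis
      by (rule that[of "(z + t) / 2"]) (use 1 h in \<open>auto simp: spd_def char_region_def field_simps\<close>)
  next
    case 2
    show thesis
      by (rule that[of "t - z"]) (use 2 h in \<open>auto simp: spd_def char_region_def field_simps\<close>)
  next
    case 3
    \<comment> \<open>The time \<tau> at which z + c (t - \<tau>) = \<tau>, that is, when the
      diagonal is reached.\<close>
    define t0 where "t0 = (z + c * t) / (1 + c)"
    have t0: "t0 * (1 + c) = z + c * t" using c by (simp add: t0_def)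
    have ct: "c * (t - \<tau>) \<le> t - \<tau>" "0 \<le> c * (t - \<tau>)" if "\<tau> \<le> t" for \<tau>
      using c that mult_right_mono[of c 1 "t - \<tau>"] by auto
    have "t0 * (1 + c) \<le> t * (1 + c)" unfolding t0 using h by (simp add: algebra_simps)
    then have le: "t0 \<le> t" using c by simp
    have ge: "0 \<le> t0" unfolding t0_def using c h by (intro divide_nonneg_nonneg add_nonneg_nonneg mult_nonneg_nonneg) auto
    have d: "z + c * (t - t0) = t0" using t0 by (simp add: algebra_simps)
    have in_reg: "(z + c * (t - \<tau>), \<tau>) \<in> char_region Z" if "\<tau> \<in> {t0..t}" for \<tau>
    proof -
      have "c * (t - \<tau>) \<le> c * (t - t0)" using that c by (intro mult_left_mono) auto
      then have "z + c * (t - \<tau>) \<le> \<tau>" using d that by simp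
      then show ?thesis using ct[of \<tau>] that h by (auto simp: char_region_def)
    qed
    show thesis
      by (rule that[of t0]) (use 3 h le ge d in_reg in_reg[of t0] in \<open>auto simp: spd_def char_region_def algebra_simps\<close>)
  next
    case 4
    define t0 where "t0 = (z - c * t) / (1 - c)"
    have t0: "t0 * (1 - c) = z - c * t" using c by (simp add: t0_def)
    have "t0 * (1 - c) \<le> t * (1 - c)" unfolding t0 using h by (simp add: algebra_simps)
    then have le: "t0 \<le> t" using c by simp
    have ge: "0 \<le> t0" unfolding t0_def using c 4 by simp
    have d: "z - c * (t - t0) = t0" using t0 by (simp add: algebra_simps)
    have in_reg: "(z - c * (t - \<tau>), \<tau>) \<in> char_region Z" if "\<tau> \<in> {t0..t}" for \<tau>
    proof -
      have "c * (t - \<tau>) \<le> c * (t - t0)" using that c by (intro mult_left_mono) auto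
      then have "0 \<le> z - c * (t - \<tau>)" using d ge by simp
      moreover have "c * (\<tau> - t0) \<le> \<tau> - t0" using that c mult_right_mono[of c 1 "\<tau> - t0"] by auto
      then have "z - c * (t - \<tau>) \<le> \<tau>" using d by (simp add: algebra_simps)
      moreover have "0 \<le> c * (t - \<tau>)" using c that by simp
      ultimately show ?thesis using that h by (auto simp: char_region_def)
    qed
    show thesis
      by (rule that[of t0]) (use 4 h le ge d in_reg in_reg[of t0] in \<open>auto simp: spd_def char_region_def algebra_simps\<close>)
  next
    case 5
    \<comment> \<open>The time at which z = 0 is reached; it is not negative because z < c t in this
      case.\<close>
    define t0 where "t0 = t - z / c"
    have t0: "c * (t - t0) = z" using c by (simp add: t0_def)
    have le: "t0 \<le> t" "0 \<le> t0" using c h 5 by (auto simp: t0_def field_simps)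
    have in_reg: "(z - c * (t - \<tau>), \<tau>) \<in> char_region Z" if "\<tau> \<in> {t0..t}" for \<tau>
    proof -
      have "c * (t - \<tau>) \<le> c * (t - t0)" using that c by (intro mult_left_mono) auto
      then have "0 \<le> z - c * (t - \<tau>)" using t0 by simp
      moreover have "c * (\<tau> - t0) \<le> \<tau> - t0" using that c mult_right_mono[of c 1 "\<tau> - t0"] by auto
      then have "z - c * (t - \<tau>) \<le> \<tau>" using t0 le(2) by (simp add: algebra_simps)
      moreover have "0 \<le> c * (t - \<tau>)" using c that by simp
      ultimately show ?thesis using that h by (auto simp: char_region_def)
    qed
    show thesis
      by (rule that[of t0]) (use 5 h le t0 in_reg in \<open>auto simp: spd_def char_region_def algebra_simps\<close>)
  qed
qed

text \<open>The difference u of two solutions vanishes, component by component, where the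
  characteristics end. Along them its i-th component has derivative \<beta> (B u)_i, because the
  A-terms cancel against the velocity, and this is bounded by a multiple of the norm of u.\<close>

lemma char_solution_unique:
  assumes c: "0 < c" "c < 1" and \<beta>: "continuous_on {0..Z} \<beta>"
    and m: "char_solution c \<beta> Z m" and n: "char_solution c \<beta> Z n" and p: "p \<in> char_region Z"
  shows "n p = m p"
proof -
  let ?R = "char_region Z"
  obtain mz mt where m': "\<And>p. p \<in> ?R \<Longrightarrow>
      (m has_derivative (\<lambda>(h, k). h *\<^sub>R mz p + k *\<^sub>R mt p)) (at p within ?R)"
      "\<And>p. p \<in> ?R \<Longrightarrow> mt p = matA c *v mz p + \<beta> (fst p) *\<^sub>R (matB c *v m p)"
    using m unfolding char_solution_def by blast
  obtain nz nt where n': "\<And>p. p \<in> ?R \<Longrightarrow>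
      (n has_derivative (\<lambda>(h, k). h *\<^sub>R nz p + k *\<^sub>R nt p)) (at p within ?R)"
      "\<And>p. p \<in> ?R \<Longrightarrow> nt p = matA c *v nz p + \<beta> (fst p) *\<^sub>R (matB c *v n p)"
    using n unfolding char_solution_def by blast
  have bc: "m (0, t) $ 2 = n (0, t) $ 2" "m (0, t) $ 4 = n (0, t) $ 4" if "t \<in> {0..2 * Z}" for t
    using m n that unfolding char_solution_def by auto
  have dc: "m (z, z) $ 1 = n (z, z) $ 1" "m (z, z) $ 3 = n (z, z) $ 3" "m (z, z) $ 4 = n (z, z) $ 4" if "z \<in> {0..Z}" for z
    using m n that unfolding char_solution_def by auto
  define u where "u p = n p - m p" for p
  have u: "(u has_derivative (\<lambda>(h, k). h *\<^sub>R (nz p - mz p) + k *\<^sub>R (nt p - mt p))) (at p within ?R)"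
    if "p \<in> ?R" for p
    unfolding u_def
    by (rule has_derivative_eq_rhs[OF has_derivative_diff[OF n'(1)[OF that] m'(1)[OF that]]])
      (auto simp: algebra_simps)
  obtain K where K: "K \<ge> 0" "\<And>x i. \<bar>(matB c *v x) $ i\<bar> \<le> K * norm x" using matB_bound[of c] by blast
  have "bounded (\<beta> ` {0..Z})"
    by (intro compact_imp_bounded compact_continuous_image \<beta>) auto
  then obtain b where b: "\<And>z. z \<in> {0..Z} \<Longrightarrow> \<bar>\<beta> z\<bar> \<le> b" unfolding bounded_iff by force
  have b0: "b \<ge> 0" using b[of 0] p by (force simp: char_region_def)
  have "u p = 0"
  proof (rule zero_by_characteristics[OF compact_char_region _ _ _ p, of u "b * K"])
    show "continuous_on ?R u"
      using u has_derivative_continuous continuous_on_eq_continuous_within by blast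
    show "b * K \<ge> 0" using b0 K by simp
    fix z t i assume zt: "(z, t) \<in> ?R"
    obtain t0 where t0: "t0 \<le> t" "\<And>\<tau>. \<tau> \<in> {t0..t} \<Longrightarrow> (z - spd c i * (\<tau> - t), \<tau>) \<in> ?R"
      and s: "(i = 2 \<or> i = 4) \<and> z - spd c i * (t0 - t) = 0 \<and> t0 \<in> {0..2 * Z} \<or>
       (i = 1 \<or> i = 3 \<or> i = 4) \<and> z - spd c i * (t0 - t) = t0 \<and> t0 \<in> {0..Z}"
      by (rule char_characteristic[OF c zt, of i], rule that)
    have "u (z - spd c i * (t0 - t), t0) $ i = 0"
      using s bc[of t0] dc[of t0] by (auto simp: u_def)
    moreover have "\<exists>d. ((\<lambda>\<tau>. u (z + (- spd c i) * (\<tau> - t), \<tau>) $ i) has_real_derivative d) (at \<tau>) \<and>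
         \<bar>d\<bar> \<le> b * K * norm (u (z + (- spd c i) * (\<tau> - t), \<tau>))" if \<tau>: "\<tau> \<in> {t0<..<t}" for \<tau>
    proof (intro exI conjI)
      define q where "q = (z + (- spd c i) * (\<tau> - t), \<tau>)"
      have q: "q \<in> ?R" using t0(2)[of \<tau>] \<tau> by (auto simp: q_def)
      have "fst q \<in> {0..Z}" using q by (auto simp: char_region_def)
      note bq = b[OF this]
      show "((\<lambda>\<tau>. u (z + (- spd c i) * (\<tau> - t), \<tau>) $ i) has_real_derivative
          - spd c i * (nz q - mz q) $ i + (nt q - mt q) $ i) (at \<tau>)"
        by (rule has_real_derivative_along_path[OF _ _ \<tau>, of u "nz q - mz q" "nt q - mt q" _ _ ?R])
          (use t0(2) u[OF q] in \<open>auto simp: q_def\<close>)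
      have "- spd c i * (nz q - mz q) $ i + (nt q - mt q) $ i = \<beta> (fst q) * (matB c *v u q) $ i"
        using m'(2)[OF q] n'(2)[OF q]
        by (simp add: matA_spd u_def matrix_vector_mult_diff_distrib algebra_simps)
      also have "\<bar>\<dots>\<bar> \<le> b * (K * norm (u q))"
        unfolding abs_mult by (intro mult_mono bq K b0) auto
      finally show "\<bar>- spd c i * (nz q - mz q) $ i + (nt q - mt q) $ i\<bar>
          \<le> b * K * norm (u (z + (- spd c i) * (\<tau> - t), \<tau>))" by (simp add: q_def)
    qed
    ultimately show "\<exists>t0 v. t0 \<le> t \<and> (\<forall>\<tau>\<in>{t0..t}. (z + v * (\<tau> - t), \<tau>) \<in> ?R) \<and>
      u (z + v * (t0 - t), t0) $ i = 0 \<and>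
      (\<forall>\<tau>\<in>{t0<..<t}. \<exists>d. ((\<lambda>\<tau>. u (z + v * (\<tau> - t), \<tau>) $ i) has_real_derivative d) (at \<tau>) \<and>
         \<bar>d\<bar> \<le> b * K * norm (u (z + v * (\<tau> - t), \<tau>)))"
      using t0 by (intro exI[of _ t0] exI[of _ "- spd c i"]) auto
  qed
  then show ?thesis by (simp add: u_def)
qed

section \<open>The distributional solution\<close>

lemma Basis_plane: "(Basis :: (real \<times> real) set) = {(1, 0), (0, 1)}"
  by (auto simp: Basis_prod_def)

lemma smooth_C1_plane:
  assumes "smooth \<psi>"
  shows "C1_plane \<psi> (partial (1, 0) \<psi>) (partial (0, 1) \<psi>)"
proof -
  have "(\<psi> has_derivative (\<lambda>(h, k). h *\<^sub>R partial (1, 0) \<psi> p + k *\<^sub>R partial (0, 1) \<psi> p)) (at p)" for p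
  proof -
    have D: "(\<psi> has_derivative (\<lambda>v. partial v \<psi> p)) (at p)" by (rule smooth_has_derivative[OF assms])
    then interpret bounded_linear "\<lambda>v. partial v \<psi> p" by (rule has_derivative_bounded_linear)
    have "partial v \<psi> p = fst v *\<^sub>R partial (1, 0) \<psi> p + snd v *\<^sub>R partial (0, 1) \<psi> p" for v
    proof -
      have "v = fst v *\<^sub>R (1, 0) + snd v *\<^sub>R (0, 1)" by (cases v) simp
      then have "partial v \<psi> p = partial (fst v *\<^sub>R (1, 0) + snd v *\<^sub>R (0, 1)) \<psi> p" by simp
      then show ?thesis by (simp only: add scaleR)
    qed
    then have "(\<lambda>v. partial v \<psi> p) = (\<lambda>(h, k). h *\<^sub>R partial (1, 0) \<psi> p + k *\<^sub>R partial (0, 1) \<psi> p)"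
      unfolding case_prod_unfold by (rule ext)
    with D show ?thesis by (simp only:)
  qed
  moreover have "continuous_on UNIV (partial (1, 0) \<psi>)" "continuous_on UNIV (partial (0, 1) \<psi>)"
    by (intro smooth_continuous smooth_partial assms; simp add: Basis_plane)+
  ultimately show ?thesis by (simp add: C1_plane_def)
qed

lemma C1_plane_shear:
  assumes "C1_plane f fx fy"
  shows "C1_plane (\<lambda>p. f (fst p, fst p + snd p)) (\<lambda>p. fx (fst p, fst p + snd p) + fy (fst p, fst p + snd p))
     (\<lambda>p. fy (fst p, fst p + snd p))"
proof -
  have "((\<lambda>p. f (fst p, fst p + snd p)) has_derivative
     (\<lambda>(h, k). h *\<^sub>R (fx (fst p, fst p + snd p) + fy (fst p, fst p + snd p)) + k *\<^sub>R fy (fst p, fst p + snd p))) (at p)" for p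
  proof -
    have "((\<lambda>p. (fst p, fst p + snd p)) has_derivative (\<lambda>v. (fst v, fst v + snd v))) (at p)"
      by (auto intro!: derivative_eq_intros)
    from has_derivative_compose[OF this C1_planeD(4)[OF assms, where S = UNIV]]
    show ?thesis
      by (rule has_derivative_eq_rhs) (auto simp: case_prod_unfold scaleR_add_right scaleR_add_left)
  qed
  moreover have "continuous_on UNIV (\<lambda>p. fx (fst p, fst p + snd p))" "continuous_on UNIV (\<lambda>p. fy (fst p, fst p + snd p))"
    by (rule continuous_on_compose2[OF C1_planeD(2)[OF assms]], auto intro!: continuous_intros)
      (rule continuous_on_compose2[OF C1_planeD(3)[OF assms]], auto intro!: continuous_intros)
  ultimately show ?thesis by (simp add: C1_plane_def continuous_on_add)
qed

lemma C1_plane_scaleR: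
  fixes f :: "real \<times> real \<Rightarrow> real" and g :: "real \<times> real \<Rightarrow> 'b::real_normed_vector"
  assumes f: "C1_plane f fx fy" and g: "C1_plane g gx gy"
  shows "C1_plane (\<lambda>p. f p *\<^sub>R g p) (\<lambda>p. fx p *\<^sub>R g p + f p *\<^sub>R gx p) (\<lambda>p. fy p *\<^sub>R g p + f p *\<^sub>R gy p)"
proof -
  have "((\<lambda>p. f p *\<^sub>R g p) has_derivative
     (\<lambda>(h, k). h *\<^sub>R (fx p *\<^sub>R g p + f p *\<^sub>R gx p) + k *\<^sub>R (fy p *\<^sub>R g p + f p *\<^sub>R gy p))) (at p)" for p
    by (rule has_derivative_eq_rhs[OF has_derivative_scaleR[OF C1_planeD(4)[OF f] C1_planeD(4)[OF g]]])
      (auto simp: case_prod_unfold algebra_simps)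
  then show ?thesis
    using C1_planeD[OF f] C1_planeD[OF g] unfolding C1_plane_def by (intro conjI allI continuous_intros)
qed

text \<open>In the coordinates (z, s) a test function vanishes on all sides of a large square except
  possibly s = 0, so the square can stand for the quadrant in integrations by parts.\<close>

abbreviation square_integral :: "real \<Rightarrow> (real \<times> real \<Rightarrow> 'b::euclidean_space) \<Rightarrow> 'b" where
  "square_integral R f \<equiv> integral (cbox (0, 0) (R, R)) f"

lemma square_integral_x:
  fixes f :: "real \<times> real \<Rightarrow> 'b::euclidean_space"
  assumes f: "C1_plane f fx fy" and R: "R \<ge> 0"
  shows "square_integral R fx = integral {0..R} (\<lambda>y. f (R, y) - f (0, y))"
proof -
  have c: "continuous_on (cbox (0, 0) (R, R)) (\<lambda>(x, y). fx (x, y))"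
    using C1_planeD(2)[OF f] continuous_on_subset by (auto simp: case_prod_unfold)
  have "square_integral R fx = integral (cbox 0 R) (\<lambda>x. integral (cbox 0 R) (\<lambda>y. fx (x, y)))"
    using integral_prod_continuous[OF c] by (simp add: case_prod_unfold)
  also have "\<dots> = integral (cbox 0 R) (\<lambda>y. integral (cbox 0 R) (\<lambda>x. fx (x, y)))"
    by (rule integral_swap_continuous) (use c in simp)
  finally have eq: "square_integral R fx = integral (cbox 0 R) (\<lambda>y. integral (cbox 0 R) (\<lambda>x. fx (x, y)))" .
  have "integral (cbox 0 R) (\<lambda>x. fx (x, y)) = f (R, y) - f (0, y)" for y
  proof (rule integral_unique, unfold cbox_interval, rule fundamental_theorem_of_calculus[OF R])
    fix x show "((\<lambda>x. f (x, y)) has_vector_derivative fx (x, y)) (at x within {0..R})"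
      using C1_plane_line[OF f, of "(0, y)" "(1, 0)" x "{0..R}"] by simp
  qed
  with eq show ?thesis by simp
qed

lemma square_integral_y:
  fixes f :: "real \<times> real \<Rightarrow> 'b::euclidean_space"
  assumes f: "C1_plane f fx fy" and R: "R \<ge> 0"
  shows "square_integral R fy = integral {0..R} (\<lambda>x. f (x, R) - f (x, 0))"
proof -
  have c: "continuous_on (cbox (0, 0) (R, R)) (\<lambda>(x, y). fy (x, y))"
    using C1_planeD(3)[OF f] continuous_on_subset by (auto simp: case_prod_unfold)
  have "square_integral R fy = integral (cbox 0 R) (\<lambda>x. integral (cbox 0 R) (\<lambda>y. fy (x, y)))"
    using integral_prod_continuous[OF c] by (simp add: case_prod_unfold)
  moreover have "integral (cbox 0 R) (\<lambda>y. fy (x, y)) = f (x, R) - f (x, 0)" for x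
  proof (rule integral_unique, unfold cbox_interval, rule fundamental_theorem_of_calculus[OF R])
    fix y show "((\<lambda>y. f (x, y)) has_vector_derivative fy (x, y)) (at y within {0..R})"
      using C1_plane_line[OF f, of "(x, 0)" "(0, 1)" y "{0..R}"] by simp
  qed
  ultimately show ?thesis by simp
qed

lemma test_function_quadrant_bounds:
  assumes "\<psi> \<in> test_functions ({0<..} \<times> UNIV :: (real \<times> real) set)"
  obtains R where "R > 0" "\<And>z t. z \<le> 0 \<or> z \<ge> R \<or> t \<ge> R \<Longrightarrow> (z, t) \<notin> supp \<psi>"
proof -
  obtain r where r: "r > 0" "\<And>p. p \<in> supp \<psi> \<Longrightarrow> norm p \<le> r"
    using compact_imp_bounded[OF test_functionsD(2)[OF assms]] unfolding bounded_pos by blast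
  show thesis
  proof (rule that[of "r + 1"])
    fix z t assume h: "z \<le> 0 \<or> z \<ge> r + 1 \<or> t \<ge> r + 1"
    show "(z, t) \<notin> supp \<psi>"
    proof
      assume p: "(z, t) \<in> supp \<psi>"
      then have "z > 0" using test_functionsD(3)[OF assms] by auto
      moreover have "\<bar>z\<bar> \<le> r" "\<bar>t\<bar> \<le> r"
        using r(2)[OF p] norm_fst_le[of z t] norm_snd_le[of t z] by simp_all
      ultimately show False using h by linarith
    qed
  qed (use r in simp)
qed

context quadrant_solution
begin

abbreviation e2 :: "real^4" where "e2 \<equiv> vector [0, 1, 0, 0]"

lemma e2_nth: "e2 $ 1 = 0" "e2 $ 2 = 1" "e2 $ 3 = 0" "e2 $ 4 = 0"
  by (simp_all add: vector_def)

text \<open>The pairing of \<delta>(t - z) [0,1,0,0] + m H(t - z) with \<open>\<phi>\<close> after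
  the substitution t = z + s, which moves the jump to the fixed end 0 of the integral.\<close>

definition sol :: "real \<Rightarrow> (real \<Rightarrow> real) \<Rightarrow> real^4" where
  "sol z \<phi> = dirac z \<phi> *\<^sub>R e2 + integral {0..} (\<lambda>s. \<phi> (z + s) *\<^sub>R m (z, s))"

lemma sol_cut:
  assumes "\<And>x. x > R \<Longrightarrow> \<phi> x = 0" "0 \<le> z"
  shows "sol z \<phi> = \<phi> z *\<^sub>R e2 + integral {0..R} (\<lambda>s. \<phi> (z + s) *\<^sub>R m (z, s))"
proof -
  have "integral {0..} (\<lambda>s. \<phi> (z + s) *\<^sub>R m (z, s)) = integral {0..R} (\<lambda>s. \<phi> (z + s) *\<^sub>R m (z, s))"
    by (rule integral_restrict_support) (use assms in auto)
  then show ?thesis by (simp add: sol_def dirac_def)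
qed

lemma sol_scaleR: "a *\<^sub>R sol z \<phi> = sol z (\<lambda>x. a * \<phi> x)"
  by (simp only: sol_def dirac_def scaleR_add_right scaleR_scaleR[symmetric] integral_cmul)

lemma continuous_m: "continuous_on S m"
  using C1_planeD(1)[OF m] continuous_on_subset by blast

lemma sol_integrable:
  assumes "continuous_on UNIV \<phi>"
  shows "(\<lambda>s. \<phi> (z + s) *\<^sub>R m (z, s)) integrable_on {0..R}"
  by (intro integrable_continuous_interval continuous_intros continuous_on_compose2[OF assms]
      continuous_on_compose2[OF continuous_m[of UNIV]]) auto

text \<open>The point mass and the locally bounded density both have order 0: on a compact set only
  the supremum of the test function enters, so \<open>N\<close> is taken to be 0.\<close>

lemma distribution_sol:
  assumes z: "z \<ge> 0"
  shows "distribution_on UNIV (sol z)"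
  unfolding distribution_on_def
proof (intro conjI ballI allI impI)
  fix \<phi> \<psi> :: "real \<Rightarrow> real"
  assume t: "\<phi> \<in> test_functions UNIV" "\<psi> \<in> test_functions UNIV"
  obtain R1 where R1: "R1 > 0" "\<And>x. \<bar>x\<bar> > R1 \<Longrightarrow> \<phi> x = 0" by (rule test_function_bounds[OF t(1)], rule that)
  obtain R2 where R2: "R2 > 0" "\<And>x. \<bar>x\<bar> > R2 \<Longrightarrow> \<psi> x = 0" by (rule test_function_bounds[OF t(2)], rule that)
  define R where "R = max R1 R2"
  have R: "\<And>x. x > R \<Longrightarrow> \<phi> x = 0" "\<And>x. x > R \<Longrightarrow> \<psi> x = 0" "\<And>x. x > R \<Longrightarrow> \<phi> x + \<psi> x = 0"
    using R1 R2 by (auto simp: R_def)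
  have c: "continuous_on UNIV \<phi>" "continuous_on UNIV \<psi>"
    using t test_functionsD(1) smooth_continuous by blast+
  show "sol z (\<lambda>x. \<phi> x + \<psi> x) = sol z \<phi> + sol z \<psi>"
    using sol_cut[of R \<phi> z] sol_cut[of R \<psi> z] sol_cut[of R "\<lambda>x. \<phi> x + \<psi> x" z] R z
      Henstock_Kurzweil_Integration.integral_add[OF sol_integrable[OF c(1), of z R] sol_integrable[OF c(2), of z R]]
    by (simp add: scaleR_add_left)
next
  fix \<phi> :: "real \<Rightarrow> real" and a
  show "sol z (\<lambda>x. a * \<phi> x) = a *\<^sub>R sol z \<phi>" by (simp add: sol_scaleR)
next
  fix K :: "real set" assume "compact K \<and> K \<subseteq> UNIV"
  then obtain R where R: "R > 0" "\<And>x. x \<in> K \<Longrightarrow> \<bar>x\<bar> \<le> R"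
    using compact_imp_bounded[of K] unfolding bounded_pos real_norm_def by blast
  have "bounded ((\<lambda>s. m (z, s)) ` {0..R})"
    by (intro compact_imp_bounded compact_continuous_image continuous_on_compose2[OF continuous_m[of UNIV]] continuous_intros) auto
  then obtain B where B: "B > 0" "\<And>s. s \<in> {0..R} \<Longrightarrow> norm (m (z, s)) \<le> B"
    unfolding bounded_pos by auto
  have "norm (sol z \<phi>) \<le> (norm e2 + B * R) * b"
    if t: "\<phi> \<in> test_functions UNIV" and K: "supp \<phi> \<subseteq> K"
      and b: "\<forall>vs x. set vs \<subseteq> Basis \<and> length vs \<le> 0 \<longrightarrow> \<bar>partials vs \<phi> x\<bar> \<le> b" for \<phi> b
  proof -
    have b: "\<bar>\<phi> x\<bar> \<le> b" for x using b[rule_format, of "[]" x] by (simp add: partials_def)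
    have b0: "b \<ge> 0" using b[of 0] by linarith
    have zero: "\<phi> x = 0" if "x > R" for x
      using R(2)[of x] K that not_in_supp[of x \<phi>] by fastforce
    have n2: "norm (integral {0..R} (\<lambda>s. \<phi> (z + s) *\<^sub>R m (z, s))) \<le> (b * B) * (R - 0)"
    proof (rule integral_bound)
      show "continuous_on {0..R} (\<lambda>s. \<phi> (z + s) *\<^sub>R m (z, s))"
        by (intro continuous_intros continuous_on_compose2[OF smooth_continuous[OF test_functionsD(1)[OF t], of UNIV]]
            continuous_on_compose2[OF continuous_m[of UNIV]]) auto
      show "norm (\<phi> (z + s) *\<^sub>R m (z, s)) \<le> b * B" if "s \<in> {0..R}" for s
        using b B(2)[OF that] b0 by (auto intro!: mult_mono)
    qed (use R in simp)
    have n1: "norm (\<phi> z *\<^sub>R e2) \<le> b * norm e2"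
      using b by (auto intro!: mult_right_mono)
    have eq: "sol z \<phi> = \<phi> z *\<^sub>R e2 + integral {0..R} (\<lambda>s. \<phi> (z + s) *\<^sub>R m (z, s))"
      by (rule sol_cut[OF zero z])
    have "norm (sol z \<phi>) \<le> b * norm e2 + (b * B) * (R - 0)"
      unfolding eq by (rule order_trans[OF norm_triangle_ineq add_mono[OF n1 n2]])
    then show ?thesis by (simp add: algebra_simps)
  qed
  then show "\<exists>C N. \<forall>\<phi>\<in>test_functions UNIV. \<forall>b. supp \<phi> \<subseteq> K \<longrightarrow>
      (\<forall>vs x. set vs \<subseteq> Basis \<and> length vs \<le> N \<longrightarrow> \<bar>partials vs \<phi> x\<bar> \<le> b) \<longrightarrow> norm (sol z \<phi>) \<le> C * b"
    by (intro exI[of _ "norm e2 + B * R"] exI[of _ 0]) blast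
qed

lemma continuous_sol:
  assumes t: "\<phi> \<in> test_functions UNIV"
  shows "continuous_on {0..} (\<lambda>z. sol z \<phi>)"
proof -
  obtain R where R: "R > 0" "\<And>x. \<bar>x\<bar> > R \<Longrightarrow> \<phi> x = 0" by (rule test_function_bounds[OF t], rule that)
  have c: "continuous_on UNIV \<phi>" using t test_functionsD(1) smooth_continuous by blast
  have "continuous_on {0..} (\<lambda>z. \<phi> z *\<^sub>R e2 + integral (cbox 0 R) (\<lambda>s. \<phi> (z + s) *\<^sub>R m (z, s)))"
  proof (intro continuous_on_add continuous_on_scaleR continuous_on_const continuous_on_subset[OF c] integral_continuous_on_param)
    show "continuous_on ({0..} \<times> cbox 0 R) (\<lambda>(z, s). \<phi> (z + s) *\<^sub>R m (z, s))"
      unfolding case_prod_unfold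
      by (intro continuous_intros continuous_on_compose2[OF c] continuous_on_compose2[OF continuous_m[of UNIV]]) auto
  qed simp
  moreover have "sol z \<phi> = \<phi> z *\<^sub>R e2 + integral (cbox 0 R) (\<lambda>s. \<phi> (z + s) *\<^sub>R m (z, s))" if "z \<in> {0..}" for z
    using sol_cut[of R \<phi> z] R that by simp
  ultimately show ?thesis by (subst continuous_on_cong[OF refl]) auto
qed

text \<open>Fubini separates the mass on the line t = z from the density. The statement asks for
  continuity of \<open>\<psi>\<close> only, because it is also applied to the product of a test
  function with the coefficient.\<close>

lemma glue_sol:
  assumes c: "continuous_on UNIV \<psi>" and R: "R > 0" and \<psi>: "\<And>z t. z \<ge> R \<or> t \<ge> R \<Longrightarrow> \<psi> (z, t) = 0"
  shows "glue sol \<psi> = integral {0..R} (\<lambda>z. \<psi> (z, z) *\<^sub>R e2)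
    + square_integral R (\<lambda>p. \<psi> (fst p, fst p + snd p) *\<^sub>R m p)"
proof -
  have sol: "sol z (\<lambda>t. \<psi> (z, t)) = \<psi> (z, z) *\<^sub>R e2 + integral {0..R} (\<lambda>s. \<psi> (z, z + s) *\<^sub>R m (z, s))"
    if "z \<ge> 0" for z
    using that \<psi> by (subst sol_cut) auto
  have cs: "continuous_on UNIV (\<lambda>p. \<psi> (fst p, fst p + snd p) *\<^sub>R m p)"
    by (intro continuous_intros continuous_on_compose2[OF c] continuous_m) auto
  have cp: "continuous_on (cbox (0, 0) (R, R)) (\<lambda>(z, s). \<psi> (z, z + s) *\<^sub>R m (z, s))"
    using continuous_on_subset[OF cs] by (auto simp: case_prod_unfold)
  have i1: "(\<lambda>z. \<psi> (z, z) *\<^sub>R e2) integrable_on {0..R}"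
    by (intro integrable_continuous_interval continuous_intros continuous_on_compose2[OF c]) auto
  have "continuous_on {0..R} (\<lambda>z. integral (cbox 0 R) (\<lambda>s. \<psi> (z, z + s) *\<^sub>R m (z, s)))"
    by (rule integral_continuous_on_param)
      (use continuous_on_subset[OF cs] in \<open>auto simp: case_prod_unfold\<close>)
  then have i2: "(\<lambda>z. integral {0..R} (\<lambda>s. \<psi> (z, z + s) *\<^sub>R m (z, s))) integrable_on {0..R}"
    using integrable_continuous_interval by simp
  have "glue sol \<psi> = integral {0..R} (\<lambda>z. sol z (\<lambda>t. \<psi> (z, t)))"
    unfolding glue_def
  proof (rule integral_restrict_support)
    fix z assume z: "z \<in> {0..} - {0..R}"
    then have "z \<ge> R" "z \<ge> 0" by auto
    then show "sol z (\<lambda>t. \<psi> (z, t)) = 0"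
      unfolding sol[OF \<open>z \<ge> 0\<close>] using \<psi>[of z] by simp
  qed auto
  also have "\<dots> = integral {0..R} (\<lambda>z. \<psi> (z, z) *\<^sub>R e2 + integral {0..R} (\<lambda>s. \<psi> (z, z + s) *\<^sub>R m (z, s)))"
    by (rule integral_cong) (simp add: sol)
  also have "\<dots> = integral {0..R} (\<lambda>z. \<psi> (z, z) *\<^sub>R e2) + integral {0..R} (\<lambda>z. integral {0..R} (\<lambda>s. \<psi> (z, z + s) *\<^sub>R m (z, s)))"
    by (rule Henstock_Kurzweil_Integration.integral_add[OF i1 i2])
  also have "integral {0..R} (\<lambda>z. integral {0..R} (\<lambda>s. \<psi> (z, z + s) *\<^sub>R m (z, s)))
      = square_integral R (\<lambda>p. \<psi> (fst p, fst p + snd p) *\<^sub>R m p)"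
    using integral_prod_continuous[OF cp] by (simp add: case_prod_unfold)
  finally show ?thesis .
qed

lemma square_integrable:
  assumes "continuous_on UNIV \<psi>"
  shows "(\<lambda>p. \<psi> (fst p, fst p + snd p) *\<^sub>R m p) integrable_on cbox (0, 0) (R, R)"
    "(\<lambda>z. \<psi> (z, z) *\<^sub>R e2) integrable_on {0..R::real}"
  by (intro integrable_continuous integrable_continuous_interval continuous_intros continuous_on_compose2[OF assms] continuous_m; auto)+

lemma distribution_glue_sol: "distribution_on ({0<..} \<times> UNIV) (glue sol)"
  unfolding distribution_on_def
proof (intro conjI ballI allI impI)
  fix \<phi> \<psi> :: "real \<times> real \<Rightarrow> real"
  assume t: "\<phi> \<in> test_functions ({0<..} \<times> UNIV)" "\<psi> \<in> test_functions ({0<..} \<times> UNIV)"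
  obtain R1 where R1: "R1 > 0" "\<And>z t. z \<le> 0 \<or> z \<ge> R1 \<or> t \<ge> R1 \<Longrightarrow> (z, t) \<notin> supp \<phi>"
    by (rule test_function_quadrant_bounds[OF t(1)], rule that)
  obtain R2 where R2: "R2 > 0" "\<And>z t. z \<le> 0 \<or> z \<ge> R2 \<or> t \<ge> R2 \<Longrightarrow> (z, t) \<notin> supp \<psi>"
    by (rule test_function_quadrant_bounds[OF t(2)], rule that)
  define R where "R = max R1 R2"
  have R0: "R > 0" using R1 by (simp add: R_def)
  have R: "\<phi> (z, t) = 0" "\<psi> (z, t) = 0" "\<phi> (z, t) + \<psi> (z, t) = 0" if "z \<ge> R \<or> t \<ge> R" for z t
    using R1(2)[of z t] R2(2)[of z t] that not_in_supp[of "(z, t)" \<phi>]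
      not_in_supp[of "(z, t)" \<psi>] by (auto simp: R_def)
  have c: "continuous_on UNIV \<phi>" "continuous_on UNIV \<psi>"
    using t test_functionsD(1) smooth_continuous by blast+
  note i = square_integrable[OF c(1), of R] square_integrable[OF c(2), of R]
  show "glue sol (\<lambda>x. \<phi> x + \<psi> x) = glue sol \<phi> + glue sol \<psi>"
  proof -
    let ?I = "\<lambda>\<psi>. integral {0..R} (\<lambda>z. \<psi> (z, z) *\<^sub>R e2)
      + square_integral R (\<lambda>p. \<psi> (fst p, fst p + snd p) *\<^sub>R m p)"
    have "glue sol \<phi> = ?I \<phi>" by (rule glue_sol[OF c(1) R0 R(1)])
    moreover have "glue sol \<psi> = ?I \<psi>" by (rule glue_sol[OF c(2) R0 R(2)])
    moreover have "glue sol (\<lambda>x. \<phi> x + \<psi> x) = ?I (\<lambda>x. \<phi> x + \<psi> x)"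
      by (rule glue_sol[OF continuous_on_add[OF c] R0 R(3)])
    ultimately show ?thesis
      using Henstock_Kurzweil_Integration.integral_add[OF i(2,4)] Henstock_Kurzweil_Integration.integral_add[OF i(1,3)]
      by (simp add: scaleR_add_left)
  qed
next
  fix \<phi> :: "real \<times> real \<Rightarrow> real" and a
  show "glue sol (\<lambda>x. a * \<phi> x) = a *\<^sub>R glue sol \<phi>"
    by (simp add: glue_def flip: sol_scaleR)
next
  fix K :: "(real \<times> real) set" assume K: "compact K \<and> K \<subseteq> {0<..} \<times> UNIV"
  then obtain r where r: "r > 0" "\<And>p. p \<in> K \<Longrightarrow> norm p \<le> r"
    using compact_imp_bounded[of K] unfolding bounded_pos by blast
  define R where "R = r + 1"
  have R: "R > 0" using r by (simp add: R_def)
  have "bounded (m ` cbox (0, 0) (R, R))"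
    by (intro compact_imp_bounded compact_continuous_image continuous_m compact_cbox)
  then obtain B where B: "B > 0" "\<And>p. p \<in> cbox (0, 0) (R, R) \<Longrightarrow> norm (m p) \<le> B"
    unfolding bounded_pos by auto
  have "norm (glue sol \<phi>) \<le> (norm e2 * R + B * measure lborel (cbox (0, 0) (R, R) :: (real \<times> real) set)) * b"
    if t: "\<phi> \<in> test_functions ({0<..} \<times> UNIV)" and K: "supp \<phi> \<subseteq> K"
      and b: "\<forall>vs x. set vs \<subseteq> Basis \<and> length vs \<le> 0 \<longrightarrow> \<bar>partials vs \<phi> x\<bar> \<le> b" for \<phi> b
  proof -
    have b: "\<bar>\<phi> x\<bar> \<le> b" for x using b[rule_format, of "[]" x] by (simp add: partials_def)
    have b0: "b \<ge> 0" using b[of 0] by linarith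
    have c: "continuous_on UNIV \<phi>" using t test_functionsD(1) smooth_continuous by blast
    have zero: "\<phi> (z, t) = 0" if "z \<ge> R \<or> t \<ge> R" for z t
    proof (rule not_in_supp[of "(z, t)" \<phi>], rule notI)
      assume "(z, t) \<in> supp \<phi>"
      then have "norm (z, t) \<le> r" using K r by blast
      then have "\<bar>z\<bar> \<le> r" "\<bar>t\<bar> \<le> r" using norm_fst_le[of z t] norm_snd_le[of t z] by simp_all
      then show False using that by (auto simp: R_def)
    qed
    have n1: "norm (integral {0..R} (\<lambda>z. \<phi> (z, z) *\<^sub>R e2)) \<le> (b * norm e2) * (R - 0)"
    proof -
      have "continuous_on {0..R} (\<lambda>z. \<phi> (z, z) *\<^sub>R e2)"
        by (intro continuous_intros continuous_on_compose2[OF c]) auto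
      moreover have "norm (\<phi> (z, z) *\<^sub>R e2) \<le> b * norm e2" for z
        using b[of "(z, z)"] by (simp add: mult_right_mono)
      ultimately show ?thesis
        using integral_bound[of 0 R "\<lambda>z. \<phi> (z, z) *\<^sub>R e2" "b * norm e2"] R by simp
    qed
    have n2: "norm (square_integral R (\<lambda>p. \<phi> (fst p, fst p + snd p) *\<^sub>R m p)) \<le> (b * B) * measure lborel (cbox (0, 0) (R, R) :: (real \<times> real) set)"
    proof (rule has_integral_bound[OF _ integrable_integral[OF square_integrable(1)[OF c]]])
      show "norm (\<phi> (fst p, fst p + snd p) *\<^sub>R m p) \<le> b * B" if "p \<in> cbox (0, 0) (R, R)" for p
        using b B(2)[OF that] b0 by (auto intro!: mult_mono)
    qed (use b0 B in simp)
    have eq: "glue sol \<phi> = integral {0..R} (\<lambda>z. \<phi> (z, z) *\<^sub>R e2)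
      + square_integral R (\<lambda>p. \<phi> (fst p, fst p + snd p) *\<^sub>R m p)"
      by (rule glue_sol[OF c R zero])
    have "norm (glue sol \<phi>) \<le> (b * norm e2) * (R - 0) + (b * B) * measure lborel (cbox (0, 0) (R, R) :: (real \<times> real) set)"
      unfolding eq by (rule order_trans[OF norm_triangle_ineq add_mono[OF n1 n2]])
    then show ?thesis by (simp add: algebra_simps)
  qed
  then show "\<exists>C N. \<forall>\<phi>\<in>test_functions ({0<..} \<times> UNIV). \<forall>b. supp \<phi> \<subseteq> K \<longrightarrow>
      (\<forall>vs x. set vs \<subseteq> Basis \<and> length vs \<le> N \<longrightarrow> \<bar>partials vs \<phi> x\<bar> \<le> b) \<longrightarrow> norm (glue sol \<phi>) \<le> C * b"
    by (intro exI[of _ "norm e2 * R + B * measure lborel (cbox (0, 0) (R, R) :: (real \<times> real) set)"] exI[of _ 0]) blast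
qed

end

lemma integral_matrix_vector_mult:
  fixes M :: "real^'n^'m"
  assumes "f integrable_on S"
  shows "integral S (\<lambda>x. M *v f x) = M *v integral S f"
  using integral_linear[OF assms matrix_vector_mul_bounded_linear[of M]] by (simp add: o_def)

lemma integrable_matrix_vector_mult:
  fixes M :: "real^'n^'m"
  assumes "f integrable_on S"
  shows "(\<lambda>x. M *v f x) integrable_on S"
  using integrable_linear[OF assms matrix_vector_mul_bounded_linear[of M]] by (simp add: o_def)

context quadrant_solution
begin

lemma matA_e2: "matA c *v e2 = - e2"
  by (simp add: vec_eq_iff forall_4 matA_nth e2_nth)

text \<open>Row by row this reads 2 m1 = 0, 0 = 0, (1 + c) m3 = \<beta> (c - 1)/2 and (1 - c) m4 = -
  \<beta> (c + 1)/2, which is where the values prescribed on t = z come from. They leave the second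
  component free there; its condition stands at z = 0.\<close>

lemma m_base: "m (z, 0) + matA c *v m (z, 0) = \<beta> z *\<^sub>R (matB c *v e2)"
proof -
  have cancel: "a * (y / (2 * a)) = y / 2" if "a \<noteq> 0" for a y :: real using that by simp
  have "(c - 1) / (2 * (c + 1)) * x + c * ((c - 1) / (2 * (c + 1)) * x) = x * ((c - 1) / 2)" for x
  proof -
    have "(c - 1) / (2 * (c + 1)) * x + c * ((c - 1) / (2 * (c + 1)) * x) = ((c + 1) * ((c - 1) / (2 * (c + 1)))) * x"
      by (simp only: distrib_right distrib_left mult_1 mult.assoc)
    also have "(c + 1) * ((c - 1) / (2 * (c + 1))) = (c - 1) / 2" by (rule cancel) (use c in simp)
    finally show ?thesis by simp
  qed
  moreover have "(c + 1) / (2 * (c - 1)) * x - c * ((c + 1) / (2 * (c - 1)) * x) = - (x * ((c + 1) / 2))" for x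
  proof -
    have "(c + 1) / (2 * (c - 1)) * x - c * ((c + 1) / (2 * (c - 1)) * x) = - ((c - 1) * ((c + 1) / (2 * (c - 1)))) * x"
      by (simp only: left_diff_distrib minus_diff_eq mult_1 mult.assoc mult_minus_left)
    also have "(c - 1) * ((c + 1) / (2 * (c - 1))) = (c + 1) / 2" by (rule cancel) (use c in simp)
    finally show ?thesis by simp
  qed
  moreover define g3 where "g3 = (c - 1) / (2 * (c + 1))"
  moreover define g4 where "g4 = (c + 1) / (2 * (c - 1))"
  ultimately have "g3 * \<beta> z + c * (g3 * \<beta> z) = \<beta> z * ((c - 1) / 2)"
    "g4 * \<beta> z - c * (g4 * \<beta> z) = - (\<beta> z * ((c + 1) / 2))" by blast+
  then show ?thesis
    unfolding vec_eq_iff forall_4 vector_add_component vector_scaleR_component matA_nth matB_nth e2_nth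
      m1 m3[folded g3_def] m4[folded g4_def]
    by (simp add: field_simps)
qed

text \<open>For the mass on t = z, A e2 = - e2 turns the derivative terms into the integral of the
  total derivative of \<psi>(z, z), which vanishes; its zero-order term remains. For the density,
  integration by parts leaves one boundary term at s = 0, and \<open>m_base\<close> matches it with
  that remainder.\<close>

lemma sol_pde:
  assumes \<psi>: "\<psi> \<in> test_functions ({0<..} \<times> UNIV)"
  shows "dist_deriv (0, 1) (glue sol) \<psi> =
    matA c *v dist_deriv (1, 0) (glue sol) \<psi> + matB c *v glue (\<lambda>z \<phi>. \<beta> z *\<^sub>R sol z \<phi>) \<psi>"
proof -
  define \<psi>z where "\<psi>z = partial (1, 0) \<psi>"
  define \<psi>t where "\<psi>t = partial (0, 1) \<psi>"
  obtain R where R: "R > 0" and supp: "\<And>z t. z \<le> 0 \<or> z \<ge> R \<or> t \<ge> R \<Longrightarrow> (z, t) \<notin> supp \<psi>"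
    by (rule test_function_quadrant_bounds[OF \<psi>], rule that)
  have zero: "\<psi> (z, t) = 0" "\<psi>z (z, t) = 0" "\<psi>t (z, t) = 0" if "z \<le> 0 \<or> z \<ge> R \<or> t \<ge> R" for z t
    using not_in_supp[OF supp[OF that]] partial_outside_supp[OF supp[OF that]] by (simp_all add: \<psi>z_def \<psi>t_def)
  have C1: "C1_plane \<psi> \<psi>z \<psi>t"
    unfolding \<psi>z_def \<psi>t_def by (rule smooth_C1_plane[OF test_functionsD(1)[OF \<psi>]])
  note c\<psi> = C1_planeD(1-3)[OF C1]
  define \<sigma> :: "real \<times> real \<Rightarrow> real \<times> real" where "\<sigma> p = (fst p, fst p + snd p)" for p
  \<comment> \<open>The coefficient is moved onto the test function, so that all three terms of the
    equation have the form covered by \<open>glue_sol\<close>.\<close>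
  define b\<psi> where "b\<psi> p = \<beta> (fst p) * \<psi> p" for p
  have cb: "continuous_on UNIV b\<psi>"
    unfolding b\<psi>_def by (intro continuous_intros c\<psi> continuous_on_compose2[OF continuous_\<beta>[of UNIV]]) auto
  let ?D = "\<lambda>\<psi>. integral {0..R} (\<lambda>z. \<psi> (z, z) *\<^sub>R e2)"
  let ?S = "\<lambda>\<psi>. square_integral R (\<lambda>p. \<psi> (\<sigma> p) *\<^sub>R m p)"
  have g: "glue sol \<psi>t = ?D \<psi>t + ?S \<psi>t" "glue sol \<psi>z = ?D \<psi>z + ?S \<psi>z" "glue sol b\<psi> = ?D b\<psi> + ?S b\<psi>"
    unfolding \<sigma>_def
    by (rule glue_sol[OF _ R]; use c\<psi> cb zero in \<open>simp add: b\<psi>_def\<close>)+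
  \<comment> \<open>\<open>Q\<close> is the product to be integrated by parts in (z, s), with
    partial derivatives \<open>Qz\<close> and \<open>Qs\<close>; the shear \<open>\<sigma>\<close>
    adds \<open>\<psi>t\<close> to the z-derivative.\<close>
  define Q where "Q p = \<psi> (\<sigma> p) *\<^sub>R m p" for p
  define Qz where "Qz p = (\<psi>z (\<sigma> p) + \<psi>t (\<sigma> p)) *\<^sub>R m p + \<psi> (\<sigma> p) *\<^sub>R mz p" for p
  define Qs where "Qs p = \<psi>t (\<sigma> p) *\<^sub>R m p + \<psi> (\<sigma> p) *\<^sub>R ms p" for p
  have Q: "C1_plane Q Qz Qs"
    using C1_plane_scaleR[OF C1_plane_shear[OF C1] m] by (simp add: Q_def[abs_def] Qz_def[abs_def] Qs_def[abs_def] \<sigma>_def)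
  have "square_integral R Qz = integral {0..R} (\<lambda>s. Q (R, s) - Q (0, s))"
    by (rule square_integral_x[OF Q]) (use R in simp)
  also have "\<dots> = integral {0..R} (\<lambda>s. 0)"
    by (rule integral_cong) (simp add: Q_def \<sigma>_def zero)
  finally have Sz: "square_integral R Qz = 0" by simp
  have "square_integral R Qs = integral {0..R} (\<lambda>z. Q (z, R) - Q (z, 0))"
    by (rule square_integral_y[OF Q]) (use R in simp)
  also have "\<dots> = integral {0..R} (\<lambda>z. - (\<psi> (z, z) *\<^sub>R m (z, 0)))"
    by (rule integral_cong) (simp add: Q_def \<sigma>_def zero)
  finally have Ss: "square_integral R Qs = integral {0..R} (\<lambda>z. - (\<psi> (z, z) *\<^sub>R m (z, 0)))" .
  have iQ: "Qz integrable_on cbox (0, 0) (R, R)" "Qs integrable_on cbox (0, 0) (R, R)"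
    using C1_planeD(2,3)[OF Q] continuous_on_subset by (blast intro: integrable_continuous)+
  have im: "(\<lambda>z. \<psi> (z, z) *\<^sub>R m (z, 0)) integrable_on {0..R}"
    by (intro integrable_continuous_interval continuous_intros continuous_on_compose2[OF c\<psi>(1)]
        continuous_on_compose2[OF continuous_m[of UNIV]]) auto
  note i = square_integrable[OF c\<psi>(2), of R] square_integrable[OF c\<psi>(3), of R] square_integrable[OF cb, of R]
  note iS = i(1,3,5)[folded \<sigma>_def]
  have "matA c *v ?S \<psi>z - ?S \<psi>t - matB c *v ?S b\<psi>
    = square_integral R (\<lambda>p. matA c *v (\<psi>z (\<sigma> p) *\<^sub>R m p) - \<psi>t (\<sigma> p) *\<^sub>R m p - matB c *v (b\<psi> (\<sigma> p) *\<^sub>R m p))"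
    by (simp add: Henstock_Kurzweil_Integration.integral_diff integrable_diff integral_matrix_vector_mult
        integrable_matrix_vector_mult iS)
  \<comment> \<open>The derivatives of \<psi> are completed to derivatives of \<open>Q\<close>. The
    terms with derivatives of \<open>m\<close> that this adds are exactly those of
    \<open>pde\<close>, and so make up the term with B.\<close>
  also have "\<dots> = square_integral R (\<lambda>p. matA c *v Qz p - Qs p - matA c *v Qs p)"
  proof (rule integral_cong)
    fix p
    have "matA c *v Qz p - Qs p - matA c *v Qs p = matA c *v (\<psi>z (\<sigma> p) *\<^sub>R m p) - \<psi>t (\<sigma> p) *\<^sub>R m p
       + \<psi> (\<sigma> p) *\<^sub>R (matA c *v mz p - (ms p + matA c *v ms p))"
      by (simp add: Qz_def Qs_def matrix_vector_right_distrib matrix_vector_mult_scaleR algebra_simps)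
    also have "matA c *v mz p - (ms p + matA c *v ms p) = - (\<beta> (fst p) *\<^sub>R (matB c *v m p))"
      unfolding pde by simp
    finally show "matA c *v (\<psi>z (\<sigma> p) *\<^sub>R m p) - \<psi>t (\<sigma> p) *\<^sub>R m p - matB c *v (b\<psi> (\<sigma> p) *\<^sub>R m p)
        = matA c *v Qz p - Qs p - matA c *v Qs p"
      by (simp add: b\<psi>_def \<sigma>_def matrix_vector_mult_scaleR mult.commute)
  qed
  also have "\<dots> = matA c *v square_integral R Qz - square_integral R Qs - matA c *v square_integral R Qs"
    by (simp add: Henstock_Kurzweil_Integration.integral_diff integrable_diff integral_matrix_vector_mult
        integrable_matrix_vector_mult iQ)
  also have "\<dots> = integral {0..R} (\<lambda>z. \<psi> (z, z) *\<^sub>R m (z, 0)) + matA c *v integral {0..R} (\<lambda>z. \<psi> (z, z) *\<^sub>R m (z, 0))"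
    by (simp add: Sz Ss matrix_vector_mult_diff_distrib[of _ 0, simplified])
  also have "\<dots> = integral {0..R} (\<lambda>z. \<psi> (z, z) *\<^sub>R m (z, 0) + matA c *v (\<psi> (z, z) *\<^sub>R m (z, 0)))"
    by (simp add: Henstock_Kurzweil_Integration.integral_add integral_matrix_vector_mult integrable_matrix_vector_mult im)
  also have "\<dots> = integral {0..R} (\<lambda>z. matB c *v (b\<psi> (z, z) *\<^sub>R e2))"
  proof (rule integral_cong)
    fix z
    have "\<psi> (z, z) *\<^sub>R m (z, 0) + matA c *v (\<psi> (z, z) *\<^sub>R m (z, 0)) = \<psi> (z, z) *\<^sub>R (m (z, 0) + matA c *v m (z, 0))"
      by (simp add: matrix_vector_mult_scaleR scaleR_add_right)
    then show "\<psi> (z, z) *\<^sub>R m (z, 0) + matA c *v (\<psi> (z, z) *\<^sub>R m (z, 0)) = matB c *v (b\<psi> (z, z) *\<^sub>R e2)"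
      unfolding m_base by (simp add: b\<psi>_def matrix_vector_mult_scaleR mult.commute)
  qed
  also have "\<dots> = matB c *v ?D b\<psi>"
    by (rule integral_matrix_vector_mult[OF i(6)])
  finally have S: "matA c *v ?S \<psi>z - ?S \<psi>t - matB c *v ?S b\<psi> = matB c *v ?D b\<psi>" .
  have "matA c *v ?D \<psi>z - ?D \<psi>t = integral {0..R} (\<lambda>z. matA c *v (\<psi>z (z, z) *\<^sub>R e2) - \<psi>t (z, z) *\<^sub>R e2)"
    by (simp add: Henstock_Kurzweil_Integration.integral_diff integral_matrix_vector_mult integrable_matrix_vector_mult i(2,4))
  also have "\<dots> = integral {0..R} (\<lambda>z. (\<psi>z (z, z) + \<psi>t (z, z)) *\<^sub>R (- e2))"
    by (rule integral_cong) (simp add: matrix_vector_mult_scaleR matA_e2 algebra_simps)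
  also have "\<dots> = \<psi> (R, R) *\<^sub>R (- e2) - \<psi> (0, 0) *\<^sub>R (- e2)"
  proof (rule integral_unique, rule fundamental_theorem_of_calculus)
    fix z
    have "((\<lambda>z. \<psi> (z, z)) has_real_derivative \<psi>z (z, z) + \<psi>t (z, z)) (at z within {0..R})"
      using C1_plane_line[OF C1, of "(0, 0)" "(1, 1)" z "{0..R}"]
      by (simp add: has_real_derivative_iff_has_vector_derivative)
    from has_vector_derivative_scaleR[OF this has_vector_derivative_const[of "- e2"]]
    show "((\<lambda>z. \<psi> (z, z) *\<^sub>R (- e2)) has_vector_derivative (\<psi>z (z, z) + \<psi>t (z, z)) *\<^sub>R (- e2)) (at z within {0..R})"
      by simp
  qed (use R in simp)
  finally have D: "matA c *v ?D \<psi>z = ?D \<psi>t" using zero by simp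
  have "glue (\<lambda>z \<phi>. \<beta> z *\<^sub>R sol z \<phi>) \<psi> = glue sol b\<psi>"
    by (simp add: glue_def sol_scaleR b\<psi>_def)
  moreover have "matA c *v glue sol \<psi>z = glue sol \<psi>t + matB c *v glue sol b\<psi>"
    using S D unfolding g matrix_vector_right_distrib by (simp add: algebra_simps)
  moreover have "matA c *v (- glue sol \<psi>z) = - (matA c *v glue sol \<psi>z)"
    using matrix_vector_mult_diff_distrib[of "matA c" 0 "glue sol \<psi>z"] by simp
  ultimately show ?thesis
    by (simp add: dist_deriv_def \<psi>z_def[symmetric] \<psi>t_def[symmetric])
qed

text \<open>The coefficient of the locale lives on the whole line, \<open>b\<close> on the
  half-line; they may be exchanged because \<open>glue\<close> integrates over z \<ge> 0.\<close>

lemma ibvp_solution_sol: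
  assumes b: "\<And>z. z \<ge> 0 \<Longrightarrow> \<beta> z = b z"
  shows "ibvp_solution c b sol"
  unfolding ibvp_solution_def
proof (intro conjI ballI allI impI)
  fix \<psi> :: "real \<times> real \<Rightarrow> real" assume "\<psi> \<in> test_functions ({0<..} \<times> UNIV)"
  moreover have "glue (\<lambda>z \<phi>. b z *\<^sub>R sol z \<phi>) \<psi> = glue (\<lambda>z \<phi>. \<beta> z *\<^sub>R sol z \<phi>) \<psi>"
    unfolding glue_def by (rule integral_cong) (simp add: b)
  ultimately show "dist_deriv (0, 1) (glue sol) \<psi> =
    matA c *v dist_deriv (1, 0) (glue sol) \<psi> + matB c *v glue (\<lambda>z \<phi>. b z *\<^sub>R sol z \<phi>) \<psi>"
    using sol_pde by simp
next
  fix \<phi> :: "real \<Rightarrow> real" assume t: "\<phi> \<in> test_functions UNIV"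
  obtain R where R: "R > 0" "\<And>x. \<bar>x\<bar> > R \<Longrightarrow> \<phi> x = 0" by (rule test_function_bounds[OF t], rule that)
  have s: "sol 0 \<phi> = \<phi> 0 *\<^sub>R e2 + integral {0..R} (\<lambda>s. \<phi> (0 + s) *\<^sub>R m (0, s))"
    by (rule sol_cut) (use R in auto)
  have i: "(\<lambda>s. \<phi> (0 + s) *\<^sub>R m (0, s)) integrable_on {0..R}"
    by (rule sol_integrable[OF smooth_continuous[OF test_functionsD(1)[OF t]]])
  have comp: "integral {0..R} (\<lambda>s. \<phi> (0 + s) *\<^sub>R m (0, s)) $ j = 0" if "\<And>s. s \<ge> 0 \<Longrightarrow> m (0, s) $ j = 0" for j
  proof -
    have "integral {0..R} (\<lambda>s. \<phi> (0 + s) *\<^sub>R m (0, s)) $ j = integral {0..R} (\<lambda>s. (\<phi> (0 + s) *\<^sub>R m (0, s)) $ j)"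
      using integral_linear[OF i bounded_linear_vec_nth[of j]] by (simp add: o_def)
    also have "\<dots> = integral {0..R} (\<lambda>s. 0)" by (rule integral_cong) (simp add: that)
    finally show ?thesis by simp
  qed
  show "sol 0 \<phi> $ 2 = dirac 0 \<phi>" "sol 0 \<phi> $ 4 = 0"
    using comp[OF m0(1)] comp[OF m0(2)] by (simp_all add: s dirac_def e2_nth)
next
  fix z :: real and \<phi> :: "real \<Rightarrow> real"
  assume z: "z \<ge> 0" and t: "\<phi> \<in> test_functions {..<0}"
  have zero: "\<phi> x = 0" if "x \<ge> 0" for x
    using test_functionsD(3)[OF t] that by (intro not_in_supp) auto
  have "integral {0..} (\<lambda>s. \<phi> (z + s) *\<^sub>R m (z, s)) = integral {0..} (\<lambda>s::real. 0)"
    by (rule integral_cong) (use zero z in simp)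
  then show "sol z \<phi> = 0" using zero[OF z] by (simp add: sol_def dirac_def)
qed (simp_all add: distribution_sol continuous_sol distribution_glue_sol)

end

section \<open>Uniqueness of the distributional solution\<close>

lemma has_derivative_tensor:
  fixes f g :: "real \<Rightarrow> real"
  assumes "smooth f" "smooth g"
  shows "((\<lambda>p. f (fst p) * g (snd p)) has_derivative
    (\<lambda>v. fst v * (partial 1 f (fst p) * g (snd p)) + snd v * (f (fst p) * partial 1 g (snd p)))) (at p)"
proof -
  have "((\<lambda>p::real\<times>real. f (fst p)) has_derivative (\<lambda>v. partial 1 f (fst p) * fst v)) (at p)"
    by (rule has_derivative_compose[OF bounded_linear_imp_has_derivative[OF bounded_linear_fst]])
      (use smooth_real_derivative[OF assms(1), of "fst p"] in \<open>simp add: has_field_derivative_def\<close>)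
  moreover have "((\<lambda>p::real\<times>real. g (snd p)) has_derivative (\<lambda>v. partial 1 g (snd p) * snd v)) (at p)"
    by (rule has_derivative_compose[OF bounded_linear_imp_has_derivative[OF bounded_linear_snd]])
      (use smooth_real_derivative[OF assms(2), of "snd p"] in \<open>simp add: has_field_derivative_def\<close>)
  ultimately show ?thesis
    by (rule has_derivative_eq_rhs[OF has_derivative_mult]) (simp add: fun_eq_iff ac_simps)
qed

lemma partial_tensor:
  fixes f g :: "real \<Rightarrow> real"
  assumes "smooth f" "smooth g"
  shows "partial (1, 0) (\<lambda>p. f (fst p) * g (snd p)) = (\<lambda>p. partial 1 f (fst p) * g (snd p))"
    "partial (0, 1) (\<lambda>p. f (fst p) * g (snd p)) = (\<lambda>p. f (fst p) * partial 1 g (snd p))"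
  using partialI[OF has_derivative_tensor[OF assms]] by (simp_all add: fun_eq_iff)

text \<open>Each partial derivative of a product f(z) g(t) is again such a product, so the induction
  over directions stays in this class.\<close>

lemma smooth_tensor:
  fixes f g :: "real \<Rightarrow> real"
  assumes "smooth f" "smooth g"
  shows "smooth (\<lambda>p. f (fst p) * g (snd p))"
  unfolding smooth_def
proof (intro allI impI)
  fix vs and p :: "real \<times> real"
  assume "set vs \<subseteq> (Basis :: (real \<times> real) set)"
  then have "\<exists>f' g'. smooth f' \<and> smooth g' \<and> partials vs (\<lambda>p. f (fst p) * g (snd p)) = (\<lambda>p. f' (fst p) * g' (snd p))"
  proof (induction vs)
    case Nil
    then show ?case using assms by (auto simp: partials_def)
  next
    case (Cons v vs)
    then obtain f' g' where *: "smooth f'" "smooth g'"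
      "partials vs (\<lambda>p. f (fst p) * g (snd p)) = (\<lambda>p. f' (fst p) * g' (snd p))" by auto
    have p: "partials (v # vs) (\<lambda>p. f (fst p) * g (snd p)) = partial v (\<lambda>p. f' (fst p) * g' (snd p))"
      using *(3) by (simp add: partials_def)
    have sm: "smooth (partial 1 f')" "smooth (partial 1 g')" using * by (auto intro: smooth_partial)
    have "v = (1, 0) \<or> v = (0, 1)" using Cons.prems by (simp add: Basis_plane)
    then show ?case
      unfolding p using partial_tensor[OF *(1,2)] sm *(1,2) by (elim disjE) (simp; blast)+
  qed
  then obtain f' g' where *: "smooth f'" "smooth g'"
    "partials vs (\<lambda>p. f (fst p) * g (snd p)) = (\<lambda>p. f' (fst p) * g' (snd p))" by blast
  show "partials vs (\<lambda>p. f (fst p) * g (snd p)) differentiable (at p)"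
    unfolding *(3) differentiable_def by (rule exI) (rule has_derivative_tensor[OF *(1,2)])
qed

lemma test_functions_tensor:
  fixes f g :: "real \<Rightarrow> real"
  assumes "f \<in> test_functions {0<..}" "g \<in> test_functions UNIV"
  shows "(\<lambda>p. f (fst p) * g (snd p)) \<in> test_functions ({0<..} \<times> UNIV)"
proof (rule test_functionI[of _ "supp f \<times> supp g"])
  show "smooth (\<lambda>p. f (fst p) * g (snd p))"
    using assms by (intro smooth_tensor test_functionsD(1))
  show "compact (supp f \<times> supp g)" using assms by (intro compact_Times test_functionsD(2))
  show "supp f \<times> supp g \<subseteq> {0<..} \<times> UNIV" using test_functionsD(3)[OF assms(1)] by auto
  show "f (fst p) * g (snd p) = 0" if "p \<notin> supp f \<times> supp g" for p
    using that not_in_supp[of "fst p" f] not_in_supp[of "snd p" g] by (auto simp: mem_Times_iff)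
qed

text \<open>Testing with products \<theta>(z) \<phi>(t) puts the t-derivative on \<phi> and leaves a
  weak equation in z between continuous functions, so the z-derivative is a classical one.\<close>

lemma ibvp_solution_derivative:
  assumes M: "ibvp_solution c b M" and c: "0 < c" and b: "continuous_on {0..} b"
    and \<phi>: "\<phi> \<in> test_functions UNIV" and z: "z > 0"
  shows "((\<lambda>z. spd c i * M z \<phi> $ i) has_real_derivative
    - M z (partial 1 \<phi>) $ i - b z * (matB c *v M z \<phi>) $ i) (at z)"
proof (rule weak_derivative_imp_derivative[OF _ _ _ z])
  have \<phi>': "partial 1 \<phi> \<in> test_functions UNIV" by (rule test_functions_partial[OF \<phi>]) simp
  have M1: "distribution_on UNIV (M z)" if "z \<ge> 0" for z
    using M that unfolding ibvp_solution_def by blast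
  have cM: "continuous_on {0..} (\<lambda>z. M z \<phi>)" if "\<phi> \<in> test_functions UNIV" for \<phi>
    using M that unfolding ibvp_solution_def by blast
  have cB: "continuous_on {0..} (\<lambda>z. matB c *v M z \<phi>)"
    by (rule continuous_on_compose2[OF matrix_vector_mult_linear_continuous_on[of UNIV] cM[OF \<phi>]]) simp
  show "continuous_on {0..} (\<lambda>z. spd c i * M z \<phi> $ i)"
    by (intro continuous_intros cM[OF \<phi>])
  show "continuous_on {0..} (\<lambda>z. - M z (partial 1 \<phi>) $ i - b z * (matB c *v M z \<phi>) $ i)"
    by (intro continuous_intros cM[OF \<phi>'] cB b)
  fix \<theta> :: "real \<Rightarrow> real" assume \<theta>: "\<theta> \<in> test_functions {0<..}"
  obtain l r where lr: "0 < l" "l < r" "\<And>x. x \<notin> {l..r} \<Longrightarrow> \<theta> x = 0"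
    by (rule test_function_halfline_bounds[OF \<theta>], rule that)
  have \<theta>': "partial 1 \<theta> x = 0" if "x \<notin> {l..r}" for x
  proof (rule partial_outside_supp)
    show "x \<notin> supp \<theta>" using supp_subset[of "{l..r}" \<theta>] lr(3) that by auto
  qed
  have cut: "integral {0..} (\<lambda>z. h z *\<^sub>R F z) = integral {0..r} (\<lambda>z. h z *\<^sub>R F z)"
    if "\<And>x. x \<notin> {l..r} \<Longrightarrow> h x = 0" for h and F :: "real \<Rightarrow> 'z::banach"
    by (rule integral_restrict_support) (use that lr in auto)
  note sm = test_functionsD(1)[OF \<theta>] test_functionsD(1)[OF \<phi>]
  have c\<theta>: "continuous_on {0..r} \<theta>" "continuous_on {0..r} (partial 1 \<theta>)"
    by (rule smooth_continuous[OF sm(1)]) (rule smooth_continuous[OF smooth_partial[OF sm(1)]], simp)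
  have sub: "continuous_on {0..r} F" if "continuous_on {0..} F" for F :: "real \<Rightarrow> 'z::topological_space"
    by (rule continuous_on_subset[OF that]) auto
  define T where "T p = \<theta> (fst p) * \<phi> (snd p)" for p
  have T: "T \<in> test_functions ({0<..} \<times> UNIV)"
    unfolding T_def[abs_def] by (rule test_functions_tensor[OF \<theta> \<phi>])
  \<comment> \<open>\<open>M z\<close> acts in t only, so \<theta>(z) is a scalar for it and comes
    out by homogeneity.\<close>
  have g1: "glue M (partial (0, 1) T) = integral {0..r} (\<lambda>z. \<theta> z *\<^sub>R M z (partial 1 \<phi>))"
  proof -
    have "glue M (partial (0, 1) T) = integral {0..} (\<lambda>z. \<theta> z *\<^sub>R M z (partial 1 \<phi>))"
      unfolding glue_def T_def[abs_def] partial_tensor[OF sm]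
      by (rule integral_cong) (simp add: distribution_cmult[OF M1 \<phi>'])
    then show ?thesis using cut[of \<theta>, OF lr(3)] by simp
  qed
  have g2: "glue M (partial (1, 0) T) = integral {0..r} (\<lambda>z. partial 1 \<theta> z *\<^sub>R M z \<phi>)"
  proof -
    have "glue M (partial (1, 0) T) = integral {0..} (\<lambda>z. partial 1 \<theta> z *\<^sub>R M z \<phi>)"
      unfolding glue_def T_def[abs_def] partial_tensor[OF sm]
      by (rule integral_cong) (simp add: distribution_cmult[OF M1 \<phi>])
    then show ?thesis using cut[of "partial 1 \<theta>", OF \<theta>'] by simp
  qed
  have g3: "glue (\<lambda>z \<phi>. b z *\<^sub>R M z \<phi>) T = integral {0..r} (\<lambda>z. \<theta> z *\<^sub>R (b z *\<^sub>R M z \<phi>))"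
  proof -
    have "glue (\<lambda>z \<phi>. b z *\<^sub>R M z \<phi>) T = integral {0..} (\<lambda>z. \<theta> z *\<^sub>R (b z *\<^sub>R M z \<phi>))"
      unfolding glue_def T_def
      by (rule integral_cong) (simp add: distribution_cmult[OF M1 \<phi>])
    also have "\<dots> = integral {0..r} (\<lambda>z. \<theta> z *\<^sub>R (b z *\<^sub>R M z \<phi>))"
      by (rule cut) (rule lr(3))
    finally show ?thesis .
  qed
  have i: "(\<lambda>z. \<theta> z *\<^sub>R M z (partial 1 \<phi>)) integrable_on {0..r}"
    "(\<lambda>z. partial 1 \<theta> z *\<^sub>R M z \<phi>) integrable_on {0..r}"
    "(\<lambda>z. \<theta> z *\<^sub>R (b z *\<^sub>R M z \<phi>)) integrable_on {0..r}"
    by (intro integrable_continuous_interval continuous_intros c\<theta> sub[OF cM[OF \<phi>]] sub[OF cM[OF \<phi>']] sub[OF b])+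
  have nth: "integral {0..r} F $ i = integral {0..r} (\<lambda>z. F z $ i)" if "F integrable_on {0..r}" for F :: "real \<Rightarrow> real^4"
    using integral_linear[OF that bounded_linear_vec_nth[of i]] by (simp add: o_def)
  have "dist_deriv (0, 1) (glue M) T = matA c *v dist_deriv (1, 0) (glue M) T
      + matB c *v glue (\<lambda>z \<phi>. b z *\<^sub>R M z \<phi>) T"
    using M T unfolding ibvp_solution_def by blast
  then have "- glue M (partial (0, 1) T) $ i = - (spd c i * glue M (partial (1, 0) T) $ i)
      + (matB c *v glue (\<lambda>z \<phi>. b z *\<^sub>R M z \<phi>) T) $ i"
    unfolding dist_deriv_def vec_eq_iff by (simp add: matA_spd)
  then have "spd c i * integral {0..r} (\<lambda>z. (partial 1 \<theta> z *\<^sub>R M z \<phi>) $ i)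
     = integral {0..r} (\<lambda>z. (\<theta> z *\<^sub>R M z (partial 1 \<phi>)) $ i)
       + integral {0..r} (\<lambda>z. (matB c *v (\<theta> z *\<^sub>R (b z *\<^sub>R M z \<phi>))) $ i)"
    unfolding g1 g2 g3 integral_matrix_vector_mult[OF i(3), symmetric]
      nth[OF i(1)] nth[OF i(2)] nth[OF integrable_matrix_vector_mult[OF i(3)]] by simp
  also have "\<dots> = integral {0..r} (\<lambda>z. (\<theta> z *\<^sub>R M z (partial 1 \<phi>)) $ i + (matB c *v (\<theta> z *\<^sub>R (b z *\<^sub>R M z \<phi>))) $ i)"
    by (rule Henstock_Kurzweil_Integration.integral_add[symmetric])
      (use integrable_linear[OF i(1) bounded_linear_vec_nth[of i]]
        integrable_linear[OF integrable_matrix_vector_mult[OF i(3)] bounded_linear_vec_nth[of i]] in \<open>simp_all add: o_def\<close>)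
  also have "\<dots> = integral {0..r} (\<lambda>z. - (\<theta> z *\<^sub>R (- M z (partial 1 \<phi>) $ i - b z * (matB c *v M z \<phi>) $ i)))"
    by (rule integral_cong) (simp add: matrix_vector_mult_scaleR algebra_simps)
  also have "\<dots> = - integral {0..} (\<lambda>z. \<theta> z * (- M z (partial 1 \<phi>) $ i - b z * (matB c *v M z \<phi>) $ i))"
    using cut[of \<theta> "\<lambda>z. - M z (partial 1 \<phi>) $ i - b z * (matB c *v M z \<phi>) $ i", OF lr(3)] by simp
  finally have *: "spd c i * integral {0..r} (\<lambda>z. (partial 1 \<theta> z *\<^sub>R M z \<phi>) $ i)
     = - integral {0..} (\<lambda>z. \<theta> z * (- M z (partial 1 \<phi>) $ i - b z * (matB c *v M z \<phi>) $ i))" .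
  have "integral {0..} (\<lambda>z. partial 1 \<theta> z * (spd c i * M z \<phi> $ i)) = integral {0..r} (\<lambda>z. partial 1 \<theta> z *\<^sub>R (spd c i * M z \<phi> $ i))"
    using cut[of "partial 1 \<theta>" "\<lambda>z. spd c i * M z \<phi> $ i", OF \<theta>'] by simp
  also have "\<dots> = integral {0..r} (\<lambda>z. spd c i * (partial 1 \<theta> z *\<^sub>R M z \<phi>) $ i)"
    by (rule integral_cong) simp
  also have "\<dots> = spd c i * integral {0..r} (\<lambda>z. (partial 1 \<theta> z *\<^sub>R M z \<phi>) $ i)"
    by (rule integral_mult_right)
  finally show "integral {0..} (\<lambda>z. partial 1 \<theta> z * (spd c i * M z \<phi> $ i))
     = - integral {0..} (\<lambda>z. \<theta> z * (- M z (partial 1 \<phi>) $ i - b z * (matB c *v M z \<phi>) $ i))"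
    using * by simp
qed

section \<open>Translates of test functions and regularity of mollifications in t\<close>

lemma DERIV_quadratic_bound:
  fixes f :: "real \<Rightarrow> real"
  assumes "\<delta> > 0" and bd: "\<And>h. \<bar>h\<bar> < \<delta> \<Longrightarrow> \<bar>f (x + h)\<bar> \<le> K * h\<^sup>2"
  shows "(f has_real_derivative 0) (at x)"
proof -
  have f0: "f x = 0" using bd[of 0] assms(1) by simp
  have K0: "\<bar>h\<bar> < \<delta> \<Longrightarrow> h \<noteq> 0 \<Longrightarrow> \<bar>f (x + h) / h\<bar> \<le> \<bar>K * h\<bar>" for h
  proof -
    assume h: "\<bar>h\<bar> < \<delta>" "h \<noteq> 0"
    have "\<bar>f (x + h) / h\<bar> = \<bar>f (x + h)\<bar> / \<bar>h\<bar>" by simp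
    also have "\<dots> \<le> K * h\<^sup>2 / \<bar>h\<bar>" by (rule divide_right_mono[OF bd[OF h(1)]]) simp
    also have "\<dots> \<le> \<bar>K * h\<^sup>2\<bar> / \<bar>h\<bar>" by (intro divide_right_mono) auto
    also have "\<dots> = \<bar>K * h\<bar>"
    proof -
      have "\<bar>K * h\<^sup>2\<bar> = \<bar>K * h\<bar> * \<bar>h\<bar>" by (simp add: power2_eq_square abs_mult)
      then show ?thesis using h(2) by simp
    qed
    finally show ?thesis .
  qed
  have "((\<lambda>h. f (x + h) / h) \<longlongrightarrow> 0) (at 0)"
  proof (rule Lim_null_comparison)
    show "\<forall>\<^sub>F h in at 0. norm (f (x + h) / h) \<le> \<bar>K * h\<bar>"
      unfolding eventually_at using K0 assms(1) by (intro exI[of _ \<delta>]) (auto simp: dist_real_def)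
    have "((\<lambda>h. \<bar>K * h\<bar>) \<longlongrightarrow> \<bar>K * 0\<bar>) (at 0)" by (intro tendsto_intros)
    then show "((\<lambda>h. \<bar>K * h\<bar>) \<longlongrightarrow> 0) (at 0)" by simp
  qed
  then show ?thesis by (simp add: DERIV_def f0)
qed

lemma tests_on_shift:
  assumes "\<phi> \<in> tests_on r" "\<bar>t\<bar> \<le> R - r"
  shows "(\<lambda>x. \<phi> (x - t)) \<in> tests_on R"
proof -
  have "smooth (\<lambda>x. \<phi> (x - t))"
    using assms(1) smooth_affine[of \<phi> 1 1 "- t"] by (simp add: tests_on_def)
  moreover have "\<phi> (x - t) = 0" if "\<bar>x\<bar> > R" for x
  proof -
    have "\<bar>x - t\<bar> > r" using that assms(2) by linarith
    then show ?thesis using assms(1) by (simp add: tests_on_def)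
  qed
  ultimately show ?thesis by (simp add: tests_on_def)
qed

lemma tests_on_add:
  assumes "\<phi> \<in> tests_on R" "\<psi> \<in> tests_on R"
  shows "(\<lambda>x. \<phi> x + \<psi> x) \<in> tests_on R"
  using assms by (auto simp: tests_on_def intro: smooth_add)

lemma tests_on_cmult:
  assumes "\<phi> \<in> tests_on R"
  shows "(\<lambda>x. a * \<phi> x) \<in> tests_on R"
  using assms smooth_affine[of \<phi> a 1 0] by (auto simp: tests_on_def)

lemma tests_on_partial:
  assumes "\<phi> \<in> tests_on R"
  shows "partial 1 \<phi> \<in> tests_on R"
proof -
  have "supp \<phi> \<subseteq> {-R..R}" by (rule supp_subset) (use assms in \<open>auto simp: tests_on_def\<close>)
  then have "partial 1 \<phi> x = 0" if "\<bar>x\<bar> > R" for x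
  proof (intro partial_outside_supp notI)
    assume "x \<in> supp \<phi>"
    with \<open>supp \<phi> \<subseteq> {-R..R}\<close> have "x \<in> {-R..R}" by blast
    with that show False by auto
  qed
  then show ?thesis using assms by (auto simp: tests_on_def intro: smooth_partial)
qed

lemma dern_Suc': "dern (Suc k) \<phi> = dern k (partial 1 \<phi>)"
  unfolding funpow_Suc_right o_apply ..

text \<open>The mean value theorem for each derivative, at the cost of one order. With bounds
  uniform in z it makes the pairing with translates Lipschitz in t. Subtraction is written with
  \<open>- 1 *\<close> to fit \<open>distribution_add\<close> and
  \<open>distribution_cmult\<close>.\<close>

lemma dbound_shift_diff:
  assumes \<phi>: "smooth \<phi>" and b: "dbound (Suc N) \<phi> B"
  shows "dbound N (\<lambda>x. \<phi> (x - t) + - 1 * \<phi> (x - s)) (B * \<bar>t - s\<bar>)"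
  unfolding dbound_def
proof (intro allI impI)
  fix k x assume k: "k \<le> N"
  have sh: "smooth (\<lambda>x. \<phi> (x - t))" for t using smooth_affine[OF \<phi>, of 1 1 "- t"] by simp
  have sh': "smooth (\<lambda>x. - 1 * \<phi> (x - t))" for t using smooth_affine[OF \<phi>, of "- 1" 1 "- t"] by simp
  have "dern k (\<lambda>x. \<phi> (x - t) + - 1 * \<phi> (x - s)) x = dern k \<phi> (x - t) - dern k \<phi> (x - s)"
    unfolding dern_add[OF sh sh'] dern_cmult[OF sh] dern_shift[OF \<phi>] by simp
  also have "norm \<dots> \<le> B * norm ((x - t) - (x - s))"
  proof (rule field_differentiable_bound[of UNIV])
    show "(dern k \<phi> has_real_derivative dern (Suc k) \<phi> y) (at y within UNIV)" for y
      using smooth_real_derivative[OF smooth_dern[OF \<phi>, of k]] by simp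
    show "norm (dern (Suc k) \<phi> y) \<le> B" for y
      using b k unfolding dbound_def by (metis Suc_le_mono real_norm_def)
  qed auto
  finally show "\<bar>dern k (\<lambda>x. \<phi> (x - t) + - 1 * \<phi> (x - s)) x\<bar> \<le> B * \<bar>t - s\<bar>"
    by (simp add: abs_minus_commute)
qed

text \<open>First-order Taylor expansion of a translate in its shift, at the cost of two orders; the
  linear term has a plus sign because the shift enters with a minus. It gives differentiability of
  the pairing in t with a remainder uniform in z.\<close>

lemma dbound_shift_taylor:
  assumes \<phi>: "smooth \<phi>" and b: "dbound (Suc (Suc N)) \<phi> B"
  shows "dbound N (\<lambda>x. (\<phi> (x - (t + h)) + - 1 * \<phi> (x - t)) + h * partial 1 \<phi> (x - t)) (B * h\<^sup>2)"
  unfolding dbound_def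
proof (intro allI impI)
  fix k x assume k: "k \<le> N"
  have \<phi>': "smooth (partial 1 \<phi>)" using \<phi> by (auto intro: smooth_partial)
  have sh: "smooth (\<lambda>x. f (x - t))" if "smooth f" for t and f :: "real \<Rightarrow> real"
    using smooth_affine[OF that, of 1 1 "- t"] by simp
  have sh': "smooth (\<lambda>x. a * f (x - t))" if "smooth f" for t a and f :: "real \<Rightarrow> real"
    using smooth_affine[OF that, of a 1 "- t"] by simp
  define g where "g = dern k \<phi>"
  define g' where "g' = dern (Suc k) \<phi>"
  define g'' where "g'' = dern (Suc (Suc k)) \<phi>"
  have d: "(g has_real_derivative g' y) (at y within S)" "(g' has_real_derivative g'' y) (at y within S)" for y S
    using smooth_real_derivative[OF smooth_dern[OF \<phi>, of k]] smooth_real_derivative[OF smooth_dern[OF \<phi>, of "Suc k"]]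
    by (auto simp: g_def g'_def g''_def intro: has_field_derivative_at_within)
  have b'': "norm (g'' y) \<le> B" for y
    using b k unfolding dbound_def g''_def by (metis Suc_le_mono real_norm_def)
  have B0: "B \<ge> 0" using b''[of 0] norm_ge_zero order_trans by blast
  define y where "y = x - t"
  have "dern k (\<lambda>x. (\<phi> (x - (t + h)) + - 1 * \<phi> (x - t)) + h * partial 1 \<phi> (x - t)) x
     = (g (x - (t + h)) - g (x - t)) + h * g' (x - t)"
    unfolding dern_add[OF smooth_add[OF sh[OF \<phi>] sh'[OF \<phi>]] sh'[OF \<phi>']] dern_add[OF sh[OF \<phi>] sh'[OF \<phi>]]
      dern_cmult[OF sh[OF \<phi>]] dern_cmult[OF sh[OF \<phi>']] dern_shift[OF \<phi>] dern_shift[OF \<phi>']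
    by (simp add: g_def g'_def dern_Suc' del: funpow.simps)
  also have "\<dots> = (g (y - h) + h * g' y) - (g (y - 0) + 0 * g' y)"
    by (simp add: y_def algebra_simps)
  \<comment> \<open>The mean value theorem is used twice: for s \<mapsto> g(y - s) + s g'(y), and
    for its derivative g'(y) - g'(y - s), which it bounds by
    \<open>B * \<bar>h\<bar>\<close>.\<close>
  also have "norm \<dots> \<le> (B * \<bar>h\<bar>) * norm (h - 0)"
  proof (rule field_differentiable_bound[of "{-\<bar>h\<bar>..\<bar>h\<bar>}"])
    fix s assume s: "s \<in> {-\<bar>h\<bar>..\<bar>h\<bar>}"
    have "((\<lambda>s. g (y - s)) has_real_derivative g' (y - s) * (- 1)) (at s within {-\<bar>h\<bar>..\<bar>h\<bar>})"
      by (rule DERIV_chain2[OF d(1)]) (auto intro!: derivative_eq_intros)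
    then show "((\<lambda>s. g (y - s) + s * g' y) has_real_derivative (g' y - g' (y - s))) (at s within {-\<bar>h\<bar>..\<bar>h\<bar>})"
      by (auto intro!: derivative_eq_intros)
    have "norm (g' y - g' (y - s)) \<le> B * norm (y - (y - s))"
      by (rule field_differentiable_bound[of UNIV g' g'', OF convex_UNIV d(2) b'']) auto
    also have "\<dots> \<le> B * \<bar>h\<bar>" using s B0 by (intro mult_left_mono) auto
    finally show "norm (g' y - g' (y - s)) \<le> B * \<bar>h\<bar>" .
  qed auto
  finally show "\<bar>dern k (\<lambda>x. (\<phi> (x - (t + h)) + - 1 * \<phi> (x - t)) + h * partial 1 \<phi> (x - t)) x\<bar> \<le> B * h\<^sup>2"
    by (simp add: power2_eq_square mult.assoc)
qed

text \<open>Separate continuity would not suffice; a Lipschitz constant in t that is independent of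
  z makes the continuity joint.\<close>

lemma continuous_on_Times_Lipschitz:
  fixes u :: "real \<times> real \<Rightarrow> 'b::real_normed_vector"
  assumes c: "\<And>t. t \<in> T \<Longrightarrow> continuous_on J (\<lambda>z. u (z, t))"
    and L: "\<And>z t s. z \<in> J \<Longrightarrow> t \<in> T \<Longrightarrow> s \<in> T \<Longrightarrow> norm (u (z, t) - u (z, s)) \<le> K * \<bar>t - s\<bar>"
  shows "continuous_on (J \<times> T) u"
  unfolding continuous_on_iff
proof (intro ballI allI impI)
  fix p and e :: real assume p: "p \<in> J \<times> T" and e: "e > 0"
  obtain z t where zt: "p = (z, t)" "z \<in> J" "t \<in> T" using p by auto
  obtain d where d: "d > 0" "\<And>z'. z' \<in> J \<Longrightarrow> dist z' z < d \<Longrightarrow> dist (u (z', t)) (u (z, t)) < e / 2"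
    using c[OF zt(3)] zt(2) e unfolding continuous_on_iff by (meson half_gt_zero)
  define k where "k = min d (e / (2 * (\<bar>K\<bar> + 1)))"
  show "\<exists>k>0. \<forall>q\<in>J \<times> T. dist q p < k \<longrightarrow> dist (u q) (u p) < e"
  proof (intro exI[of _ k] conjI ballI impI)
    show "k > 0" using d e by (simp add: k_def)
    fix q assume q: "q \<in> J \<times> T" "dist q p < k"
    obtain z' t' where q': "q = (z', t')" "z' \<in> J" "t' \<in> T" using q by auto
    have dz: "dist z' z < d" and dt: "\<bar>t' - t\<bar> < e / (2 * (\<bar>K\<bar> + 1))"
      using q dist_fst_le[of q p] dist_snd_le[of q p] by (auto simp: q' zt k_def dist_real_def)
    have "norm (u (z', t') - u (z', t)) \<le> K * \<bar>t' - t\<bar>" using L q' zt by blast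
    also have "\<dots> \<le> (\<bar>K\<bar> + 1) * \<bar>t' - t\<bar>" by (intro mult_right_mono) auto
    also have "\<dots> < (\<bar>K\<bar> + 1) * (e / (2 * (\<bar>K\<bar> + 1)))" using dt by (intro mult_strict_left_mono) auto
    also have "\<dots> = e / 2" by (simp add: field_simps)
    finally have "dist (u (z', t')) (u (z', t)) < e / 2" by (simp add: dist_norm)
    moreover have "dist (u (z', t)) (u (z, t)) < e / 2" by (rule d(2)[OF q'(2) dz])
    ultimately show "dist (u q) (u p) < e"
      unfolding q' zt using dist_triangle[of "u (z', t')" "u (z, t)" "u (z', t)"] by linarith
  qed
qed

text \<open>Since the coefficients do not depend on \<open>t\<close>, convolving with a test function in \<open>t\<close> turns a
  distributional solution into a classical one, to which \<open>zero_by_characteristics\<close> applies. The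
  uniform boundedness principle supplies the joint regularity in \<open>(z, t)\<close>.\<close>

lemma distributional_solution_zero:
  fixes D :: "real \<Rightarrow> (real \<Rightarrow> real) \<Rightarrow> real^4"
  assumes c: "0 < c" "c < 1" and b: "continuous_on {0..} b"
    and dist: "\<And>z. z \<ge> 0 \<Longrightarrow> distribution_on UNIV (D z)"
    and cont: "\<And>\<phi>. \<phi> \<in> test_functions UNIV \<Longrightarrow> continuous_on {0..} (\<lambda>z. D z \<phi>)"
    and ode: "\<And>\<phi> z i. \<phi> \<in> test_functions UNIV \<Longrightarrow> z > 0 \<Longrightarrow>
      ((\<lambda>z. spd c i * D z \<phi> $ i) has_real_derivative
        - D z (partial 1 \<phi>) $ i - b z * (matB c *v D z \<phi>) $ i) (at z)"
    and bc: "\<And>\<phi>. \<phi> \<in> test_functions UNIV \<Longrightarrow> D 0 \<phi> $ 2 = 0 \<and> D 0 \<phi> $ 4 = 0"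
    and past: "\<And>z \<phi>. z \<ge> 0 \<Longrightarrow> \<phi> \<in> test_functions {..<0} \<Longrightarrow> D z \<phi> = 0"
    and z0: "z0 \<ge> 0" and \<phi>: "\<phi> \<in> test_functions UNIV"
  shows "D z0 \<phi> = 0"
proof -
  obtain r where r: "r > 0" "\<And>x. \<bar>x\<bar> > r \<Longrightarrow> \<phi> x = 0" by (rule test_function_bounds[OF \<phi>], rule that)
  have sm: "smooth \<phi>" by (rule test_functionsD(1)[OF \<phi>])
  have \<phi>r: "\<phi> \<in> tests_on r" using sm r by (simp add: tests_on_def)
  \<comment> \<open>At time \<open>t1\<close> the translated support lies in
    \<open>[t1 - r, t1 + r]\<close>, hence in t < 0, where \<open>past\<close> applies.\<close>
  define t1 where "t1 = - r - 1"
  define L where "L = z0 - t1 + 1"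
  \<comment> \<open>Shifts from \<open>{t1 - 1..z0 + 1}\<close> have size at most
    \<open>r + 2 + z0\<close>, so all translates lie in \<open>tests_on R\<close>. The extra 1 at
    both ends of this time interval leaves room for difference quotients.\<close>
  define R where "R = r + (r + 2 + z0)"
  have shift: "(\<lambda>x. \<psi> (x - t)) \<in> tests_on R" if "\<psi> \<in> tests_on r" "t \<in> {t1 - 1..z0 + 1}" for \<psi> t
    by (rule tests_on_shift[OF that(1)]) (use that(2) r z0 in \<open>auto simp: R_def t1_def\<close>)
  note test = tests_on_test[OF shift]
  obtain C N where C: "C \<ge> 0"
    and CN: "\<And>z \<psi> B. z \<in> {0..L} \<Longrightarrow> \<psi> \<in> tests_on R \<Longrightarrow> dbound N \<psi> B \<Longrightarrow> norm (D z \<psi>) \<le> C * B"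
  proof (rule distributions_uniformly_bounded[where J = "{0..L}" and u = D and R = R])
    show "distribution_on UNIV (D z)" if "z \<in> {0..L}" for z using that by (intro dist) simp
    show "bounded ((\<lambda>z. D z \<psi>) ` {0..L})" if "\<psi> \<in> test_functions UNIV" for \<psi>
      by (intro compact_imp_bounded compact_continuous_image continuous_on_subset[OF cont[OF that]]) auto
  qed (rule that)
  \<comment> \<open>The convolution in t; \<open>u \<phi> (z0, 0)\<close> is the value to be shown
    to vanish.\<close>
  define u where "u \<psi> p = D (fst p) (\<lambda>x. \<psi> (x - snd p))" for \<psi> :: "real \<Rightarrow> real" and p :: "real \<times> real"
  have dbe: "\<exists>B\<ge>0. dbound n \<psi> B" if "\<psi> \<in> tests_on r" for n \<psi>
    using test_function_bounded_dern[OF tests_on_test[OF that], of n] unfolding dbound_def by metis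
  have Lip: "\<exists>K. \<forall>z\<in>{0..L}. \<forall>t\<in>{t1 - 1..z0 + 1}. \<forall>s\<in>{t1 - 1..z0 + 1}.
      norm (u \<psi> (z, t) - u \<psi> (z, s)) \<le> K * \<bar>t - s\<bar>" if \<psi>: "\<psi> \<in> tests_on r" for \<psi>
  proof -
    obtain B where B: "dbound (Suc N) \<psi> B" using dbe[OF \<psi>] by blast
    have "norm (u \<psi> (z, t) - u \<psi> (z, s)) \<le> (C * B) * \<bar>t - s\<bar>"
      if h: "z \<in> {0..L}" "t \<in> {t1 - 1..z0 + 1}" "s \<in> {t1 - 1..z0 + 1}" for z t s
    proof -
      have dz: "distribution_on UNIV (D z)" using h by (intro dist) simp
      have "u \<psi> (z, t) - u \<psi> (z, s) = D z (\<lambda>x. \<psi> (x - t) + - 1 * \<psi> (x - s))"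
        using distribution_add[OF dz test[OF \<psi> h(2)] tests_on_test[OF tests_on_cmult[OF shift[OF \<psi> h(3)]]], of "- 1"]
          distribution_cmult[OF dz test[OF \<psi> h(3)], of "- 1"] by (simp add: u_def)
      also have "norm \<dots> \<le> C * (B * \<bar>t - s\<bar>)"
      proof (rule CN[OF h(1)])
        show "(\<lambda>x. \<psi> (x - t) + - 1 * \<psi> (x - s)) \<in> tests_on R"
          by (intro tests_on_add tests_on_cmult shift \<psi> h)
        show "dbound N (\<lambda>x. \<psi> (x - t) + - 1 * \<psi> (x - s)) (B * \<bar>t - s\<bar>)"
          by (rule dbound_shift_diff[OF _ B]) (use \<psi> in \<open>simp add: tests_on_def\<close>)
      qed
      finally show ?thesis by (simp add: mult.assoc)
    qed
    then show ?thesis by blast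
  qed
  have cu: "continuous_on ({0..L} \<times> {t1 - 1..z0 + 1}) (u \<psi>)" if \<psi>: "\<psi> \<in> tests_on r" for \<psi>
  proof -
    obtain K where "\<And>z t s. z \<in> {0..L} \<Longrightarrow> t \<in> {t1 - 1..z0 + 1} \<Longrightarrow> s \<in> {t1 - 1..z0 + 1} \<Longrightarrow>
      norm (u \<psi> (z, t) - u \<psi> (z, s)) \<le> K * \<bar>t - s\<bar>" using Lip[OF \<psi>] by blast
    then show ?thesis
    proof (rule continuous_on_Times_Lipschitz[rotated])
      show "continuous_on {0..L} (\<lambda>z. u \<psi> (z, t))" if "t \<in> {t1 - 1..z0 + 1}" for t
        unfolding u_def fst_conv snd_conv by (rule continuous_on_subset[OF cont[OF test[OF \<psi> that]]]) auto
    qed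
  qed
  define \<phi>' where "\<phi>' = partial 1 \<phi>"
  have \<phi>'r: "\<phi>' \<in> tests_on r" unfolding \<phi>'_def by (rule tests_on_partial[OF \<phi>r])
  obtain B where B: "dbound (Suc (Suc N)) \<phi> B" using dbe[OF \<phi>r] by blast
  have taylor: "norm (u \<phi> (z, t + h) - u \<phi> (z, t) + h *\<^sub>R u \<phi>' (z, t)) \<le> C * (B * h\<^sup>2)"
    if h: "z \<in> {0..L}" "t \<in> {t1 - 1..z0 + 1}" "t + h \<in> {t1 - 1..z0 + 1}" for z t h
  proof -
    have dz: "distribution_on UNIV (D z)" using h by (intro dist) simp
    let ?a = "\<lambda>x. \<phi> (x - (t + h))" and ?b = "\<lambda>x. - 1 * \<phi> (x - t)" and ?d = "\<lambda>x. h * \<phi>' (x - t)"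
    have ts: "?a \<in> tests_on R" "?b \<in> tests_on R" "?d \<in> tests_on R"
      by (intro tests_on_cmult shift \<phi>r \<phi>'r h)+
    have "D z (\<lambda>x. (?a x + ?b x) + ?d x) = (D z ?a + D z ?b) + D z ?d"
      using distribution_add[OF dz tests_on_test[OF tests_on_add[OF ts(1,2)]] tests_on_test[OF ts(3)]]
        distribution_add[OF dz tests_on_test[OF ts(1)] tests_on_test[OF ts(2)]] by simp
    also have "D z ?b = - 1 *\<^sub>R u \<phi> (z, t)"
      using distribution_cmult[OF dz test[OF \<phi>r h(2)], of "- 1"] by (simp add: u_def)
    also have "D z ?d = h *\<^sub>R u \<phi>' (z, t)"
      using distribution_cmult[OF dz test[OF \<phi>'r h(2)], of h] by (simp add: u_def)
    also have "D z ?a = u \<phi> (z, t + h)" by (simp add: u_def)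
    finally have "u \<phi> (z, t + h) - u \<phi> (z, t) + h *\<^sub>R u \<phi>' (z, t) = D z (\<lambda>x. (?a x + ?b x) + ?d x)" by simp
    also have "norm \<dots> \<le> C * (B * h\<^sup>2)"
    proof (rule CN[OF h(1)])
      show "(\<lambda>x. (?a x + ?b x) + ?d x) \<in> tests_on R" by (intro tests_on_add ts)
      show "dbound N (\<lambda>x. (?a x + ?b x) + ?d x) (B * h\<^sup>2)"
        unfolding \<phi>'_def by (rule dbound_shift_taylor[OF sm B])
    qed
    finally show ?thesis .
  qed
  \<comment> \<open>The path changes z and t together. The increment in t is expanded by
    \<open>taylor\<close> at the already displaced z, with a uniform remainder, while the increment
    in z at fixed t is governed by \<open>ode\<close>. At velocity \<open>- spd c i\<close> the
    terms with \<open>\<phi>'\<close> cancel.\<close>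
  have path: "((\<lambda>\<tau>. u \<phi> (z + (- spd c i) * (\<tau> - t), \<tau>) $ i) has_real_derivative
      b (z + (- spd c i) * (\<tau> - t)) * (matB c *v u \<phi> (z + (- spd c i) * (\<tau> - t), \<tau>)) $ i) (at \<tau>)"
    if h: "z + (- spd c i) * (\<tau> - t) \<in> {0<..<L}" "\<tau> \<in> {t1 - 1<..<z0 + 1}" for z t \<tau> i
  proof -
    define v where "v = - spd c i"
    define y where "y = z + v * (\<tau> - t)"
    define f where "f h = u \<phi> (y + v * h, \<tau> + h) $ i" for h
    have tau: "\<tau> \<in> {t1 - 1..z0 + 1}" using h by auto
    have y: "y \<in> {0<..<L}" using h by (simp add: y_def v_def)
    define \<delta> where "\<delta> = Min {y, L - y, \<tau> - (t1 - 1), z0 + 1 - \<tau>} / 2"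
    have v1: "\<bar>v\<bar> \<le> 1" using c exhaust_4[of i] by (auto simp: v_def spd_def)
    have \<delta>: "\<delta> > 0" using y h by (simp add: \<delta>_def)
    have le: "2 * \<delta> \<le> y" "2 * \<delta> \<le> L - y" "2 * \<delta> \<le> \<tau> - (t1 - 1)" "2 * \<delta> \<le> z0 + 1 - \<tau>"
      by (simp_all add: \<delta>_def)
    have near: "y + v * h \<in> {0<..<L}" "\<tau> + h \<in> {t1 - 1..z0 + 1}" if "\<bar>h\<bar> < \<delta>" for h
    proof -
      have "\<bar>v * h\<bar> \<le> 1 * \<bar>h\<bar>" unfolding abs_mult using v1 by (intro mult_right_mono) auto
      then show "y + v * h \<in> {0<..<L}" using that le \<delta> by auto
      show "\<tau> + h \<in> {t1 - 1..z0 + 1}" using that le by auto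
    qed
    \<comment> \<open>The Taylor remainder at the displaced point; being quadratic in h, it has
      derivative 0 at h = 0.\<close>
    define e where "e h = f h - u \<phi> (y + v * h, \<tau>) $ i + h * u \<phi>' (y + v * h, \<tau>) $ i" for h
    have "\<bar>e (0 + h)\<bar> \<le> (C * B) * h\<^sup>2" if "\<bar>h\<bar> < \<delta>" for h
    proof -
      have "e (0 + h) = (u \<phi> (y + v * h, \<tau> + h) - u \<phi> (y + v * h, \<tau>) + h *\<^sub>R u \<phi>' (y + v * h, \<tau>)) $ i"
        by (simp add: e_def f_def)
      also have "\<bar>\<dots>\<bar> \<le> C * (B * h\<^sup>2)"
        by (rule order_trans[OF component_le_norm_cart taylor]) (use near[OF that] tau in auto)
      finally show ?thesis by (simp add: mult.assoc)
    qed
    from DERIV_quadratic_bound[OF \<delta> this] have de: "(e has_real_derivative 0) (at 0)" .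
    have du: "((\<lambda>h. spd c i * u \<phi> (y + v * h, \<tau>) $ i) has_real_derivative
       (- u \<phi>' (y, \<tau>) $ i - b y * (matB c *v u \<phi> (y, \<tau>)) $ i) * v) (at 0)"
    proof (rule DERIV_chain2[where f = "\<lambda>z. spd c i * u \<phi> (z, \<tau>) $ i"])
      have "partial 1 (\<lambda>x. \<phi> (x - \<tau>)) = (\<lambda>x. \<phi>' (x - \<tau>))"
        using dern_shift[OF sm, of 1 \<tau>] by (simp add: \<phi>'_def)
      then show "((\<lambda>z. spd c i * u \<phi> (z, \<tau>) $ i) has_real_derivative
          - u \<phi>' (y, \<tau>) $ i - b y * (matB c *v u \<phi> (y, \<tau>)) $ i) (at (y + v * 0))"
        using ode[OF test[OF \<phi>r tau], of y i] y by (simp add: u_def)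
      show "((\<lambda>h. y + v * h) has_real_derivative v) (at 0)"
        by (auto intro!: derivative_eq_intros)
    qed
    have s0: "spd c i \<noteq> 0" using c exhaust_4[of i] by (auto simp: spd_def)
    have du': "((\<lambda>h. u \<phi> (y + v * h, \<tau>) $ i) has_real_derivative
       u \<phi>' (y, \<tau>) $ i + b y * (matB c *v u \<phi> (y, \<tau>)) $ i) (at 0)"
    proof -
      have "((\<lambda>h. (1 / spd c i) * (spd c i * u \<phi> (y + v * h, \<tau>) $ i)) has_real_derivative
        (1 / spd c i) * ((- u \<phi>' (y, \<tau>) $ i - b y * (matB c *v u \<phi> (y, \<tau>)) $ i) * v)) (at 0)"
        by (rule DERIV_cmult[OF du])
      moreover have "(1 / spd c i) * ((- u \<phi>' (y, \<tau>) $ i - b y * (matB c *v u \<phi> (y, \<tau>)) $ i) * v)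
         = u \<phi>' (y, \<tau>) $ i + b y * (matB c *v u \<phi> (y, \<tau>)) $ i"
        using s0 by (simp add: v_def)
      ultimately show ?thesis using s0 by simp
    qed
    \<comment> \<open>A product h g(h) has derivative g(0) at 0 as soon as g is continuous there, so
      continuity in z of the pairing with \<open>\<phi>'\<close> is enough.\<close>
    have dh: "((\<lambda>h. h * u \<phi>' (y + v * h, \<tau>) $ i) has_real_derivative u \<phi>' (y, \<tau>) $ i) (at 0)"
    proof -
      have c1: "continuous_on {0<..<L} (\<lambda>z. u \<phi>' (z, \<tau>) $ i)"
        unfolding u_def fst_conv snd_conv
        by (intro continuous_intros continuous_on_subset[OF cont[OF test[OF \<phi>'r tau]]]) auto
      then have "isCont (\<lambda>z. u \<phi>' (z, \<tau>) $ i) y"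
        using y by (simp add: continuous_on_eq_continuous_at)
      moreover have "((\<lambda>h. y + v * h) \<longlongrightarrow> y) (at 0)" by (auto intro!: tendsto_eq_intros)
      ultimately have lim: "((\<lambda>h. u \<phi>' (y + v * h, \<tau>) $ i) \<longlongrightarrow> u \<phi>' (y, \<tau>) $ i) (at 0)"
        by (rule isCont_tendsto_compose)
      have "((\<lambda>h. (h * u \<phi>' (y + v * h, \<tau>) $ i) / h) \<longlongrightarrow> u \<phi>' (y, \<tau>) $ i) (at 0)"
        by (rule Lim_transform_eventually[OF lim]) (auto simp: eventually_at intro!: exI[of _ 1])
      then show ?thesis by (simp add: DERIV_def)
    qed
    have "((\<lambda>h. e h + u \<phi> (y + v * h, \<tau>) $ i - h * u \<phi>' (y + v * h, \<tau>) $ i) has_real_derivative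
      0 + (u \<phi>' (y, \<tau>) $ i + b y * (matB c *v u \<phi> (y, \<tau>)) $ i) - u \<phi>' (y, \<tau>) $ i) (at 0)"
      by (intro DERIV_add DERIV_diff de du' dh)
    moreover have "(\<lambda>h. e h + u \<phi> (y + v * h, \<tau>) $ i - h * u \<phi>' (y + v * h, \<tau>) $ i) = f"
      by (simp add: e_def fun_eq_iff)
    ultimately have "(f has_real_derivative b y * (matB c *v u \<phi> (y, \<tau>)) $ i) (at (\<tau> - \<tau>))" by simp
    then have "((\<lambda>x. f (x - \<tau>)) has_real_derivative b y * (matB c *v u \<phi> (y, \<tau>)) $ i) (at \<tau>)"
      using DERIV_shift[of f _ \<tau> "- \<tau>"] by simp
    moreover have "(\<lambda>x. f (x - \<tau>)) = (\<lambda>\<tau>. u \<phi> (z + v * (\<tau> - t), \<tau>) $ i)"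
      by (simp add: f_def y_def fun_eq_iff algebra_simps)
    ultimately show ?thesis by (simp add: y_def v_def)
  qed
  have early: "u \<phi> (z, t) = 0" if "z \<ge> 0" "t = t1" for z t
  proof -
    have "(\<lambda>x. \<phi> (x - t)) \<in> test_functions {..<0}"
    proof (rule test_functionI[of _ "{t - r..t + r}"])
      show "smooth (\<lambda>x. \<phi> (x - t))" using smooth_affine[OF sm, of 1 1 "- t"] by simp
      show "{t - r..t + r} \<subseteq> {..<0}" using that by (auto simp: t1_def)
      show "\<phi> (x - t) = 0" if "x \<notin> {t - r..t + r}" for x using that by (intro r(2)) auto
    qed simp
    from past[OF that(1) this] show ?thesis by (simp add: u_def)
  qed
  have left: "u \<phi> (0, t) $ 2 = 0" "u \<phi> (0, t) $ 4 = 0" if "t \<in> {t1 - 1..z0 + 1}" for t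
    using bc[OF test[OF \<phi>r that]] by (simp_all add: u_def)
  \<comment> \<open>The backward domain of dependence of (z0, 0): speeds are at most 1, so z + t
    does not increase backwards in time.\<close>
  define S where "S = {p. 0 \<le> fst p \<and> t1 \<le> snd p \<and> fst p + snd p \<le> z0}"
  have S: "S \<subseteq> {0..L} \<times> {t1 - 1..z0 + 1}" using z0 by (auto simp: S_def L_def t1_def)
  have "closed S" unfolding S_def by (intro closed_Collect_conj closed_Collect_le continuous_intros)
  moreover have "bounded S" by (rule bounded_subset[OF _ S]) (intro bounded_Times; simp)
  ultimately have cS: "compact S" by (simp add: compact_eq_bounded_closed)
  obtain K where K: "K \<ge> 0" "\<And>x i. \<bar>(matB c *v x) $ i\<bar> \<le> K * norm x" using matB_bound[of c] by blast
  have "bounded (b ` {0..L})"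
    by (intro compact_imp_bounded compact_continuous_image continuous_on_subset[OF b]) auto
  then obtain b1 where b1: "b1 > 0" "\<And>z. z \<in> {0..L} \<Longrightarrow> \<bar>b z\<bar> \<le> b1" unfolding bounded_pos by auto
  have "u \<phi> (z0, 0) = 0"
  proof (rule zero_by_characteristics[OF cS continuous_on_subset[OF cu[OF \<phi>r] S], of "b1 * K"])
    show "b1 * K \<ge> 0" using b1 K by simp
    show "(z0, 0) \<in> S" using z0 r by (simp add: S_def t1_def)
    fix z t i assume zt: "(z, t) \<in> S"
    define w where "w = \<bar>spd c i\<bar>"
    have w: "0 < w" "w \<le> 1" using c exhaust_4[of i] by (auto simp: w_def spd_def)
    \<comment> \<open>Backwards in time, components 1 and 3 travel right and meet no boundary before
      \<open>t1\<close>; components 2 and 4 travel left and stop at z = 0 if they reach it after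
      \<open>t1\<close>.\<close>
    define t0 where "t0 = (if i = 1 \<or> i = 3 then t1 else max t1 (t - z / w))"
    have h: "0 \<le> z" "t1 \<le> t" "z + t \<le> z0" using zt by (auto simp: S_def)
    have t0: "t0 \<le> t" "t1 \<le> t0" using h w by (auto simp: t0_def)
    have pos: "0 \<le> z + (- spd c i) * (\<tau> - t) \<and> z + (- spd c i) * (\<tau> - t) + \<tau> \<le> z0 \<and>
        (t0 < \<tau> \<longrightarrow> \<tau> < t \<longrightarrow> 0 < z + (- spd c i) * (\<tau> - t))" if \<tau>: "\<tau> \<in> {t0..t}" for \<tau>
    proof -
      have wt: "0 \<le> w * (t - \<tau>)" "w * (t - \<tau>) \<le> t - \<tau>" "\<tau> < t \<Longrightarrow> 0 < w * (t - \<tau>)"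
        using w \<tau> mult_right_mono[of w 1 "t - \<tau>"] by auto
      show ?thesis
      proof (cases "i = 1 \<or> i = 3")
        case True
        then have "(- spd c i) * (\<tau> - t) = w * (t - \<tau>)" using c by (auto simp: w_def spd_def algebra_simps)
        then show ?thesis using wt h by auto
      next
        case False
        then have i: "i = 2 \<or> i = 4" using exhaust_4[of i] by blast
        then have eq: "(- spd c i) * (\<tau> - t) = - (w * (t - \<tau>))" using c by (auto simp: w_def spd_def algebra_simps)
        have "t - z / w \<le> t0" using False by (simp add: t0_def)
        then have "w * (t - t0) \<le> z" using w by (simp add: field_simps)
        moreover have "w * (t - \<tau>) \<le> w * (t - t0)" "t0 < \<tau> \<Longrightarrow> w * (t - \<tau>) < w * (t - t0)"
          using \<tau> w by auto
        ultimately show ?thesis unfolding eq using wt h \<tau> by auto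
      qed
    qed
    have start: "u \<phi> (z + (- spd c i) * (t0 - t), t0) $ i = 0"
    proof (cases "t0 = t1")
      case True
      then show ?thesis using early[of "z + (- spd c i) * (t0 - t)" t0] pos[of t0] t0 by simp
    next
      case False
      then have i: "i = 2 \<or> i = 4" and e: "t0 = t - z / w" using exhaust_4[of i] by (auto simp: t0_def max_def split: if_splits)
      have "z + (- spd c i) * (t0 - t) = 0"
        using i c w by (auto simp: e w_def spd_def)
      moreover have "t0 \<in> {t1 - 1..z0 + 1}" using t0 h z0 by auto
      ultimately show ?thesis using left[of t0] i by auto
    qed
    have inS: "(z + (- spd c i) * (\<tau> - t), \<tau>) \<in> S" if "\<tau> \<in> {t0..t}" for \<tau>
      using pos[OF that] that t0 by (auto simp: S_def)
    have der: "\<exists>d. ((\<lambda>\<tau>. u \<phi> (z + (- spd c i) * (\<tau> - t), \<tau>) $ i) has_real_derivative d) (at \<tau>) \<and>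
         \<bar>d\<bar> \<le> b1 * K * norm (u \<phi> (z + (- spd c i) * (\<tau> - t), \<tau>))" if \<tau>: "\<tau> \<in> {t0<..<t}" for \<tau>
    proof (intro exI conjI)
      let ?y = "z + (- spd c i) * (\<tau> - t)"
      have "0 < ?y" "?y + \<tau> \<le> z0" using pos[of \<tau>] \<tau> by auto
      then have y: "?y \<in> {0<..<L}" "\<tau> \<in> {t1 - 1<..<z0 + 1}" using \<tau> t0 by (auto simp: L_def)
      show "((\<lambda>\<tau>. u \<phi> (z + (- spd c i) * (\<tau> - t), \<tau>) $ i) has_real_derivative
        b ?y * (matB c *v u \<phi> (?y, \<tau>)) $ i) (at \<tau>)"
        by (rule path[OF y])
      have "\<bar>b ?y * (matB c *v u \<phi> (?y, \<tau>)) $ i\<bar> \<le> b1 * (K * norm (u \<phi> (?y, \<tau>)))"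
        unfolding abs_mult using b1 y by (intro mult_mono K(2) b1(2)) auto
      then show "\<bar>b ?y * (matB c *v u \<phi> (?y, \<tau>)) $ i\<bar> \<le> b1 * K * norm (u \<phi> (?y, \<tau>))"
        by (simp add: mult.assoc)
    qed
    show "\<exists>t0 v. t0 \<le> t \<and> (\<forall>\<tau>\<in>{t0..t}. (z + v * (\<tau> - t), \<tau>) \<in> S) \<and>
      u \<phi> (z + v * (t0 - t), t0) $ i = 0 \<and>
      (\<forall>\<tau>\<in>{t0<..<t}. \<exists>d. ((\<lambda>\<tau>. u \<phi> (z + v * (\<tau> - t), \<tau>) $ i) has_real_derivative d) (at \<tau>) \<and>
         \<bar>d\<bar> \<le> b1 * K * norm (u \<phi> (z + v * (\<tau> - t), \<tau>)))"
      by (intro exI[of _ t0] exI[of _ "- spd c i"] conjI ballI t0(1) start inS der)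
  qed
  then show ?thesis by (simp add: u_def)
qed

section \<open>Uniqueness for the initial boundary value problem, and the theorem\<close>

lemma distribution_on_diff:
  assumes u: "distribution_on S u" and v: "distribution_on S v"
  shows "distribution_on S (\<lambda>\<phi>. u \<phi> - v \<phi>)"
proof -
  have "\<exists>C N. \<forall>\<phi>\<in>test_functions S. \<forall>b. supp \<phi> \<subseteq> K \<longrightarrow>
      (\<forall>vs x. set vs \<subseteq> Basis \<and> length vs \<le> N \<longrightarrow> \<bar>partials vs \<phi> x\<bar> \<le> b) \<longrightarrow> norm (u \<phi> - v \<phi>) \<le> C * b"
    if K: "compact K \<and> K \<subseteq> S" for K
  proof -
    obtain C N where 1: "\<And>\<phi> b. \<phi> \<in> test_functions S \<Longrightarrow> supp \<phi> \<subseteq> K \<Longrightarrow>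
      (\<forall>vs x. set vs \<subseteq> Basis \<and> length vs \<le> N \<longrightarrow> \<bar>partials vs \<phi> x\<bar> \<le> b) \<Longrightarrow> norm (u \<phi>) \<le> C * b"
      using u K unfolding distribution_on_def by meson
    obtain C' N' where 2: "\<And>\<phi> b. \<phi> \<in> test_functions S \<Longrightarrow> supp \<phi> \<subseteq> K \<Longrightarrow>
      (\<forall>vs x. set vs \<subseteq> Basis \<and> length vs \<le> N' \<longrightarrow> \<bar>partials vs \<phi> x\<bar> \<le> b) \<Longrightarrow> norm (v \<phi>) \<le> C' * b"
      using v K unfolding distribution_on_def by meson
    show ?thesis
    proof (intro exI[of _ "C + C'"] exI[of _ "max N N'"] ballI allI impI)
      fix \<phi> b assume h: "\<phi> \<in> test_functions S" "supp \<phi> \<subseteq> K"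
        "\<forall>vs x. set vs \<subseteq> Basis \<and> length vs \<le> max N N' \<longrightarrow> \<bar>partials vs \<phi> x\<bar> \<le> b"
      have "norm (u \<phi>) \<le> C * b" by (rule 1[OF h(1,2)]) (use h(3) in \<open>simp add: le_max_iff_disj\<close>)
      moreover have "norm (v \<phi>) \<le> C' * b" by (rule 2[OF h(1,2)]) (use h(3) in \<open>simp add: le_max_iff_disj\<close>)
      ultimately show "norm (u \<phi> - v \<phi>) \<le> (C + C') * b"
        using norm_triangle_ineq4[of "u \<phi>" "v \<phi>"] by (simp add: distrib_right)
    qed
  qed
  with u v show ?thesis
    unfolding distribution_on_def by (simp add: algebra_simps)
qed

lemma ibvp_solution_unique:
  assumes c: "0 < c" "c < 1" and b: "continuous_on {0..} b"
    and M: "ibvp_solution c b M" and N: "ibvp_solution c b N"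
    and z: "z \<ge> 0" and \<phi>: "\<phi> \<in> test_functions UNIV"
  shows "M z \<phi> = N z \<phi>"
proof -
  have "M z \<phi> - N z \<phi> = 0"
  proof (rule distributional_solution_zero[where D = "\<lambda>z \<phi>. M z \<phi> - N z \<phi>", OF c b])
    fix z :: real assume "z \<ge> 0"
    with M N show "distribution_on UNIV (\<lambda>\<phi>. M z \<phi> - N z \<phi>)"
      unfolding ibvp_solution_def by (intro distribution_on_diff) blast+
  next
    fix \<phi> :: "real \<Rightarrow> real" assume "\<phi> \<in> test_functions UNIV"
    with M N show "continuous_on {0..} (\<lambda>z. M z \<phi> - N z \<phi>)"
      unfolding ibvp_solution_def by (intro continuous_on_diff) blast+
  next
    fix \<phi> :: "real \<Rightarrow> real" and z :: real and i
    assume h: "\<phi> \<in> test_functions UNIV" "z > 0"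
    show "((\<lambda>z. spd c i * (M z \<phi> - N z \<phi>) $ i) has_real_derivative
        - (M z (partial 1 \<phi>) - N z (partial 1 \<phi>)) $ i - b z * (matB c *v (M z \<phi> - N z \<phi>)) $ i) (at z)"
      using DERIV_diff[OF ibvp_solution_derivative[OF M c(1) b h] ibvp_solution_derivative[OF N c(1) b h]]
      by (simp add: algebra_simps matrix_vector_mult_diff_distrib)
  next
    fix \<phi> :: "real \<Rightarrow> real" assume "\<phi> \<in> test_functions UNIV"
    with M N show "(M 0 \<phi> - N 0 \<phi>) $ 2 = 0 \<and> (M 0 \<phi> - N 0 \<phi>) $ 4 = 0"
      unfolding ibvp_solution_def by simp
  next
    fix \<phi> :: "real \<Rightarrow> real" and z :: real assume "z \<ge> 0" "\<phi> \<in> test_functions {..<0}"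
    with M N show "M z \<phi> - N z \<phi> = 0"
      unfolding ibvp_solution_def by simp
  qed (rule z \<phi>)+
  then show ?thesis by simp
qed

text \<open>A test function supported in t < 2Z - z sees, among the times t \<ge> z, only those with
  (z, t) in \<open>char_region Z\<close>, so there a function \<open>n\<close> that agrees with the
  quadrant solution on this region may replace it.\<close>

lemma (in quadrant_solution) sol_eq_regular:
  assumes z: "z \<in> {0..Z}" and \<phi>: "\<phi> \<in> test_functions {..<2 * Z - z}"
    and n: "\<And>p. p \<in> char_region Z \<Longrightarrow> m (fst p, snd p - fst p) = n p"
  shows "sol z \<phi> = dirac z \<phi> *\<^sub>R vector [0, 1, 0, 0] + regular_dist (\<lambda>t. heaviside (t - z) *\<^sub>R n (z, t)) \<phi>"
proof -
  obtain R where R: "R > 0" "\<And>x. \<bar>x\<bar> > R \<Longrightarrow> \<phi> x = 0" by (rule test_function_bounds[OF \<phi>], rule that)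
  have zero: "\<phi> t = 0" if "t \<ge> 2 * Z - z" for t
    using test_functionsD(3)[OF \<phi>] that by (intro not_in_supp) auto
  have "regular_dist (\<lambda>t. heaviside (t - z) *\<^sub>R n (z, t)) \<phi>
     = integral {z..z + R} (\<lambda>t. \<phi> t *\<^sub>R (heaviside (t - z) *\<^sub>R n (z, t)))"
    unfolding regular_dist_def
  proof (rule integral_restrict_support)
    fix t assume "t \<in> UNIV - {z..z + R}"
    then have "t < z \<or> \<bar>t\<bar> > R" using z by auto
    then show "\<phi> t *\<^sub>R (heaviside (t - z) *\<^sub>R n (z, t)) = 0"
      using R(2)[of t] by (auto simp: heaviside_def)
  qed simp
  also have "\<dots> = integral {z..z + R} (\<lambda>t. \<phi> t *\<^sub>R m (z, t - z))"
  proof (rule integral_cong)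
    fix t assume t: "t \<in> {z..z + R}"
    show "\<phi> t *\<^sub>R (heaviside (t - z) *\<^sub>R n (z, t)) = \<phi> t *\<^sub>R m (z, t - z)"
    proof (cases "t \<le> 2 * Z - z")
      case True
      then have "(z, t) \<in> char_region Z" using z t by (auto simp: char_region_def)
      from n[OF this] show ?thesis using t by (simp add: heaviside_def)
    next
      case False
      then show ?thesis using zero[of t] by simp
    qed
  qed
  also have "\<dots> = integral {0..R} (\<lambda>s. \<phi> (z + s) *\<^sub>R m (z, s))"
    using integral_shift_real_ivl[of z z "z + R" "\<lambda>t. \<phi> t *\<^sub>R m (z, t - z)"] by (simp add: add.commute)
  finally show ?thesis
    using sol_cut[of R \<phi> z] R z by (simp add: dirac_def)
qed

lemma C1_deriv_on_continuous: "C1_deriv_on S f f' \<Longrightarrow> continuous_on S f"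
  unfolding C1_deriv_on_def by (meson DERIV_continuous continuous_on_eq_continuous_within)

theorem theorem1p1:
  fixes c Z :: real and \<beta> :: "real \<Rightarrow> real"
  assumes "0 < c" and "c < 1" and "0 < Z" and "\<beta> \<in> C1_dot Z"
  shows "\<exists>m. char_solution c \<beta> Z m \<and>
    (\<forall>m'. char_solution c \<beta> Z m' \<longrightarrow> (\<forall>p\<in>char_region Z. m' p = m p)) \<and>
    (\<forall>\<beta>e. C1_on {0..} \<beta>e \<and> (\<forall>z\<in>{0..Z}. \<beta>e z = \<beta> z) \<longrightarrow>
      (\<exists>M. ibvp_solution c \<beta>e M) \<and>
      (\<forall>M. ibvp_solution c \<beta>e M \<longrightarrow>
        (\<forall>z\<in>{0..Z}. \<forall>\<phi>\<in>test_functions {..<2 * Z - z}.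
          M z \<phi> = dirac z \<phi> *\<^sub>R vector [0, 1, 0, 0] +
            regular_dist (\<lambda>t. heaviside (t - z) *\<^sub>R m (z, t)) \<phi>)))"
proof -
  note c = assms(1,2)
  obtain \<beta>' where \<beta>: "C1_deriv_on {0..Z} \<beta> \<beta>'" "\<beta> 0 = 0" "\<beta>' 0 = 0"
    using assms(4) by (auto simp: C1_dot_def)
  have c\<beta>: "continuous_on {0..Z} \<beta>"
    by (rule C1_deriv_on_continuous[OF \<beta>(1)])
  \<comment> \<open>This extension of \<open>\<beta>\<close> serves to construct \<open>n\<close>
    and is independent of the extensions \<open>\<beta>e\<close> for which the initial boundary
    value problem is solved.\<close>
  obtain b b' where b: "char_system c b b'" "\<And>z. z \<in> {0..Z} \<Longrightarrow> b z = \<beta> z"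
    using char_system_extend[OF c _ \<beta>] assms(3) by metis
  obtain m mz ms where m: "quadrant_solution c b b' m mz ms"
    using char_system.ex_quadrant_solution[OF b(1)] by metis
  define n where "n = (\<lambda>(z, t). m (z, t - z))"
  have n: "char_solution c \<beta> Z n"
    unfolding n_def by (rule quadrant_solution.char_solution_of_quadrant[OF m b(2)])
  have uniq: "m' p = n p" if "char_solution c \<beta> Z m'" "p \<in> char_region Z" for m' p
    by (rule char_solution_unique[OF c c\<beta> n that])
  have "(\<exists>M. ibvp_solution c \<beta>e M) \<and>
      (\<forall>M. ibvp_solution c \<beta>e M \<longrightarrow>
        (\<forall>z\<in>{0..Z}. \<forall>\<phi>\<in>test_functions {..<2 * Z - z}.
          M z \<phi> = dirac z \<phi> *\<^sub>R vector [0, 1, 0, 0] +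
            regular_dist (\<lambda>t. heaviside (t - z) *\<^sub>R n (z, t)) \<phi>))"
    if \<beta>e: "C1_on {0..} \<beta>e" "\<forall>z\<in>{0..Z}. \<beta>e z = \<beta> z" for \<beta>e
  proof -
    obtain \<beta>e' where \<beta>e': "C1_deriv_on {0..} \<beta>e \<beta>e'" using \<beta>e(1) by (auto simp: C1_on_def)
    have ce: "continuous_on {0..} \<beta>e"
      by (rule C1_deriv_on_continuous[OF \<beta>e'])
    have e0: "\<beta>e 0 = 0" using \<beta>e(2) \<beta>(2) assms(3) by simp
    \<comment> \<open>The one-sided derivative at 0 is determined by the values on
      \<open>{0..Z}\<close>, so every extension inherits the vanishing derivative and can be
      continued by zero to z < 0.\<close>
    have "\<beta>e' 0 = \<beta>' 0"
    proof (rule vector_derivative_unique_within_closed_interval[of 0 Z 0 \<beta>, unfolded cbox_interval])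
      show "(\<beta> has_vector_derivative \<beta>' 0) (at 0 within {0..Z})"
        using \<beta>(1) assms(3) by (auto simp: C1_deriv_on_def simp flip: has_real_derivative_iff_has_vector_derivative)
      have "(\<beta>e has_vector_derivative \<beta>e' 0) (at 0 within {0..Z})"
        using \<beta>e' by (auto simp: C1_deriv_on_def simp flip: has_real_derivative_iff_has_vector_derivative
            intro: DERIV_subset)
      then show "(\<beta> has_vector_derivative \<beta>e' 0) (at 0 within {0..Z})"
        by (rule has_vector_derivative_transform[rotated 2]) (use \<beta>e(2) assms(3) in auto)
    qed (use assms(3) in auto)
    then have e1: "\<beta>e' 0 = 0" using \<beta>(3) by simp
    obtain g g' where g: "char_system c g g'" "\<And>z. z \<in> {0..} \<Longrightarrow> g z = \<beta>e z"
      using char_system_extend[OF c _ \<beta>e' e0 e1] by metis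
    obtain k kz ks where k: "quadrant_solution c g g' k kz ks"
      using char_system.ex_quadrant_solution[OF g(1)] by metis
    interpret k: quadrant_solution c g g' k kz ks by (rule k)
    have sol: "ibvp_solution c \<beta>e k.sol"
      by (rule k.ibvp_solution_sol) (use g(2) in simp)
    \<comment> \<open>The solution built from \<open>\<beta>e\<close> may differ from
      \<open>m\<close> elsewhere, but on \<open>char_region Z\<close> both solve the problem with
      coefficient \<open>\<beta>\<close>, and \<open>uniq\<close> identifies them.\<close>
    have "char_solution c \<beta> Z (\<lambda>(z, t). k (z, t - z))"
      by (rule k.char_solution_of_quadrant) (use g(2) \<beta>e(2) in simp)
    from uniq[OF this] have kn: "k (fst p, snd p - fst p) = n p" if "p \<in> char_region Z" for p
      using that by (simp add: case_prod_unfold)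
    have "M z \<phi> = dirac z \<phi> *\<^sub>R vector [0, 1, 0, 0] + regular_dist (\<lambda>t. heaviside (t - z) *\<^sub>R n (z, t)) \<phi>"
      if M: "ibvp_solution c \<beta>e M" and z: "z \<in> {0..Z}" and \<phi>: "\<phi> \<in> test_functions {..<2 * Z - z}" for M z \<phi>
    proof -
      have "M z \<phi> = k.sol z \<phi>"
        by (rule ibvp_solution_unique[OF c ce M sol]) (use z subsetD[OF test_functions_mono[OF subset_UNIV] \<phi>] in auto)
      also have "\<dots> = dirac z \<phi> *\<^sub>R vector [0, 1, 0, 0] + regular_dist (\<lambda>t. heaviside (t - z) *\<^sub>R n (z, t)) \<phi>"
        by (rule k.sol_eq_regular[OF z \<phi> kn])
      finally show ?thesis .
    qed
    with sol show ?thesis by blast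
  qed
  with n uniq show ?thesis by (intro exI[of _ n]) blast
qed

end
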